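(* Let $\beta$ be a positive $n$-braid word. Then the 2-form $\omega_{\beta\cdot\Delta^2}$ induces a 2-form on the augmentation variety $\mathrm{Aug}(\beta,\mathfrak t_c)\cong X_0(\beta\Delta;w_0)/T_c$ that has maximal rank at every point. Thus, the augmentation variety of any positive braid is holomorphic symplectic.
   Context: All varieties are over $\mathbb{C}$. A positive $n$-braid word is a finite sequence $\beta=\sigma_{i_1}\cdots\sigma_{i_\ell}$, $\ell(\beta)=\ell$. $B_i(z)$ is the identity $n\times n$ matrix except for the block $\begin{pmatrix}0&1\\1&z\end{pmatrix}$ in rows and columns $i,i+1$; $B_\beta(z)=B_{i_1}(z_1)\cdots B_{i_\ell}(z_\ell)$. Permutations are viewed as permutation matrices with $s_i\mapsto B_i(0)$; $w_0\in S_n$ is the longest element; $\Delta=(\sigma_1\cdots\sigma_{n-1})(\sigma_1\cdots\sigma_{n-2})\cdots(\sigma_1\sigma_2)\sigma_1$, $\Delta^2=\Delta\Delta$. $X_0(\beta;\pi)=\{z: B_\beta(z)\pi\text{ upper-triangular}\}$, $X_0(\beta)=X_0(\beta;1)$. $X_0(\beta\Delta;w_0)$ is embedded in $X_0(\beta\Delta^2)$ by $z\mapsto(z,0,\dots,0)$. 2-form: for matrix-valued functions $f,g$ with values in $\mathrm{GL}(n,\mathbb{C})$ let $(f|g)=\mathrm{Tr}(f^{-1}df\wedge dg\,g^{-1})$. For a word $\eta=\sigma_{i_1}\cdots\sigma_{i_r}$, $\omega_\eta=\sum_{k=2}^{r}\big(B_{i_1}(z_1)\cdots B_{i_{k-1}}(z_{k-1})\,\big|\,B_{i_k}(z_k)\big)$,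 a 2-form on $\mathbb{C}^r$. $\omega_{\beta\cdot\Delta^2}$ is restricted to $X_0(\beta\Delta^2)$ and then to $X_0(\beta\Delta;w_0)$; the induced form on the quotient is the 2-form whose pullback to $X_0(\beta\Delta;w_0)$ is this restriction. Torus: for $\mathbf t\in(\mathbb{C}^* )^n$ and a word $\sigma_{i_1}\cdots\sigma_{i_r}$, $\mathbf t.(z_1,\dots,z_r)=(c_1z_1,\dots,c_rz_r)$ with $c_k=t_{w_k(i_k+1)}t_{w_k(i_k)}^{-1}$, $w_k=s_{i_1}\cdots s_{i_{k-1}}$. Let $w=s_{i_1}\cdots s_{i_\ell}\in S_n$ be the permutation of $\beta$; choose one element $a_j$ in each of its cycles (fixed points included). $T_c=\{\mathbf t: t_{a_j}=1\text{ for all }j\}$; it acts freely on $X_0(\beta\Delta;w_0)$. Augmentation variety: $\Lambda(\beta)\subset(\mathbb{R}^3,\xi_{\mathrm{st}})$ is the Legendrian link whose front is the rainbow closure of $\beta$; $\mathfrak t_c$ is a choice of one marked point per component of $\Lambda(\beta)$, located to the right of all crossings of $\beta$ and before the right cusps; $\mathrm{Aug}(\beta,\mathfrak t_c)=\mathrm{Spec}\,H^0(\mathcal A(\beta,\mathfrak t_c))$ with $\mathcal A$ the commutative Legendrian contact DGA of $\Lambda(\beta)$ with these marked points (base changed to $\mathbb{C}$). It is identified with $X_0(\beta\Delta;w_0)/T_c$.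
   Formalization: The restricted 2-form need not be a pullback from the quotient (n=3, β=σ₁σ₂: it is −dz₁∧dz₂/(z₁z₂), the quotient a point). "Induced form" here means its restriction along a canonical section of the quotient; it equals the form with the stated pullback whenever one exists. *)

theory Defs
  imports
    "HOL-Analysis.Analysis"
    "HOL-Combinatorics.Orbits"
    "Jordan_Normal_Form.Gauss_Jordan_Elimination"
begin

section \<open>Affine varieties, morphisms, quotients and 2-forms\<close>

text \<open>
  A point (or tangent vector) of the coordinate space \<open>\<complex>\<^sup>I\<close>, for a finite index set \<open>I\<close>,
  is a function that vanishes outside \<open>I\<close>.  In particular \<open>\<complex>\<^sup>r\<close> (with \<open>I = {..<r}\<close>) is literally
  contained in \<open>\<complex>\<^sup>r\<^sup>'\<close> for \<open>r \<le> r'\<close>, by appending zeros.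
\<close>

definition coord_space :: "'i set \<Rightarrow> ('i \<Rightarrow> complex) set" where
  "coord_space I = {x. \<forall>i. i \<notin> I \<longrightarrow> x i = 0}"

definition dderiv :: "(('i \<Rightarrow> complex) \<Rightarrow> complex) \<Rightarrow> ('i \<Rightarrow> complex) \<Rightarrow> ('i \<Rightarrow> complex) \<Rightarrow> complex" where
  "dderiv f x v = deriv (\<lambda>s. f (\<lambda>i. x i + s * v i)) 0"

definition dmap :: "(('i \<Rightarrow> complex) \<Rightarrow> 'j \<Rightarrow> complex) \<Rightarrow> ('i \<Rightarrow> complex) \<Rightarrow> ('i \<Rightarrow> complex) \<Rightarrow> 'j \<Rightarrow> complex" where
  "dmap f x v = (\<lambda>j. dderiv (\<lambda>x. f x j) x v)"

text \<open>
  An affine scheme of finite type, presented as the spectrum of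
  \<open>\<complex>[x\<^sub>i (i \<in> idx), x\<^sub>j\<^sup>-\<^sup>1 (j \<in> invs)] / (eqs)\<close>, with \<open>invs \<subseteq> idx\<close>.
\<close>

record 'i aff_scheme =
  idx :: "'i set"
  invs :: "'i set"
  eqs :: "(('i \<Rightarrow> complex) \<Rightarrow> complex) set"

definition points :: "'i aff_scheme \<Rightarrow> ('i \<Rightarrow> complex) set" where
  "points V = {x \<in> coord_space (idx V). (\<forall>j\<in>invs V. x j \<noteq> 0) \<and> (\<forall>f\<in>eqs V. f x = 0)}"

text \<open>The Zariski tangent space at a closed point.\<close>

definition tangent :: "'i aff_scheme \<Rightarrow> ('i \<Rightarrow> complex) \<Rightarrow> ('i \<Rightarrow> complex) set" where
  "tangent V x = {v \<in> coord_space (idx V). \<forall>f\<in>eqs V. dderiv f x v = 0}"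

inductive_set regular :: "'i aff_scheme \<Rightarrow> (('i \<Rightarrow> complex) \<Rightarrow> complex) set" for V where
  const: "(\<lambda>x. c) \<in> regular V"
| coord: "i \<in> idx V \<Longrightarrow> (\<lambda>x. x i) \<in> regular V"
| inv_coord: "j \<in> invs V \<Longrightarrow> (\<lambda>x. inverse (x j)) \<in> regular V"
| add: "f \<in> regular V \<Longrightarrow> g \<in> regular V \<Longrightarrow> (\<lambda>x. f x + g x) \<in> regular V"
| mult: "f \<in> regular V \<Longrightarrow> g \<in> regular V \<Longrightarrow> (\<lambda>x. f x * g x) \<in> regular V"

text \<open>Jacobian criterion: the differentials of the defining equations are linearly independent
  at every point.\<close>

definition smooth :: "'i aff_scheme \<Rightarrow> bool" where
  "smooth V \<longleftrightarrow> (\<forall>x\<in>points V. \<forall>b. \<exists>v\<in>coord_space (idx V). \<forall>f\<in>eqs V. dderiv f x v = b f)"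

definition morphism :: "'i aff_scheme \<Rightarrow> 'j aff_scheme \<Rightarrow> (('i \<Rightarrow> complex) \<Rightarrow> 'j \<Rightarrow> complex) \<Rightarrow> bool" where
  "morphism V W f \<longleftrightarrow>
     (\<forall>j\<in>idx W. (\<lambda>x. f x j) \<in> regular V) \<and> (\<forall>x. f x \<in> coord_space (idx W)) \<and>
     f ` points V \<subseteq> points W"

text \<open>
  \<open>q\<close> exhibits \<open>W\<close> as the geometric quotient of \<open>V\<close> by a (free) action of the group \<open>G\<close>:
  the fibres are the orbits, \<open>q\<close> is a submersion, and the functions on \<open>W\<close> are the invariant
  functions on \<open>V\<close>.
\<close>

definition geometric_quotient ::
  "'i aff_scheme \<Rightarrow> (('i \<Rightarrow> complex) \<Rightarrow> 'i \<Rightarrow> complex) set \<Rightarrow> 'j aff_scheme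
    \<Rightarrow> (('i \<Rightarrow> complex) \<Rightarrow> 'j \<Rightarrow> complex) \<Rightarrow> bool" where
  "geometric_quotient V G W q \<longleftrightarrow>
     morphism V W q \<and> q ` points V = points W \<and>
     (\<forall>x\<in>points V. \<forall>y\<in>points V. q x = q y \<longleftrightarrow> (\<exists>g\<in>G. y = g x)) \<and>
     (\<forall>x\<in>points V. dmap q x ` tangent V x = tangent W (q x)) \<and>
     (\<forall>f\<in>regular V. (\<forall>x\<in>points V. \<forall>g\<in>G. f (g x) = f x) \<longrightarrow>
        (\<exists>h\<in>regular W. \<forall>x\<in>points V. f x = h (q x)))"

text \<open>A 2-form assigns to a point an alternating bilinear form on tangent vectors.\<close>

type_synonym 'i two_form = "('i \<Rightarrow> complex) \<Rightarrow> ('i \<Rightarrow> complex) \<Rightarrow> ('i \<Rightarrow> complex) \<Rightarrow> complex"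

text \<open>\<open>\<Sum>\<^sub>i\<^sub>j c\<^sub>i\<^sub>j dx\<^sub>i \<and> dx\<^sub>j\<close> and its exterior derivative \<open>\<Sum>\<^sub>i\<^sub>j dc\<^sub>i\<^sub>j \<and> dx\<^sub>i \<and> dx\<^sub>j\<close>.\<close>

definition coeff_form :: "'i set \<Rightarrow> ('i \<Rightarrow> 'i \<Rightarrow> ('i \<Rightarrow> complex) \<Rightarrow> complex) \<Rightarrow> 'i two_form" where
  "coeff_form I c x u v = (\<Sum>i\<in>I. \<Sum>j\<in>I. c i j x * (u i * v j - v i * u j))"

definition d_coeff_form ::
  "'i set \<Rightarrow> ('i \<Rightarrow> 'i \<Rightarrow> ('i \<Rightarrow> complex) \<Rightarrow> complex) \<Rightarrow>
    ('i \<Rightarrow> complex) \<Rightarrow> ('i \<Rightarrow> complex) \<Rightarrow> ('i \<Rightarrow> complex) \<Rightarrow> ('i \<Rightarrow> complex) \<Rightarrow> complex" where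
  "d_coeff_form I c x u v w = (\<Sum>i\<in>I. \<Sum>j\<in>I.
      dderiv (c i j) x u * (v i * w j - w i * v j)
    + dderiv (c i j) x v * (w i * u j - u i * w j)
    + dderiv (c i j) x w * (u i * v j - v i * u j))"

text \<open>On a smooth affine variety every algebraic form extends to the ambient space, and the
  restriction of the exterior derivative does not depend on the extension.\<close>

definition closed_algebraic_form :: "'i aff_scheme \<Rightarrow> 'i two_form \<Rightarrow> bool" where
  "closed_algebraic_form V \<Omega> \<longleftrightarrow> (\<exists>c. (\<forall>i\<in>idx V. \<forall>j\<in>idx V. c i j \<in> regular V) \<and>
     (\<forall>x\<in>points V. \<forall>u\<in>tangent V x. \<forall>v\<in>tangent V x.
        \<Omega> x u v = coeff_form (idx V) c x u v \<and>
        (\<forall>w\<in>tangent V x. d_coeff_form (idx V) c x u v w = 0)))"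

definition maximal_rank :: "'i aff_scheme \<Rightarrow> 'i two_form \<Rightarrow> bool" where
  "maximal_rank V \<Omega> \<longleftrightarrow> (\<forall>x\<in>points V. \<forall>u\<in>tangent V x.
     (\<forall>v\<in>tangent V x. \<Omega> x u v = 0) \<longrightarrow> u = (\<lambda>_. 0))"

text \<open>The form is required to be algebraic, hence in particular holomorphic.\<close>

definition holomorphic_symplectic :: "'i aff_scheme \<Rightarrow> 'i two_form \<Rightarrow> bool" where
  "holomorphic_symplectic V \<Omega> \<longleftrightarrow> smooth V \<and> closed_algebraic_form V \<Omega> \<and> maximal_rank V \<Omega>"


section \<open>Braid words and braid varieties\<close>

text \<open>
  Strands are numbered \<open>0,\<dots>,n-1\<close> from the top; the letter \<open>i\<close> of a word
  (\<open>i + 1 < n\<close>) denotes the crossing \<open>\<sigma>\<^sub>i\<^sub>+\<^sub>1\<close> of strands \<open>i\<close> and \<open>i + 1\<close>.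
\<close>

definition braid_word :: "nat \<Rightarrow> nat list \<Rightarrow> bool" where
  "braid_word n \<beta> \<longleftrightarrow> (\<forall>i\<in>set \<beta>. i + 1 < n)"

definition B :: "nat \<Rightarrow> nat \<Rightarrow> complex \<Rightarrow> complex mat" where
  "B n i z = mat n n (\<lambda>(a,b).
     if a = i \<and> b = i then 0
     else if a = i + 1 \<and> b = i + 1 then z
     else if a = i \<and> b = i + 1 \<or> a = i + 1 \<and> b = i then 1
     else if a = b then 1 else 0)"

definition braid_mat :: "nat \<Rightarrow> nat list \<Rightarrow> (nat \<Rightarrow> complex) \<Rightarrow> complex mat" where
  "braid_mat n \<beta> z = foldr (\<lambda>k M. B n (\<beta> ! k) (z k) * M) [0..<length \<beta>] (1\<^sub>m n)"

text \<open>\<open>(\<sigma>\<^sub>1\<dots>\<sigma>\<^sub>n\<^sub>-\<^sub>1)(\<sigma>\<^sub>1\<dots>\<sigma>\<^sub>n\<^sub>-\<^sub>2)\<dots>(\<sigma>\<^sub>1)\<close>\<close>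

definition delta :: "nat \<Rightarrow> nat list" where
  "delta n = concat (map (\<lambda>k. [0..<k]) (rev [1..<n]))"

definition perm_mat :: "nat \<Rightarrow> (nat \<Rightarrow> nat) \<Rightarrow> complex mat" where
  "perm_mat n \<pi> = mat n n (\<lambda>(a,b). if a = \<pi> b then 1 else 0)"

definition w0 :: "nat \<Rightarrow> nat \<Rightarrow> nat" where
  "w0 n = (\<lambda>k. if k < n then n - 1 - k else k)"

text \<open>The points of this scheme are the \<open>z\<close> for which \<open>B\<^sub>\<beta>(z)\<pi>\<close> is \<open>upper_triangular\<close>.\<close>

definition X0 :: "nat \<Rightarrow> nat list \<Rightarrow> (nat \<Rightarrow> nat) \<Rightarrow> nat aff_scheme" where
  "X0 n \<beta> \<pi> = \<lparr> idx = {..<length \<beta>}, invs = {},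
     eqs = {(\<lambda>z. (braid_mat n \<beta> z * perm_mat n \<pi>) $$ (a,b)) | a b. b < a \<and> a < n} \<rparr>"


section \<open>The 2-form\<close>

definition mtrace :: "complex mat \<Rightarrow> complex" where
  "mtrace A = (\<Sum>i<dim_row A. A $$ (i,i))"

definition dmat :: "nat \<Rightarrow> (('i \<Rightarrow> complex) \<Rightarrow> complex mat) \<Rightarrow> ('i \<Rightarrow> complex) \<Rightarrow> ('i \<Rightarrow> complex) \<Rightarrow> complex mat" where
  "dmat n f x v = mat n n (\<lambda>(a,b). dderiv (\<lambda>x. f x $$ (a,b)) x v)"

text \<open>\<open>(f|g) = Tr(f\<^sup>-\<^sup>1 df \<and> dg g\<^sup>-\<^sup>1)\<close>; only used where \<open>f\<close> and \<open>g\<close> are invertible.\<close>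

definition bracket :: "nat \<Rightarrow> (('i \<Rightarrow> complex) \<Rightarrow> complex mat) \<Rightarrow> (('i \<Rightarrow> complex) \<Rightarrow> complex mat) \<Rightarrow> 'i two_form" where
  "bracket n f g x u v =
     mtrace (the (mat_inverse (f x)) * dmat n f x u * dmat n g x v * the (mat_inverse (g x)))
   - mtrace (the (mat_inverse (f x)) * dmat n f x v * dmat n g x u * the (mat_inverse (g x)))"

definition braid_form :: "nat \<Rightarrow> nat list \<Rightarrow> nat two_form" where
  "braid_form n \<eta> z u v = (\<Sum>k=1..<length \<eta>.
     bracket n (\<lambda>z. braid_mat n (take k \<eta>) z) (\<lambda>z. B n (\<eta> ! k) (z k)) z u v)"


section \<open>The torus action\<close>

text \<open>\<open>s\<^sub>i\<^sub>1\<dots>s\<^sub>i\<^sub>r\<close>, the product being composition of functions; this matches the product of the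
  matrices \<open>B\<^sub>i(0)\<close>.\<close>

definition word_perm :: "nat list \<Rightarrow> nat \<Rightarrow> nat" where
  "word_perm \<eta> = foldr (\<lambda>i \<pi>. Transposition.transpose i (i + 1) \<circ> \<pi>) \<eta> id"

definition torus_act :: "nat list \<Rightarrow> (nat \<Rightarrow> complex) \<Rightarrow> (nat \<Rightarrow> complex) \<Rightarrow> nat \<Rightarrow> complex" where
  "torus_act \<eta> t z = (\<lambda>k. if k < length \<eta>
     then t (word_perm (take k \<eta>) (\<eta> ! k + 1)) / t (word_perm (take k \<eta>) (\<eta> ! k)) * z k
     else 0)"

text \<open>One strand in each cycle of the permutation of \<open>\<beta>\<close>, i.e. on each component of its closure.\<close>

definition cycle_transversal :: "nat \<Rightarrow> nat list \<Rightarrow> nat set \<Rightarrow> bool" where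
  "cycle_transversal n \<beta> A \<longleftrightarrow>
     A \<subseteq> {..<n} \<and> (\<forall>k<n. \<exists>!a. a \<in> A \<and> a \<in> orbit (word_perm \<beta>) k)"

definition torus_c :: "nat \<Rightarrow> nat set \<Rightarrow> (nat \<Rightarrow> complex) set" where
  "torus_c n A = {t. (\<forall>k<n. t k \<noteq> 0) \<and> (\<forall>a\<in>A. t a = 1)}"


section \<open>The augmentation variety\<close>

text \<open>
  The Legendrian contact DGA of the rainbow closure of \<open>\<beta>\<close> (resolution of the front,
  commutative version over \<open>\<complex>\<close>).  In degree 0 there are the crossings of \<open>\<beta>\<close> and one invertible
  generator for each marked point; in homological degree 1 there are the \<open>n\<close> right cusps, and there
  is nothing in negative homological degree.  Strand \<open>k\<close> of \<open>\<beta>\<close> ends at the right cusp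
  \<open>k\<close>; the cusps are nested, \<open>0\<close> being the outermost.  \<open>M\<close> is the set of strands that carry a marked
  point between \<open>\<beta>\<close> and the right cusps.

  The disks with positive corner at the cusp \<open>k\<close> (Kalman's formula) are the small teardrop,
  which contributes 1, and disks whose boundary traverses \<open>\<beta>\<close> from right to left along the upper
  strands several times.  Each traverse enters at the right on some strand, collecting the marked
  point there, turns at crossings of \<open>\<beta>\<close> and leaves at the left on some strand; the boundary then
  returns along the lower half of the closure to the right cusp of that strand.
  The strands met between the start at \<open>k\<close> and the final arrival at \<open>k\<close> form an
  itinerary of strands nested inside \<open>k\<close>, and between two visits to the same strand there is a visit
  to one further out.  The paths through \<open>\<beta>\<close> that leave at the left on strand \<open>a\<close> and
  enter at the right on strand \<open>b\<close> are counted by the entry \<open>(a,b)\<close> of \<open>B\<^sub>\<beta>(z)\<close>.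

  All signs are \<open>+\<close>; with this choice every augmentation maps the product of the marked points to
  \<open>(-1)\<^sup>c\<close>, \<open>c\<close> the number of components.  Reversing the orientation of the link replaces the
  marked points by their inverses.
\<close>

datatype gen = Crossing nat | Marked nat

definition itineraries :: "nat \<Rightarrow> nat \<Rightarrow> nat list set" where
  "itineraries n k = {s. set s \<subseteq> {k<..<n} \<and>
     (\<forall>i j. i < j \<and> j < length s \<and> s ! i = s ! j \<longrightarrow> (\<exists>m. i < m \<and> m < j \<and> s ! m < s ! i))}"

definition marking :: "nat set \<Rightarrow> (gen \<Rightarrow> complex) \<Rightarrow> nat \<Rightarrow> complex" where
  "marking M p k = (if k \<in> M then p (Marked k) else 1)"

definition disk_word :: "nat \<Rightarrow> nat list \<Rightarrow> nat set \<Rightarrow> (gen \<Rightarrow> complex) \<Rightarrow> nat \<Rightarrow> nat list \<Rightarrow> complex" where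
  "disk_word n \<beta> M p k s = (let r = k # s @ [k] in
     \<Prod>j\<le>length s. marking M p (r ! j) * braid_mat n \<beta> (\<lambda>i. p (Crossing i)) $$ (r ! Suc j, r ! j))"

definition cusp_differential :: "nat \<Rightarrow> nat list \<Rightarrow> nat set \<Rightarrow> nat \<Rightarrow> (gen \<Rightarrow> complex) \<Rightarrow> complex" where
  "cusp_differential n \<beta> M k p = 1 + (\<Sum>s\<in>itineraries n k. disk_word n \<beta> M p k s)"

text \<open>\<open>H\<^sup>0\<close> is the degree 0 part of the DGA modulo the ideal generated by the differentials of the
  cusps; the augmentation variety is its spectrum.\<close>

definition Aug :: "nat \<Rightarrow> nat list \<Rightarrow> nat set \<Rightarrow> gen aff_scheme" where
  "Aug n \<beta> M = \<lparr> idx = Crossing ` {..<length \<beta>} \<union> Marked ` M, invs = Marked ` M,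
     eqs = {cusp_differential n \<beta> M k | k. k < n} \<rparr>"

end

(* Write eta = beta Delta, Y_j for the product of the first j letters of eta at x, Y for the full
product and U = Y w0.  The matrix B_Delta(y) w0 is a generic unit lower triangular matrix L with
entries y, so a point of X_0(beta Delta; w0) is a decomposition B_beta(z) L = U with U upper
triangular.  The logarithmic derivative of a letter is an elementary matrix, so that
  omega(u,v) = 2 sum_j v_j (Y_j^-1 dY_j(u))_{i_j,i_j+1} - tr(dY(u) Y^-1 dY(v) Y^-1),
and d omega is the Cartan 3-form of Y, which vanishes where U stays upper triangular.

The torus moves every point to a unique point of the slice U_kk = -1, k not in M; on the other
side, the differentials of the cusps perform Gaussian elimination on B_beta(z) diag(tau), and their
vanishing says exactly that z lies in the slice, with tau_m = -1/U_mm.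

Nondegeneracy: if u is in the kernel of omega on the slice, Lagrange multipliers for the equations
of the slice form an upper triangular matrix S such that all the matrices
D_j = Y_j^-1 S Y_j - 2 Y_j^-1 dY_j(u) have entry 0 at (i_j,i_j+1).  Then D_j is upper triangular for
all j, its diagonal being permuted along the word, whereas the last one is lower triangular because
U is upper.  Comparing the diagonals gives S_{w(k)} = S_k - 2 dU_kk/U_kk along every cycle of w; one
marked strand per cycle forces all of them to vanish.  So the last D_j is 0, and going backwards
through the word yields u = 0.  The same argument with u = 0 shows that the equations of the
augmentation variety are independent. *)

theory Submission
  imports Defs
begin

section \<open>The ring of row-finite matrices\<close>

text \<open>The form is invariant under the torus but need not be basic: contracted with the
  infinitesimal action of tau it becomes sum_k (tau_k + tau_{w(k)}) d log U_kk on X_0(beta Delta;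
  w0). For this reason the form on the augmentation variety is obtained by restriction to a slice,
  on which d log U_kk = 0 for every unmarked k. The constant -1 of the slice comes from the cusps:
  each differential is 1 plus a pivot of the elimination. Away from the augmentation variety the
  elimination still treats its pivots as -1, so the differentials of the cusps are not those of log
  U_kk; the two families are related by a triangular change of equations, and this is how tangent
  spaces and smoothness are transferred. Matrices are infinite with finite rows, so that all sizes
  live in one ring: identities along a word are then pure ring algebra, and n enters only through
  blocks and traces.\<close>

typedef rmat = "{f :: nat \<Rightarrow> nat \<Rightarrow> complex. \<forall>i. finite {j. f i j \<noteq> 0}}"
  morphisms ent Rmat
  by (rule exI[of _ "\<lambda>_ _. 0"]) simp

lemma finite_ent [simp]: "finite {j. ent X i j \<noteq> 0}"
  using ent[of X] by simp

lemma ent_Rmat: "(\<And>i. finite {j. f i j \<noteq> 0}) \<Longrightarrow> ent (Rmat f) = f"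
  by (simp add: Rmat_inverse)

lemma rmat_eqI: "(\<And>i j. ent X i j = ent Y i j) \<Longrightarrow> X = Y"
  by (metis ent_inject ext)

instantiation rmat :: ring_1
begin

definition "0 = Rmat (\<lambda>_ _. 0)"
definition "1 = Rmat (\<lambda>i j. if i = j then 1 else 0)"
definition "X + Y = Rmat (\<lambda>i j. ent X i j + ent Y i j)"
definition "- X = Rmat (\<lambda>i j. - ent X i j)"
definition "X - Y = Rmat (\<lambda>i j. ent X i j - ent Y i j)"
definition "X * Y = Rmat (\<lambda>i k. \<Sum>j | ent X i j \<noteq> 0. ent X i j * ent Y j k)"

lemma ent_zero [simp]: "ent 0 i j = 0"
  by (simp add: zero_rmat_def ent_Rmat)

lemma ent_one: "ent 1 i j = (if i = j then 1 else 0)"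
  by (simp add: one_rmat_def ent_Rmat)

lemma ent_add [simp]: "ent (X + Y) i j = ent X i j + ent Y i j"
proof -
  have "finite {j. ent X i j + ent Y i j \<noteq> 0}" for i
    by (rule finite_subset[of _ "{j. ent X i j \<noteq> 0} \<union> {j. ent Y i j \<noteq> 0}"]) auto
  then show ?thesis by (simp add: plus_rmat_def ent_Rmat)
qed

lemma ent_uminus [simp]: "ent (- X) i j = - ent X i j"
  by (simp add: uminus_rmat_def ent_Rmat)

lemma ent_minus [simp]: "ent (X - Y) i j = ent X i j - ent Y i j"
proof -
  have "finite {j. ent X i j - ent Y i j \<noteq> 0}" for i
    by (rule finite_subset[of _ "{j. ent X i j \<noteq> 0} \<union> {j. ent Y i j \<noteq> 0}"]) auto
  then show ?thesis by (simp add: minus_rmat_def ent_Rmat)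
qed

lemma ent_times_raw: "ent (X * Y) i k = (\<Sum>j | ent X i j \<noteq> 0. ent X i j * ent Y j k)"
proof -
  have "finite {k. (\<Sum>j | ent X i j \<noteq> 0. ent X i j * ent Y j k) \<noteq> 0}" for i
  proof (rule finite_subset)
    show "{k. (\<Sum>j | ent X i j \<noteq> 0. ent X i j * ent Y j k) \<noteq> 0}
        \<subseteq> (\<Union>j\<in>{j. ent X i j \<noteq> 0}. {k. ent Y j k \<noteq> 0})"
    proof
      fix k assume "k \<in> {k. (\<Sum>j | ent X i j \<noteq> 0. ent X i j * ent Y j k) \<noteq> 0}"
      then obtain j where "j \<in> {j. ent X i j \<noteq> 0}" "ent X i j * ent Y j k \<noteq> 0"
        by (metis (mono_tags, lifting) mem_Collect_eq sum.neutral)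
      then show "k \<in> (\<Union>j\<in>{j. ent X i j \<noteq> 0}. {k. ent Y j k \<noteq> 0})" by auto
    qed
    show "finite (\<Union>j\<in>{j. ent X i j \<noteq> 0}. {k. ent Y j k \<noteq> 0})" by auto
  qed
  then show ?thesis by (simp add: times_rmat_def ent_Rmat)
qed

lemma ent_times:
  assumes "finite J" "\<And>j. j \<notin> J \<Longrightarrow> ent X i j = 0"
  shows "ent (X * Y) i k = (\<Sum>j\<in>J. ent X i j * ent Y j k)"
  unfolding ent_times_raw by (rule sum.mono_neutral_left) (use assms in auto)

instance
proof
  fix X Y Z :: rmat
  show "X * Y * Z = X * (Y * Z)"
  proof (rule rmat_eqI)
    fix i l
    define J where "J = {j. ent X i j \<noteq> 0}"
    define K where "K = (\<Union>j\<in>J. {k. ent Y j k \<noteq> 0})"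
    have J: "finite J" "\<And>j. j \<notin> J \<Longrightarrow> ent X i j = 0" by (auto simp: J_def)
    have K: "finite K" "\<And>j k. j \<in> J \<Longrightarrow> k \<notin> K \<Longrightarrow> ent Y j k = 0"
      using J by (auto simp: K_def)
    have XY: "ent (X * Y) i k = (\<Sum>j\<in>J. ent X i j * ent Y j k)" for k
      by (rule ent_times[OF J])
    have "ent (X * Y * Z) i l = (\<Sum>k\<in>K. ent (X * Y) i k * ent Z k l)"
      by (rule ent_times) (auto simp: XY K)
    also have "\<dots> = (\<Sum>j\<in>J. \<Sum>k\<in>K. ent X i j * (ent Y j k * ent Z k l))"
      unfolding XY sum_distrib_right by (subst sum.swap) (simp add: mult.assoc)
    also have "\<dots> = (\<Sum>j\<in>J. ent X i j * ent (Y * Z) j l)"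
      by (intro sum.cong refl)
        (simp add: sum_distrib_left[symmetric] ent_times[OF K(1) K(2)])
    also have "\<dots> = ent (X * (Y * Z)) i l" by (rule ent_times[OF J, symmetric])
    finally show "ent (X * Y * Z) i l = ent (X * (Y * Z)) i l" .
  qed
  show "1 * X = X"
    by (rule rmat_eqI) (subst ent_times[where J="{i}" for i], auto simp: ent_one)
  show "X * 1 = X"
    by (rule rmat_eqI) (simp add: ent_times_raw ent_one if_distrib[of "\<lambda>x. _ * x"] cong: if_cong)
  show "(X + Y) * Z = X * Z + Y * Z"
  proof (rule rmat_eqI)
    fix i k
    define J where "J = {j. ent X i j \<noteq> 0} \<union> {j. ent Y i j \<noteq> 0}"
    have J: "finite J" by (simp add: J_def)
    show "ent ((X + Y) * Z) i k = ent (X * Z + Y * Z) i k"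
      unfolding ent_add
      by (subst (1 2 3) ent_times[OF J]) (auto simp: J_def sum.distrib distrib_right)
  qed
  show "X * (Y + Z) = X * Y + X * Z"
    by (rule rmat_eqI) (simp add: ent_times_raw distrib_left sum.distrib)
  show "(0 :: rmat) \<noteq> 1"
    by (metis ent_one ent_zero zero_neq_one)
qed (auto intro!: rmat_eqI simp: algebra_simps)

end

lemma ent_sum [simp]: "ent (\<Sum>x\<in>S. f x) i j = (\<Sum>x\<in>S. ent (f x) i j)"
  by (induction S rule: infinite_finite_induct) auto

lemma ent_two_times [simp]: "ent (2 * X) i j = 2 * ent X i j"
  by (metis ent_add mult_2)

subsection \<open>Special matrices\<close>

definition letter :: "nat \<Rightarrow> complex \<Rightarrow> rmat" where
  "letter i z = Rmat (\<lambda>a b.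
     if a = i \<and> b = i then 0
     else if a = i + 1 \<and> b = i + 1 then z
     else if a = i \<and> b = i + 1 \<or> a = i + 1 \<and> b = i then 1
     else if a = b then 1 else 0)"

definition letter_inv :: "nat \<Rightarrow> complex \<Rightarrow> rmat" where
  "letter_inv i z = Rmat (\<lambda>a b.
     if a = i \<and> b = i then - z
     else if a = i + 1 \<and> b = i + 1 then 0
     else if a = i \<and> b = i + 1 \<or> a = i + 1 \<and> b = i then 1
     else if a = b then 1 else 0)"

definition elem :: "nat \<Rightarrow> nat \<Rightarrow> complex \<Rightarrow> rmat" where
  "elem i j c = Rmat (\<lambda>a b. if a = i \<and> b = j then c else 0)"

definition diagonal :: "(nat \<Rightarrow> complex) \<Rightarrow> rmat" where
  "diagonal d = Rmat (\<lambda>a b. if a = b then d a else 0)"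

text \<open>The 1 of row a stands in column \<pi>(a), so rows are finite for every \<pi>. This
  transposes the convention of \<open>perm_mat\<close>; for the involution \<open>w0 n\<close> the
  two agree.\<close>

definition pmat :: "(nat \<Rightarrow> nat) \<Rightarrow> rmat" where
  "pmat \<pi> = Rmat (\<lambda>a b. if b = \<pi> a then 1 else 0)"

lemma ent_letter: "ent (letter i z) a b = (if a = i \<and> b = i then 0
     else if a = i + 1 \<and> b = i + 1 then z
     else if a = i \<and> b = i + 1 \<or> a = i + 1 \<and> b = i then 1
     else if a = b then 1 else 0)"
proof -
  have "finite {b. (if a = i \<and> b = i then 0
     else if a = i + 1 \<and> b = i + 1 then z
     else if a = i \<and> b = i + 1 \<or> a = i + 1 \<and> b = i then 1
     else if a = b then 1 else 0) \<noteq> (0 :: complex)}" for a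
    by (rule finite_subset[of _ "{i, i + 1, a}"]) (auto split: if_splits)
  then show ?thesis unfolding letter_def by (simp add: ent_Rmat)
qed

lemma ent_letter_inv: "ent (letter_inv i z) a b = (if a = i \<and> b = i then - z
     else if a = i + 1 \<and> b = i + 1 then 0
     else if a = i \<and> b = i + 1 \<or> a = i + 1 \<and> b = i then 1
     else if a = b then 1 else 0)"
proof -
  have "finite {b. (if a = i \<and> b = i then - z
     else if a = i + 1 \<and> b = i + 1 then 0
     else if a = i \<and> b = i + 1 \<or> a = i + 1 \<and> b = i then 1
     else if a = b then 1 else 0) \<noteq> (0 :: complex)}" for a
    by (rule finite_subset[of _ "{i, i + 1, a}"]) (auto split: if_splits)
  then show ?thesis unfolding letter_inv_def by (simp add: ent_Rmat)
qed

lemma ent_elem: "ent (elem i j c) a b = (if a = i \<and> b = j then c else 0)"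
  unfolding elem_def
  by (subst ent_Rmat) (auto intro!: finite_subset[of _ "{j}"] split: if_splits)

lemma ent_diagonal: "ent (diagonal d) a b = (if a = b then d a else 0)"
  unfolding diagonal_def
  by (subst ent_Rmat) (auto intro!: finite_subset[of _ "{i}" for i] split: if_splits)

lemma ent_pmat: "ent (pmat \<pi>) a b = (if b = \<pi> a then 1 else 0)"
  unfolding pmat_def by (subst ent_Rmat) auto

lemma ent_letter_times: "ent (letter i z * X) a b =
    (if a = i then ent X (i + 1) b
     else if a = i + 1 then ent X i b + z * ent X (i + 1) b else ent X a b)"
  by (cases "a = i \<or> a = i + 1"; subst ent_times[where J="if a = i \<or> a = i + 1 then {i, i + 1} else {a}"])
    (auto simp: ent_letter)

lemma ent_letter_inv_times: "ent (letter_inv i z * X) a b =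
    (if a = i then ent X (i + 1) b - z * ent X i b
     else if a = i + 1 then ent X i b else ent X a b)"
  by (cases "a = i \<or> a = i + 1"; subst ent_times[where J="if a = i \<or> a = i + 1 then {i, i + 1} else {a}"])
    (auto simp: ent_letter_inv)

lemma ent_times_col:
  assumes "finite J" "\<And>j. j \<notin> J \<Longrightarrow> ent Y j k = 0"
  shows "ent (X * Y) i k = (\<Sum>j\<in>J. ent X i j * ent Y j k)"
proof -
  have "ent (X * Y) i k = (\<Sum>j\<in>J \<union> {j. ent X i j \<noteq> 0}. ent X i j * ent Y j k)"
    by (rule ent_times) (use assms in auto)
  also have "\<dots> = (\<Sum>j\<in>J. ent X i j * ent Y j k)"
    by (rule sum.mono_neutral_right) (use assms in auto)
  finally show ?thesis .
qed

lemma ent_times_letter: "ent (X * letter i z) a b =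
    (if b = i then ent X a (i + 1)
     else if b = i + 1 then ent X a i + ent X a (i + 1) * z else ent X a b)"
  by (cases "b = i \<or> b = i + 1"; subst ent_times_col[where J="if b = i \<or> b = i + 1 then {i, i + 1} else {b}"])
    (auto simp: ent_letter)

lemma ent_times_letter_inv: "ent (X * letter_inv i z) a b =
    (if b = i then ent X a (i + 1) - ent X a i * z
     else if b = i + 1 then ent X a i else ent X a b)"
  by (cases "b = i \<or> b = i + 1"; subst ent_times_col[where J="if b = i \<or> b = i + 1 then {i, i + 1} else {b}"])
    (auto simp: ent_letter_inv)

lemma ent_elem_times: "ent (elem i j c * X) a b = (if a = i then c * ent X j b else 0)"
  by (subst ent_times[where J="{j}"]) (auto simp: ent_elem)

lemma ent_times_elem: "ent (X * elem i j c) a b = (if b = j then ent X a i * c else 0)"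
  by (subst ent_times_col[where J="{i}"]) (auto simp: ent_elem)

lemma ent_diagonal_times: "ent (diagonal d * X) a b = d a * ent X a b"
  by (subst ent_times[where J="{a}"]) (auto simp: ent_diagonal)

lemma ent_times_diagonal: "ent (X * diagonal d) a b = ent X a b * d b"
  by (subst ent_times_col[where J="{b}"]) (auto simp: ent_diagonal)

lemma ent_pmat_times: "ent (pmat \<pi> * X) a b = ent X (\<pi> a) b"
  by (subst ent_times[where J="{\<pi> a}"]) (auto simp: ent_pmat)

lemma ent_times_pmat:
  assumes "\<And>a. \<pi> (\<pi> a) = a"
  shows "ent (X * pmat \<pi>) a b = ent X a (\<pi> b)"
proof -
  have "b = \<pi> a \<longleftrightarrow> a = \<pi> b" for a by (metis assms)
  then have "ent (pmat \<pi>) a b = (if a = \<pi> b then 1 else 0)" for a by (simp add: ent_pmat)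
  then show ?thesis by (subst ent_times_col[where J="{\<pi> b}"]) auto
qed

lemma letter_letter_inv [simp]: "letter i z * letter_inv i z = 1"
  by (rule rmat_eqI) (auto simp: ent_letter_times ent_letter_inv ent_one)

lemma letter_inv_letter [simp]: "letter_inv i z * letter i z = 1"
  by (rule rmat_eqI) (auto simp: ent_letter_inv_times ent_letter ent_one)

text \<open>The derivative of \<open>letter i z\<close> in z is the elementary matrix at (i+1,i+1).
  This lemma gives its right logarithmic derivative, the next one the left one, and the third passes
  from the left to the right one by conjugation.\<close>

lemma elem_letter_inv: "elem (i + 1) (i + 1) c * letter_inv i z = elem (i + 1) i c"
  by (rule rmat_eqI) (auto simp: ent_elem_times ent_letter_inv ent_elem)

lemma letter_inv_elem: "letter_inv i z * elem (i + 1) (i + 1) c = elem i (i + 1) c"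
  by (rule rmat_eqI) (auto simp: ent_letter_inv_times ent_elem)

lemma letter_elem_letter_inv: "letter i z * elem i (i + 1) c * letter_inv i z = elem (i + 1) i c"
  by (rule rmat_eqI) (auto simp: ent_times_letter_inv ent_letter_times ent_elem)

lemma elem_add: "elem i j (c + d) = elem i j c + elem i j d"
  by (rule rmat_eqI) (auto simp: ent_elem)

lemma elem_zero [simp]: "elem i j 0 = 0"
  by (rule rmat_eqI) (auto simp: ent_elem)

lemma diagonal_times: "diagonal d * diagonal e = diagonal (\<lambda>k. d k * e k)"
  by (rule rmat_eqI) (auto simp: ent_diagonal_times ent_diagonal)

lemma diagonal_one: "diagonal (\<lambda>_. 1) = 1"
  by (rule rmat_eqI) (auto simp: ent_diagonal ent_one)

lemma diagonal_inverse:
  assumes "\<And>k. d k \<noteq> 0"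
  shows "diagonal d * diagonal (\<lambda>k. inverse (d k)) = 1" "diagonal (\<lambda>k. inverse (d k)) * diagonal d = 1"
  using assms by (simp_all add: diagonal_times diagonal_one)

lemma pmat_pmat:
  assumes "\<And>a. \<pi> (\<pi> a) = a"
  shows "pmat \<pi> * pmat \<pi> = 1"
  by (rule rmat_eqI) (auto simp: ent_pmat_times ent_pmat ent_one assms)

subsection \<open>Triangular matrices and blocks\<close>

definition upper :: "rmat \<Rightarrow> bool" where
  "upper X \<longleftrightarrow> (\<forall>a b. b < a \<longrightarrow> ent X a b = 0)"

definition lower :: "rmat \<Rightarrow> bool" where
  "lower X \<longleftrightarrow> (\<forall>a b. a < b \<longrightarrow> ent X a b = 0)"

lemma upperD: "upper X \<Longrightarrow> b < a \<Longrightarrow> ent X a b = 0" by (simp add: upper_def)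
lemma lowerD: "lower X \<Longrightarrow> a < b \<Longrightarrow> ent X a b = 0" by (simp add: lower_def)

lemma upper_simps [simp]:
  "upper X \<Longrightarrow> upper Y \<Longrightarrow> upper (X + Y)" "upper X \<Longrightarrow> upper Y \<Longrightarrow> upper (X - Y)"
  "upper X \<Longrightarrow> upper (- X)" "upper 0" "upper 1" "upper (diagonal d)"
  "upper X \<Longrightarrow> upper (2 * X)"
  by (auto simp: upper_def ent_one ent_diagonal)

lemma lower_simps [simp]:
  "lower X \<Longrightarrow> lower Y \<Longrightarrow> lower (X + Y)" "lower X \<Longrightarrow> lower Y \<Longrightarrow> lower (X - Y)"
  "lower X \<Longrightarrow> lower (- X)" "lower 0" "lower 1" "lower (diagonal d)"
  by (auto simp: lower_def ent_one ent_diagonal)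

lemma upper_times [simp]:
  assumes "upper X" "upper Y" shows "upper (X * Y)"
  unfolding upper_def
proof (intro allI impI)
  fix a b :: nat assume "b < a"
  then have "ent X a j * ent Y j b = 0" for j
    using assms by (cases "j < a") (auto simp: upper_def)
  then show "ent (X * Y) a b = 0" unfolding ent_times_raw by (intro sum.neutral) blast
qed

lemma lower_times [simp]:
  assumes "lower X" "lower Y" shows "lower (X * Y)"
  unfolding lower_def
proof (intro allI impI)
  fix a b :: nat assume "a < b"
  then have "ent X a j * ent Y j b = 0" for j
    using assms by (cases "j > a") (auto simp: lower_def)
  then show "ent (X * Y) a b = 0" unfolding ent_times_raw by (intro sum.neutral) blast
qed

lemma ent_upper_times_diag:
  assumes "upper X" "upper Y" shows "ent (X * Y) a a = ent X a a * ent Y a a"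
proof -
  have "ent (X * Y) a a = (\<Sum>j\<in>{a} \<union> {j. ent X a j \<noteq> 0}. ent X a j * ent Y j a)"
    by (rule ent_times) auto
  also have "\<dots> = (\<Sum>j\<in>{a}. ent X a j * ent Y j a)"
  proof (rule sum.mono_neutral_right)
    show "\<forall>i\<in>{a} \<union> {j. ent X a j \<noteq> 0} - {a}. ent X a i * ent Y i a = 0"
    proof
      fix i assume "i \<in> {a} \<union> {j. ent X a j \<noteq> 0} - {a}"
      then show "ent X a i * ent Y i a = 0"
        using assms by (cases "i < a") (auto simp: upper_def)
    qed
  qed auto
  finally show ?thesis by simp
qed

lemma ent_lower_times_diag:
  assumes "lower X" "lower Y" shows "ent (X * Y) a a = ent X a a * ent Y a a"
proof -
  have "ent (X * Y) a a = (\<Sum>j\<in>{a} \<union> {j. ent X a j \<noteq> 0}. ent X a j * ent Y j a)"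
    by (rule ent_times) auto
  also have "\<dots> = (\<Sum>j\<in>{a}. ent X a j * ent Y j a)"
  proof (rule sum.mono_neutral_right)
    show "\<forall>i\<in>{a} \<union> {j. ent X a j \<noteq> 0} - {a}. ent X a i * ent Y i a = 0"
    proof
      fix i assume "i \<in> {a} \<union> {j. ent X a j \<noteq> 0} - {a}"
      then show "ent X a i * ent Y i a = 0"
        using assms by (cases "i > a") (auto simp: lower_def)
    qed
  qed auto
  finally show ?thesis by simp
qed

lemma ent_times_upper_eq_sum:
  assumes "upper X"
  shows "ent (Y * X) a b = (\<Sum>j\<le>b. ent Y a j * ent X j b)"
  by (rule ent_times_col) (use assms in \<open>auto simp: upper_def\<close>)

lemma ent_lower_times_eq_sum:
  assumes "lower X"
  shows "ent (X * Y) a b = (\<Sum>j\<le>a. ent X a j * ent Y j b)"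
  by (rule ent_times) (use assms in \<open>auto simp: lower_def\<close>)

text \<open>Column by column: once the earlier columns of Y vanish below the diagonal, the entry
  (a,b) of Y X with b \<le> a is just Y_ab X_bb, and a = b shows that X_bb is nonzero.\<close>

lemma upper_left_inverse:
  assumes X: "upper X" and YX: "Y * X = 1"
  shows "upper Y"
proof -
  have "\<forall>a. b < a \<longrightarrow> ent Y a b = 0" for b
  proof (induction b rule: less_induct)
    case (less b)
    have *: "ent Y a b * ent X b b = (if a = b then 1 else 0)" if "b \<le> a" for a
    proof -
      have "(if a = b then 1 else 0) = ent (Y * X) a b" by (simp add: YX ent_one)
      also have "\<dots> = (\<Sum>j\<le>b. ent Y a j * ent X j b)" by (rule ent_times_upper_eq_sum[OF X])
      also have "\<dots> = (\<Sum>j\<in>{b}. ent Y a j * ent X j b)"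
        by (rule sum.mono_neutral_right) (use less that in auto)
      finally show ?thesis by simp
    qed
    from *[of b] have "ent X b b \<noteq> 0" by auto
    with * show ?case by (metis less_imp_le less_irrefl mult_eq_0_iff)
  qed
  then show ?thesis by (simp add: upper_def)
qed

lemma lower_right_inverse:
  assumes X: "lower X" and XY: "X * Y = 1"
  shows "lower Y"
proof -
  have "\<forall>b. a < b \<longrightarrow> ent Y a b = 0" for a
  proof (induction a rule: less_induct)
    case (less a)
    have *: "ent X a a * ent Y a b = (if a = b then 1 else 0)" if "a \<le> b" for b
    proof -
      have "(if a = b then 1 else 0) = ent (X * Y) a b" by (simp add: XY ent_one)
      also have "\<dots> = (\<Sum>j\<le>a. ent X a j * ent Y j b)" by (rule ent_lower_times_eq_sum[OF X])
      also have "\<dots> = (\<Sum>j\<in>{a}. ent X a j * ent Y j b)"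
        by (rule sum.mono_neutral_right) (use less that in auto)
      finally show ?thesis by simp
    qed
    from *[of a] have "ent X a a \<noteq> 0" by auto
    with * show ?case by (metis less_imp_le less_irrefl mult_eq_0_iff)
  qed
  then show ?thesis by (simp add: lower_def)
qed

text \<open>A matrix of size \<open>n\<close> is extended by the identity if it is to be invertible
  (\<open>unit_block\<close>) and by zero if it is to be a tangent vector (\<open>zero_block\<close>).\<close>

definition unit_block :: "nat \<Rightarrow> rmat \<Rightarrow> bool" where
  "unit_block n X \<longleftrightarrow> (\<forall>a b. n \<le> a \<or> n \<le> b \<longrightarrow> ent X a b = (if a = b then 1 else 0))"

definition zero_block :: "nat \<Rightarrow> rmat \<Rightarrow> bool" where
  "zero_block n X \<longleftrightarrow> (\<forall>a b. n \<le> a \<or> n \<le> b \<longrightarrow> ent X a b = 0)"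

lemma ent_times_unit_block:
  assumes "unit_block n X" "a < n"
  shows "ent (X * Y) a b = (\<Sum>j<n. ent X a j * ent Y j b)"
  by (rule ent_times) (use assms in \<open>auto simp: unit_block_def\<close>)

lemma ent_times_zero_block:
  assumes "zero_block n X"
  shows "ent (X * Y) a b = (\<Sum>j<n. ent X a j * ent Y j b)"
  by (rule ent_times) (use assms in \<open>auto simp: zero_block_def\<close>)

lemma ent_times_zer':
  assumes "zero_block n Y"
  shows "ent (X * Y) a b = (\<Sum>j<n. ent X a j * ent Y j b)"
  by (rule ent_times_col) (use assms in \<open>auto simp: zero_block_def\<close>)

lemma unit_block_times [simp]:
  assumes "unit_block n X" "unit_block n Y" shows "unit_block n (X * Y)"
  unfolding unit_block_def
proof (intro allI impI)
  fix a b :: nat assume ab: "n \<le> a \<or> n \<le> b"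
  show "ent (X * Y) a b = (if a = b then 1 else 0)"
  proof (cases "n \<le> a")
    case True
    then have "ent (X * Y) a b = (\<Sum>j\<in>{a}. ent X a j * ent Y j b)"
      by (intro ent_times) (use assms in \<open>auto simp: unit_block_def\<close>)
    then show ?thesis using True assms by (auto simp: unit_block_def)
  next
    case False
    then have "ent (X * Y) a b = (\<Sum>j<n. ent X a j * ent Y j b)"
      by (intro ent_times_unit_block assms) simp
    then show ?thesis using False ab assms by (auto simp: unit_block_def)
  qed
qed

lemma unit_block_one [simp]: "unit_block n 1" by (simp add: unit_block_def ent_one)

lemma zero_block_simps [simp]:
  "zero_block n 0" "zero_block n X \<Longrightarrow> zero_block n Y \<Longrightarrow> zero_block n (X + Y)" "zero_block n X \<Longrightarrow> zero_block n Y \<Longrightarrow> zero_block n (X - Y)"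
  "zero_block n X \<Longrightarrow> zero_block n (- X)" "zero_block n X \<Longrightarrow> zero_block n (2 * X)"
  by (auto simp: zero_block_def)

lemma zero_block_unit_block_times [simp]:
  assumes "unit_block n X" "zero_block n Y" shows "zero_block n (X * Y)"
  unfolding zero_block_def
proof (intro allI impI)
  fix a b :: nat assume ab: "n \<le> a \<or> n \<le> b"
  have "ent (X * Y) a b = (\<Sum>j<n. ent X a j * ent Y j b)"
    by (rule ent_times_zer'[OF assms(2)])
  also have "\<dots> = 0"
    using ab assms by (intro sum.neutral) (auto simp: unit_block_def zero_block_def)
  finally show "ent (X * Y) a b = 0" .
qed

lemma zero_block_times_unit_block [simp]:
  assumes "zero_block n X" "unit_block n Y" shows "zero_block n (X * Y)"
  unfolding zero_block_def
proof (intro allI impI)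
  fix a b :: nat assume ab: "n \<le> a \<or> n \<le> b"
  have "ent (X * Y) a b = (\<Sum>j<n. ent X a j * ent Y j b)"
    by (rule ent_times_zero_block[OF assms(1)])
  also have "\<dots> = 0"
    using ab assms by (intro sum.neutral) (auto simp: unit_block_def zero_block_def)
  finally show "ent (X * Y) a b = 0" .
qed

lemma zero_block_times [simp]:
  assumes "zero_block n X" "zero_block n Y" shows "zero_block n (X * Y)"
  unfolding zero_block_def
proof (intro allI impI)
  fix a b :: nat assume ab: "n \<le> a \<or> n \<le> b"
  have "ent (X * Y) a b = (\<Sum>j<n. ent X a j * ent Y j b)"
    by (rule ent_times_zero_block[OF assms(1)])
  also have "\<dots> = 0"
    using ab assms by (intro sum.neutral) (auto simp: zero_block_def)
  finally show "ent (X * Y) a b = 0" .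
qed

lemma unit_block_letter [simp]: "Suc i < n \<Longrightarrow> unit_block n (letter i z)"
  by (auto simp: unit_block_def ent_letter)

lemma unit_block_letter_inv [simp]: "Suc i < n \<Longrightarrow> unit_block n (letter_inv i z)"
  by (auto simp: unit_block_def ent_letter_inv)

lemma zero_block_elem [simp]: "i < n \<Longrightarrow> j < n \<Longrightarrow> zero_block n (elem i j c)"
  by (auto simp: zero_block_def ent_elem)

definition tr :: "nat \<Rightarrow> rmat \<Rightarrow> complex" where
  "tr n X = (\<Sum>i<n. ent X i i)"

lemma tr_add: "tr n (X + Y) = tr n X + tr n Y" by (simp add: tr_def sum.distrib)
text \<open>The zero block of one factor cuts both inner sums down to the first n indices, so the
  other factor may be any row-finite matrix.\<close>

lemma tr_commute:
  assumes "zero_block n X" shows "tr n (X * Y) = tr n (Y * X)"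
proof -
  have "tr n (X * Y) = (\<Sum>i<n. \<Sum>j<n. ent X i j * ent Y j i)"
    by (simp add: tr_def ent_times_zero_block[OF assms])
  also have "\<dots> = (\<Sum>j<n. \<Sum>i<n. ent Y j i * ent X i j)"
    by (subst sum.swap) (simp add: mult.commute)
  also have "\<dots> = tr n (Y * X)"
    by (simp add: tr_def ent_times_zer'[OF assms])
  finally show ?thesis .
qed

lemma tr_times_elem: "i < n \<Longrightarrow> j < n \<Longrightarrow> tr n (X * elem i j c) = ent X j i * c"
  by (simp add: tr_def ent_times_elem if_distrib sum.delta cong: if_cong)

lemma tr_upper_times:
  assumes "upper X" "upper Y"
  shows "tr n (X * Y) = (\<Sum>k<n. ent X k k * ent Y k k)"
  by (simp add: tr_def ent_upper_times_diag assms)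

section \<open>Products of braid matrices\<close>

primrec wprod :: "nat list \<Rightarrow> (nat \<Rightarrow> complex) \<Rightarrow> nat \<Rightarrow> rmat" where
  "wprod \<eta> z 0 = 1"
| "wprod \<eta> z (Suc j) = wprod \<eta> z j * letter (\<eta> ! j) (z j)"

primrec winv :: "nat list \<Rightarrow> (nat \<Rightarrow> complex) \<Rightarrow> nat \<Rightarrow> rmat" where
  "winv \<eta> z 0 = 1"
| "winv \<eta> z (Suc j) = letter_inv (\<eta> ! j) (z j) * winv \<eta> z j"

text \<open>The directional derivative of \<open>wprod\<close> along v, written out by the Leibniz
  rule; a letter contributes v_j in its corner (i+1,i+1).\<close>

primrec wdiff :: "nat list \<Rightarrow> (nat \<Rightarrow> complex) \<Rightarrow> (nat \<Rightarrow> complex) \<Rightarrow> nat \<Rightarrow> rmat" where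
  "wdiff \<eta> z v 0 = 0"
| "wdiff \<eta> z v (Suc j) = wdiff \<eta> z v j * letter (\<eta> ! j) (z j)
     + wprod \<eta> z j * elem (\<eta> ! j + 1) (\<eta> ! j + 1) (v j)"

lemma wprod_winv [simp]: "wprod \<eta> z j * winv \<eta> z j = 1"
proof (induction j)
  case (Suc j)
  have "wprod \<eta> z (Suc j) * winv \<eta> z (Suc j)
      = wprod \<eta> z j * (letter (\<eta> ! j) (z j) * letter_inv (\<eta> ! j) (z j)) * winv \<eta> z j"
    by (simp only: wprod.simps winv.simps mult.assoc)
  then show ?case by (simp add: Suc)
qed simp

lemma winv_wprod [simp]: "winv \<eta> z j * wprod \<eta> z j = 1"
proof (induction j)
  case (Suc j)
  have "winv \<eta> z (Suc j) * wprod \<eta> z (Suc j)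
      = letter_inv (\<eta> ! j) (z j) * (winv \<eta> z j * wprod \<eta> z j) * letter (\<eta> ! j) (z j)"
    by (simp only: wprod.simps winv.simps mult.assoc)
  then show ?case by (simp add: Suc)
qed simp

lemma wprod_winv_assoc [simp]: "wprod \<eta> z j * (winv \<eta> z j * X) = X"
  by (simp flip: mult.assoc)

lemma winv_wprod_assoc [simp]: "winv \<eta> z j * (wprod \<eta> z j * X) = X"
  by (simp flip: mult.assoc)

lemma braid_word_nth: "braid_word n \<eta> \<Longrightarrow> j < length \<eta> \<Longrightarrow> Suc (\<eta> ! j) < n"
  by (auto simp: braid_word_def)

lemma unit_block_wprod: "braid_word n \<eta> \<Longrightarrow> j \<le> length \<eta> \<Longrightarrow> unit_block n (wprod \<eta> z j)"
  by (induction j) (simp_all add: braid_word_nth)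

lemma unit_block_winv: "braid_word n \<eta> \<Longrightarrow> j \<le> length \<eta> \<Longrightarrow> unit_block n (winv \<eta> z j)"
  by (induction j) (simp_all add: braid_word_nth)

lemma zero_block_wdiff: "braid_word n \<eta> \<Longrightarrow> j \<le> length \<eta> \<Longrightarrow> zero_block n (wdiff \<eta> z v j)"
  by (induction j) (simp_all add: braid_word_nth unit_block_wprod)

lemma wprod_cong: "(\<And>k. k < j \<Longrightarrow> \<eta> ! k = \<eta>' ! k \<and> z k = z' k) \<Longrightarrow> wprod \<eta> z j = wprod \<eta>' z' j"
  by (induction j) auto

lemma winv_cong: "(\<And>k. k < j \<Longrightarrow> \<eta> ! k = \<eta>' ! k \<and> z k = z' k) \<Longrightarrow> winv \<eta> z j = winv \<eta>' z' j"
  by (induction j) auto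

lemma wdiff_cong:
  "(\<And>k. k < j \<Longrightarrow> \<eta> ! k = \<eta>' ! k \<and> z k = z' k \<and> v k = v' k) \<Longrightarrow> wdiff \<eta> z v j = wdiff \<eta>' z' v' j"
proof (induction j)
  case (Suc j)
  then show ?case using wprod_cong[of j \<eta> \<eta>' z z'] by auto
qed simp

lemma wprod_append:
  "wprod (\<beta> @ \<delta>) z (length \<beta> + j) = wprod \<beta> z (length \<beta>) * wprod \<delta> (\<lambda>k. z (length \<beta> + k)) j"
proof (induction j)
  case 0
  show ?case by (auto intro!: wprod_cong simp: nth_append)
qed (simp add: nth_append mult.assoc)

lemma wdiff_append:
  "wdiff (\<beta> @ \<delta>) z v (length \<beta> + j) = wdiff \<beta> z v (length \<beta>) * wprod \<delta> (\<lambda>k. z (length \<beta> + k)) j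
     + wprod \<beta> z (length \<beta>) * wdiff \<delta> (\<lambda>k. z (length \<beta> + k)) (\<lambda>k. v (length \<beta> + k)) j"
proof (induction j)
  case 0
  show ?case by (auto intro!: wdiff_cong simp: nth_append)
next
  case (Suc j)
  then show ?case using wprod_append[of \<beta> \<delta> z j]
    by (simp add: nth_append mult.assoc distrib_left distrib_right add.assoc)
qed

lemma wdiff_add: "wdiff \<eta> z (\<lambda>k. u k + v k) j = wdiff \<eta> z u j + wdiff \<eta> z v j"
  by (induction j) (simp_all add: algebra_simps elem_add)

lemma elem_scale: "diagonal (\<lambda>_. c) * elem i j d = elem i j (c * d)"
  by (rule rmat_eqI) (auto simp: ent_diagonal_times ent_elem)

text \<open>Scalars are represented by constant diagonal matrices, which are central.\<close>

lemma diagonal_const_commute: "X * diagonal (\<lambda>_. c) = diagonal (\<lambda>_. c) * X"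
  by (rule rmat_eqI) (auto simp: ent_diagonal_times ent_times_diagonal)

lemma wdiff_scale: "wdiff \<eta> z (\<lambda>k. c * v k) j = diagonal (\<lambda>_. c) * wdiff \<eta> z v j"
proof (induction j)
  case (Suc j)
  have "wprod \<eta> z j * (diagonal (\<lambda>_. c) * X) = diagonal (\<lambda>_. c) * (wprod \<eta> z j * X)" for X
    by (metis diagonal_const_commute mult.assoc)
  then show ?case by (simp add: Suc distrib_left mult.assoc elem_scale[symmetric])
qed simp

lemma wdiff_zero [simp]: "wdiff \<eta> z (\<lambda>_. 0) j = 0"
  by (induction j) auto

lemma wdiff_sum:
  "finite S \<Longrightarrow> wdiff \<eta> z (\<lambda>k. \<Sum>s\<in>S. f s k) j = (\<Sum>s\<in>S. wdiff \<eta> z (f s) j)"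
  by (induction S rule: finite_induct) (auto simp: wdiff_add)

subsection \<open>Derivatives\<close>

definition mderiv :: "(complex \<Rightarrow> rmat) \<Rightarrow> rmat \<Rightarrow> bool" where
  "mderiv F F' \<longleftrightarrow> (\<forall>a b. ((\<lambda>s. ent (F s) a b) has_field_derivative ent F' a b) (at 0))"

lemma mderivD: "mderiv F F' \<Longrightarrow> ((\<lambda>s. ent (F s) a b) has_field_derivative ent F' a b) (at 0)"
  by (simp add: mderiv_def)

lemma mderiv_unique: "mderiv F F' \<Longrightarrow> mderiv F F'' \<Longrightarrow> F' = F''"
  by (auto intro!: rmat_eqI DERIV_unique simp: mderiv_def)

lemma mderiv_const: "mderiv (\<lambda>_. X) 0"
  by (simp add: mderiv_def)

text \<open>The hypothesis on rows bounds the support of row a by one finite set for all s, so that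
  an entry of the product is a fixed finite sum.\<close>

lemma mderiv_times:
  assumes "mderiv F F'" "mderiv G G'"
    and rows: "\<And>s a j. n \<le> j \<Longrightarrow> j \<noteq> a \<Longrightarrow> ent (F s) a j = 0"
  shows "mderiv (\<lambda>s. F s * G s) (F' * G 0 + F 0 * G')"
  unfolding mderiv_def
proof (intro allI)
  fix a b
  let ?J = "insert a {..<n}"
  have rows': "ent F' a j = 0" if "j \<notin> ?J" for j
  proof -
    have "(\<lambda>s. ent (F s) a j) = (\<lambda>_. 0)" using rows that by auto
    then show ?thesis using mderivD[OF assms(1), of a j] DERIV_const DERIV_unique by metis
  qed
  have ex: "ent (F s * X) a b = (\<Sum>j\<in>?J. ent (F s) a j * ent X j b)" for s X
    by (rule ent_times) (use rows in auto)
  have ex': "ent (F' * X) a b = (\<Sum>j\<in>?J. ent F' a j * ent X j b)" for X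
    by (rule ent_times) (use rows' in auto)
  have "((\<lambda>s. \<Sum>j\<in>?J. ent (F s) a j * ent (G s) j b) has_field_derivative
      (\<Sum>j\<in>?J. ent F' a j * ent (G 0) j b + ent (F 0) a j * ent G' j b)) (at 0)"
    by (auto intro!: DERIV_sum derivative_eq_intros mderivD[OF assms(1)] mderivD[OF assms(2)])
  then show "((\<lambda>s. ent (F s * G s) a b) has_field_derivative
      ent (F' * G 0 + F 0 * G') a b) (at 0)"
    unfolding ent_add ex ex' by (simp add: sum.distrib)
qed

lemma unit_block_rows: "unit_block n X \<Longrightarrow> n \<le> j \<Longrightarrow> j \<noteq> a \<Longrightarrow> ent X a j = 0"
  by (simp add: unit_block_def)

lemma mderiv_wprod:
  assumes "\<And>k. k < j \<Longrightarrow> ((\<lambda>s. z s k) has_field_derivative v k) (at 0)"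
  shows "mderiv (\<lambda>s. wprod \<eta> (z s) j) (wdiff \<eta> (z 0) v j)"
  using assms
proof (induction j)
  case 0
  then show ?case by (simp add: mderiv_const)
next
  case (Suc j)
  note IH = mderivD[OF Suc.IH[OF Suc.prems[OF less_SucI]]]
  show ?case
    unfolding mderiv_def
  proof (intro allI)
    fix a b
    show "((\<lambda>s. ent (wprod \<eta> (z s) (Suc j)) a b) has_field_derivative
        ent (wdiff \<eta> (z 0) v (Suc j)) a b) (at 0)"
      by (auto simp: ent_times_letter ent_times_elem intro!: derivative_eq_intros IH Suc.prems)
  qed
qed

lemma mderiv_winv:
  assumes "\<And>k. k < j \<Longrightarrow> ((\<lambda>s. z s k) has_field_derivative v k) (at 0)"
  shows "mderiv (\<lambda>s. winv \<eta> (z s) j) (- (winv \<eta> (z 0) j * wdiff \<eta> (z 0) v j * winv \<eta> (z 0) j))"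
  using assms
proof (induction j)
  case 0
  then show ?case by (simp add: mderiv_const)
next
  case (Suc j)
  let ?Y = "wprod \<eta> (z 0) j" and ?I = "winv \<eta> (z 0) j" and ?d = "wdiff \<eta> (z 0) v j"
  let ?i = "\<eta> ! j"
  note IH = mderivD[OF Suc.IH[OF Suc.prems[OF less_SucI]], unfolded ent_uminus]
  \<comment> \<open>Together with \<open>letter_inv_elem\<close> this shows that B^-1 dB B^-1 is the
    elementary matrix at (i,i), which is minus the z-derivative of
    \<open>letter_inv i z\<close>.\<close>
  have e: "elem ?i (?i + 1) (v j) * letter_inv ?i (z 0 j) = elem ?i ?i (v j)"
    by (rule rmat_eqI) (auto simp: ent_elem_times ent_letter_inv ent_elem)
  have "winv \<eta> (z 0) (Suc j) * wdiff \<eta> (z 0) v (Suc j) * winv \<eta> (z 0) (Suc j)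
      = letter_inv ?i (z 0 j) * (?I * ?d * (letter ?i (z 0 j) * letter_inv ?i (z 0 j)) * ?I)
        + letter_inv ?i (z 0 j) * ((?I * ?Y) * elem (?i + 1) (?i + 1) (v j) * letter_inv ?i (z 0 j) * ?I)"
    unfolding winv.simps wdiff.simps by (simp only: distrib_left distrib_right mult.assoc)
  also have "\<dots> = letter_inv ?i (z 0 j) * (?I * ?d * ?I)
      + (letter_inv ?i (z 0 j) * elem (?i + 1) (?i + 1) (v j)) * letter_inv ?i (z 0 j) * ?I"
    by (simp add: mult.assoc)
  also have "\<dots> = letter_inv ?i (z 0 j) * (?I * ?d * ?I) + elem ?i ?i (v j) * ?I"
    unfolding letter_inv_elem e ..
  finally have eq: "winv \<eta> (z 0) (Suc j) * wdiff \<eta> (z 0) v (Suc j) * winv \<eta> (z 0) (Suc j)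
      = letter_inv ?i (z 0 j) * (?I * ?d * ?I) + elem ?i ?i (v j) * ?I" .
  show ?case
    unfolding mderiv_def eq
  proof (intro allI)
    fix a b
    show "((\<lambda>s. ent (winv \<eta> (z s) (Suc j)) a b) has_field_derivative
        ent (- (letter_inv ?i (z 0 j) * (?I * ?d * ?I) + elem ?i ?i (v j) * ?I)) a b) (at 0)"
      by (auto simp: ent_letter_inv_times ent_elem_times intro!: derivative_eq_intros IH Suc.prems)
  qed
qed

text \<open>The mixed second derivative of \<open>wprod\<close>. Letters are affine in their
  variables, so only terms that differentiate two different letters occur.\<close>

primrec wdiff2 :: "nat list \<Rightarrow> (nat \<Rightarrow> complex) \<Rightarrow> (nat \<Rightarrow> complex) \<Rightarrow> (nat \<Rightarrow> complex) \<Rightarrow> nat \<Rightarrow> rmat" where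
  "wdiff2 \<eta> z u v 0 = 0"
| "wdiff2 \<eta> z u v (Suc j) = wdiff2 \<eta> z u v j * letter (\<eta> ! j) (z j)
     + wdiff \<eta> z u j * elem (\<eta> ! j + 1) (\<eta> ! j + 1) (v j)
     + wdiff \<eta> z v j * elem (\<eta> ! j + 1) (\<eta> ! j + 1) (u j)"

lemma wdiff2_commute: "wdiff2 \<eta> z u v j = wdiff2 \<eta> z v u j"
  by (induction j) (simp_all add: algebra_simps)

lemma mderiv_wdiff:
  "mderiv (\<lambda>s. wdiff \<eta> (\<lambda>k. z k + s * u k) v j) (wdiff2 \<eta> z u v j)"
proof (induction j)
  case 0
  then show ?case by (simp add: mderiv_const)
next
  case (Suc j)
  let ?z = "\<lambda>s k. z k + s * u k"
  have Y: "mderiv (\<lambda>s. wprod \<eta> (?z s) j) (wdiff \<eta> (?z 0) u j)"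
    by (rule mderiv_wprod) (auto intro!: derivative_eq_intros)
  show ?case
    unfolding mderiv_def
  proof (intro allI)
    fix a b
    show "((\<lambda>s. ent (wdiff \<eta> (?z s) v (Suc j)) a b) has_field_derivative
        ent (wdiff2 \<eta> z u v (Suc j)) a b) (at 0)"
      by (auto simp: ent_times_letter ent_times_elem intro!: derivative_eq_intros mderivD[OF Suc.IH]
          mderivD[OF Y])
  qed
qed

lemma line_deriv: "((\<lambda>s. c + s * d) has_field_derivative d) (at 0)" for c d :: complex
  by (auto intro!: derivative_eq_intros)

lemma mderiv_letter: "mderiv (\<lambda>s. letter i (c + s * d)) (elem (i + 1) (i + 1) d)"
  unfolding mderiv_def
proof (intro allI)
  fix a b
  have "ent (letter i z) a b = (if a = i + 1 \<and> b = i + 1 then z else ent (letter i 0) a b)" for z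
    by (simp add: ent_letter)
  then show "((\<lambda>s. ent (letter i (c + s * d)) a b) has_field_derivative ent (elem (i + 1) (i + 1) d) a b) (at 0)"
    by (cases "a = i + 1 \<and> b = i + 1") (auto simp: ent_elem line_deriv)
qed

lemma mderiv_wprod_line: "mderiv (\<lambda>s. wprod \<eta> (\<lambda>k. z k + s * v k) j) (wdiff \<eta> z v j)"
  using mderiv_wprod[of j "\<lambda>s k. z k + s * v k" v \<eta>] by (simp add: line_deriv)

lemma mderiv_winv_line: "mderiv (\<lambda>s. winv \<eta> (\<lambda>k. z k + s * v k) j)
    (- (winv \<eta> z j * wdiff \<eta> z v j * winv \<eta> z j))"
  using mderiv_winv[of j "\<lambda>s k. z k + s * v k" v \<eta>] by (simp add: line_deriv)

subsection \<open>The matrices of the braid variety and its 2-form\<close>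

definition to_mat :: "nat \<Rightarrow> rmat \<Rightarrow> complex mat" where
  "to_mat n X = mat n n (\<lambda>(a,b). ent X a b)"

lemma to_mat_carrier [simp]: "to_mat n X \<in> carrier_mat n n" by (simp add: to_mat_def)

lemma index_to_mat [simp]: "a < n \<Longrightarrow> b < n \<Longrightarrow> to_mat n X $$ (a,b) = ent X a b"
  by (simp add: to_mat_def)

lemma to_mat_one: "to_mat n 1 = 1\<^sub>m n"
  by (auto simp: to_mat_def ent_one)

lemma to_mat_times:
  assumes "unit_block n X \<or> zero_block n X"
  shows "to_mat n (X * Y) = to_mat n X * to_mat n Y"
proof (rule eq_matI)
  fix a b assume "a < dim_row (to_mat n X * to_mat n Y)" "b < dim_col (to_mat n X * to_mat n Y)"
  then have ab: "a < n" "b < n" by (auto simp: to_mat_def)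
  have "ent (X * Y) a b = (\<Sum>j<n. ent X a j * ent Y j b)"
    using assms ent_times_unit_block[OF _ ab(1)] ent_times_zero_block by blast
  then show "to_mat n (X * Y) $$ (a,b) = (to_mat n X * to_mat n Y) $$ (a,b)"
    using ab by (simp add: to_mat_def scalar_prod_def atLeast0LessThan)
qed (auto simp: to_mat_def)

lemma B_eq_to_mat: "B n i z = to_mat n (letter i z)"
  by (auto simp: B_def to_mat_def ent_letter)

lemma foldr_braid:
  assumes "braid_word n \<eta>" "j \<le> length \<eta>" "A \<in> carrier_mat n n"
  shows "foldr (\<lambda>k M. B n (\<eta> ! k) (z k) * M) [0..<j] A = to_mat n (wprod \<eta> z j) * A"
  using assms(2,3)
proof (induction j arbitrary: A)
  case (Suc j)
  then have "foldr (\<lambda>k M. B n (\<eta> ! k) (z k) * M) [0..<Suc j] A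
      = to_mat n (wprod \<eta> z j) * (to_mat n (letter (\<eta> ! j) (z j)) * A)"
    by (simp add: B_eq_to_mat Suc.IH mult_carrier_mat[of _ n n])
  also have "\<dots> = to_mat n (wprod \<eta> z j) * to_mat n (letter (\<eta> ! j) (z j)) * A"
    using Suc.prems by (intro assoc_mult_mat[symmetric, of _ n n _ n _ n]) auto
  also have "\<dots> = to_mat n (wprod \<eta> z (Suc j)) * A"
    using Suc.prems by (simp add: to_mat_times unit_block_wprod[OF assms(1)])
  finally show ?case .
qed (simp add: to_mat_one)

lemma braid_mat_eq: "braid_word n \<eta> \<Longrightarrow> braid_mat n \<eta> z = to_mat n (wprod \<eta> z (length \<eta>))"
  unfolding braid_mat_def by (simp add: foldr_braid right_mult_one_mat[of _ n])

lemma braid_word_take: "braid_word n \<eta> \<Longrightarrow> braid_word n (take k \<eta>)"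
  unfolding braid_word_def by (meson in_set_takeD)

lemma braid_mat_take:
  assumes "braid_word n \<eta>" "k \<le> length \<eta>"
  shows "braid_mat n (take k \<eta>) z = to_mat n (wprod \<eta> z k)"
  using assms by (simp add: braid_mat_eq braid_word_take min_absorb2)
    (auto intro!: arg_cong[of _ _ "to_mat n"] wprod_cong)

text \<open>\<open>mat_inverse\<close> returns an option: membership in the units excludes failure,
  and uniqueness of inverses identifies the result.\<close>

lemma mat_inverse_to_mat:
  assumes "unit_block n X" "unit_block n Y" "X * Y = 1" "Y * X = 1"
  shows "the (mat_inverse (to_mat n X)) = to_mat n Y"
proof -
  have XY: "to_mat n X * to_mat n Y = 1\<^sub>m n" "to_mat n Y * to_mat n X = 1\<^sub>m n"
    using assms by (simp_all flip: to_mat_times to_mat_one)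
  have "to_mat n X \<in> Units (ring_mat TYPE(complex) n n)"
    unfolding Units_def using XY by (auto simp: ring_mat_def)
  then obtain Z where Z: "mat_inverse (to_mat n X) = Some Z"
    using mat_inverse(1)[of "to_mat n X" n n] by fastforce
  then have Z': "to_mat n X * Z = 1\<^sub>m n" "Z \<in> carrier_mat n n"
    using mat_inverse(2)[OF to_mat_carrier Z] by auto
  have "to_mat n Y = to_mat n Y * (to_mat n X * Z)" by (simp add: Z' right_mult_one_mat[of _ n n])
  also have "\<dots> = (to_mat n Y * to_mat n X) * Z"
    using Z' by (intro assoc_mult_mat[symmetric, of _ n n _ n _ n]) auto
  also have "\<dots> = Z" using Z' XY by simp
  finally show ?thesis using Z by simp
qed

lemma dderivI:
  "((\<lambda>s. f (\<lambda>i. x i + s * v i)) has_field_derivative d) (at 0) \<Longrightarrow> dderiv f x v = d"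
  unfolding dderiv_def by (rule DERIV_imp_deriv)

lemma dmat_eq_to_mat:
  assumes "\<And>s. f (\<lambda>i. x i + s * v i) = to_mat n (F s)" "mderiv F F'"
  shows "dmat n f x v = to_mat n F'"
proof (rule eq_matI)
  fix a b assume "a < dim_row (to_mat n F')" "b < dim_col (to_mat n F')"
  then have ab: "a < n" "b < n" by (auto simp: to_mat_def)
  have "dderiv (\<lambda>x. f x $$ (a,b)) x v = ent F' a b"
    by (rule dderivI) (use assms ab in \<open>auto simp: mderiv_def\<close>)
  then show "dmat n f x v $$ (a,b) = to_mat n F' $$ (a,b)"
    using ab by (simp add: dmat_def)
qed (auto simp: dmat_def to_mat_def)

lemma mtrace_to_mat: "mtrace (to_mat n X) = tr n X"
  by (simp add: mtrace_def tr_def to_mat_def)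

section \<open>Logarithmic derivatives of partial products\<close>

definition wlog :: "nat list \<Rightarrow> (nat \<Rightarrow> complex) \<Rightarrow> (nat \<Rightarrow> complex) \<Rightarrow> nat \<Rightarrow> rmat" where
  "wlog \<eta> z v j = winv \<eta> z j * wdiff \<eta> z v j"

definition wform :: "nat list \<Rightarrow> nat two_form" where
  "wform \<eta> z u v = (\<Sum>j<length \<eta>.
     ent (wlog \<eta> z u j) (\<eta> ! j) (\<eta> ! j + 1) * v j - ent (wlog \<eta> z v j) (\<eta> ! j) (\<eta> ! j + 1) * u j)"

text \<open>For a single letter dg g^-1 is v_k times the elementary matrix at (i+1,i), so the trace
  reads off the entry (i,i+1) of f^-1 df.\<close>

lemma bracket_eq:
  assumes "braid_word n \<eta>" "k < length \<eta>"
  shows "bracket n (\<lambda>z. braid_mat n (take k \<eta>) z) (\<lambda>z. B n (\<eta> ! k) (z k)) z u v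
    = ent (wlog \<eta> z u k) (\<eta> ! k) (\<eta> ! k + 1) * v k - ent (wlog \<eta> z v k) (\<eta> ! k) (\<eta> ! k + 1) * u k"
proof -
  let ?i = "\<eta> ! k"
  have i: "Suc ?i < n" using assms by (rule braid_word_nth)
  have k: "k \<le> length \<eta>" using assms by simp
  have f: "braid_mat n (take k \<eta>) z = to_mat n (wprod \<eta> z k)" for z
    using assms by (intro braid_mat_take) auto
  have df: "dmat n (\<lambda>z. braid_mat n (take k \<eta>) z) z w = to_mat n (wdiff \<eta> z w k)" for w
    by (rule dmat_eq_to_mat[OF _ mderiv_wprod_line]) (rule f)
  have dletter: "dmat n (\<lambda>z. B n ?i (z k)) z w = to_mat n (elem (?i + 1) (?i + 1) (w k))" for w
    by (rule dmat_eq_to_mat[OF _ mderiv_letter]) (rule B_eq_to_mat)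
  have fi: "the (mat_inverse (to_mat n (wprod \<eta> z k))) = to_mat n (winv \<eta> z k)"
    using assms by (intro mat_inverse_to_mat unit_block_wprod unit_block_winv) auto
  have gi: "the (mat_inverse (to_mat n (letter ?i (z k)))) = to_mat n (letter_inv ?i (z k))"
    using i by (intro mat_inverse_to_mat) auto
  have trace_eq: "mtrace (to_mat n (winv \<eta> z k) * to_mat n (wdiff \<eta> z u k)
      * to_mat n (elem (?i + 1) (?i + 1) (v k)) * to_mat n (letter_inv ?i (z k)))
      = ent (wlog \<eta> z u k) ?i (?i + 1) * v k" for u v :: "nat \<Rightarrow> complex"
  proof -
    note bw = unit_block_winv[OF assms(1) k, of z] and zw = zero_block_wdiff[OF assms(1) k, of z u]
    have z: "zero_block n (winv \<eta> z k * wdiff \<eta> z u k)" using bw zw by simp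
    have z': "zero_block n (winv \<eta> z k * wdiff \<eta> z u k * elem (?i + 1) (?i + 1) (v k))"
      using i by (intro zero_block_times z zero_block_elem) auto
    have "mtrace (to_mat n (winv \<eta> z k) * to_mat n (wdiff \<eta> z u k)
        * to_mat n (elem (?i + 1) (?i + 1) (v k)) * to_mat n (letter_inv ?i (z k)))
        = tr n (wlog \<eta> z u k * (elem (?i + 1) (?i + 1) (v k) * letter_inv ?i (z k)))"
      using bw z z' by (simp add: wlog_def to_mat_times[symmetric] mtrace_to_mat mult.assoc)
    also have "\<dots> = ent (wlog \<eta> z u k) ?i (?i + 1) * v k"
      unfolding elem_letter_inv using i by (intro tr_times_elem) auto
    finally show ?thesis .
  qed
  show ?thesis
    unfolding bracket_def df dletter unfolding f fi B_eq_to_mat gi trace_eq ..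
qed

lemma braid_form_eq: "braid_word n \<eta> \<Longrightarrow> braid_form n \<eta> = wform \<eta>"
proof (intro ext)
  fix z u v assume "braid_word n \<eta>"
  then have "braid_form n \<eta> z u v = (\<Sum>j=1..<length \<eta>.
     ent (wlog \<eta> z u j) (\<eta> ! j) (\<eta> ! j + 1) * v j - ent (wlog \<eta> z v j) (\<eta> ! j) (\<eta> ! j + 1) * u j)"
    unfolding braid_form_def by (intro sum.cong refl bracket_eq) auto
  \<comment> \<open>\<open>braid_form\<close> starts at the second letter; the term of the first one
    vanishes, because the empty product is constant.\<close>
  also have "\<dots> = wform \<eta> z u v"
    unfolding wform_def
    by (rule sum.mono_neutral_left) (auto simp: wlog_def not_less_eq_eq Suc_le_eq)
  finally show "braid_form n \<eta> z u v = wform \<eta> z u v" .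
qed

section \<open>The half twist\<close>

lemma delta_Suc: "delta (Suc n) = [0..<n] @ delta n"
  by (cases n) (simp_all add: delta_def)

lemma delta_0 [simp]: "delta 0 = []"
  by (simp add: delta_def)

lemma braid_word_delta: "braid_word n (delta n)"
proof (induction n)
  case (Suc n)
  then show ?case by (auto simp: braid_word_def delta_Suc)
qed (simp add: braid_word_def)

lemma w0_w0 [simp]: "w0 n (w0 n a) = a"
  by (auto simp: w0_def)

lemma w0_mono: "b < a \<Longrightarrow> a < n \<Longrightarrow> w0 n a < w0 n b"
  by (auto simp: w0_def)

text \<open>Each letter pushes the column that holds the variables one place to the right, appends
  its own variable to it and leaves a shifted unit vector behind.\<close>

lemma ent_wprod_upt:
  "ent (wprod [0..<n] y j) a b = (if b < j then (if a = b + 1 then 1 else 0)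
     else if b = j then (if a = 0 then 1 else if a \<le> j then y (a - 1) else 0)
     else if a = b then 1 else 0)" if "j \<le> n"
  using that
proof (induction j arbitrary: a b)
  case (Suc j)
  then show ?case by (auto simp: ent_times_letter le_Suc_eq)
qed (auto simp: ent_one)

lemma ent_wprod_upt_times:
  "ent (wprod [0..<n] y n * X) a b = (if a = 0 then ent X n b
     else if a \<le> n then ent X (a - 1) b + y (a - 1) * ent X n b else ent X a b)"
  by (subst ent_times[where J="if a = 0 then {n} else if a \<le> n then {a - 1, n} else {a}"])
    (auto simp: ent_wprod_upt split: if_splits)

text \<open>The letter of \<open>delta n\<close> whose variable is the entry \<open>(a,b)\<close>, \<open>b < a < n\<close>.\<close>

fun delta_pos :: "nat \<Rightarrow> nat \<Rightarrow> nat \<Rightarrow> nat" where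
  "delta_pos n a 0 = a - 1"
| "delta_pos n a (Suc b) = (n - 1) + delta_pos (n - 1) (a - 1) b"

definition lmat :: "nat \<Rightarrow> (nat \<Rightarrow> complex) \<Rightarrow> rmat" where
  "lmat n y = Rmat (\<lambda>a b. if a = b then 1 else if b < a \<and> a < n then y (delta_pos n a b) else 0)"

lemma ent_lmat:
  "ent (lmat n y) a b = (if a = b then 1 else if b < a \<and> a < n then y (delta_pos n a b) else 0)"
proof -
  have "finite {b. (if a = b then 1 else if b < a \<and> a < n then y (delta_pos n a b) else 0) \<noteq> (0 :: complex)}" for a
    by (rule finite_subset[of _ "{..a}"]) (auto split: if_splits)
  then show ?thesis by (simp add: lmat_def ent_Rmat)
qed

text \<open>Induction on n: the first n letters of the larger half twist fill column 0 with new
  variables, and the remaining letters form the half twist on n strands, whose triangular matrix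
  fills the other columns.\<close>

lemma wprod_delta: "wprod (delta n) y (length (delta n)) * pmat (w0 n) = lmat n y"
proof (induction n arbitrary: y)
  case 0
  show ?case by (rule rmat_eqI) (auto simp: ent_pmat w0_def ent_lmat)
next
  case (Suc n)
  let ?y = "\<lambda>k. y (n + k)"
  have d: "wprod (delta n) ?y (length (delta n)) = lmat n ?y * pmat (w0 n)"
    unfolding Suc.IH[symmetric] by (simp add: mult.assoc pmat_pmat)
  have "wprod (delta (Suc n)) y (length (delta (Suc n)))
      = wprod [0..<n] y n * (lmat n ?y * pmat (w0 n))"
    using wprod_append[of "[0..<n]" "delta n" y "length (delta n)"] by (simp add: delta_Suc d)
  then have eq: "wprod (delta (Suc n)) y (length (delta (Suc n))) * pmat (w0 (Suc n))
      = wprod [0..<n] y n * (lmat n ?y * pmat (w0 n) * pmat (w0 (Suc n)))"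
    by (simp add: mult.assoc)
  show ?case
  proof (rule rmat_eqI)
    fix a b
    \<comment> \<open>The two reversals compose to a cyclic shift of the columns; the matching shift
      of the rows comes from \<open>ent_wprod_upt_times\<close>.\<close>
    have c: "w0 n (w0 (Suc n) b) = (if b = 0 then n else if b \<le> n then b - 1 else b)"
      by (cases "b = 0"; cases "b \<le> n") (simp_all add: w0_def)
    have i: "delta_pos (Suc n) a b = n + delta_pos n (a - 1) (b - 1)" if "b \<noteq> 0"
      using that by (cases b) auto
    show "ent (wprod (delta (Suc n)) y (length (delta (Suc n))) * pmat (w0 (Suc n))) a b
        = ent (lmat (Suc n) y) a b"
    proof (cases "b = 0")
      case True
      then show ?thesis
        unfolding eq ent_wprod_upt_times ent_times_pmat[OF w0_w0] c ent_lmat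
        by (cases a) auto
    next
      case False
      then have "delta_pos (Suc n) a b = n + delta_pos n (a - 1) (b - 1)" by (rule i)
      with False show ?thesis
        unfolding eq ent_wprod_upt_times ent_times_pmat[OF w0_w0] c ent_lmat
        by (cases a; cases b) (auto simp del: delta_pos.simps)
    qed
  qed
qed

lemma delta_pos_less: "b < a \<Longrightarrow> a < n \<Longrightarrow> delta_pos n a b < length (delta n)"
proof (induction n arbitrary: a b)
  case (Suc n)
  show ?case
  proof (cases b)
    case 0
    then show ?thesis using Suc.prems by (simp add: delta_Suc)
  next
    case (Suc b')
    then show ?thesis using Suc.prems Suc.IH[of b' "a - 1"] by (simp add: delta_Suc)
  qed
qed simp

text \<open>The inverse of \<open>delta_pos\<close>, by which variables of the half twist can be
  prescribed through matrix entries. The value for no strands is a dummy.\<close>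

fun delta_entry :: "nat \<Rightarrow> nat \<Rightarrow> nat \<times> nat" where
  "delta_entry 0 j = (0, 0)"
| "delta_entry (Suc n) j = (if j < n then (j + 1, 0) else map_prod Suc Suc (delta_entry n (j - n)))"

lemma delta_entry_delta_pos: "b < a \<Longrightarrow> a < n \<Longrightarrow> delta_entry n (delta_pos n a b) = (a, b)"
proof (induction n arbitrary: a b)
  case (Suc n)
  show ?case
  proof (cases b)
    case 0
    then show ?thesis using Suc.prems by auto
  next
    case (Suc b')
    then show ?thesis using Suc.prems Suc.IH[of b' "a - 1"] by auto
  qed
qed simp

lemma delta_pos_delta_entry: "j < length (delta n) \<Longrightarrow>
    (case delta_entry n j of (a, b) \<Rightarrow> b < a \<and> a < n \<and> delta_pos n a b = j)"
proof (induction n arbitrary: j)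
  case (Suc n)
  show ?case
  proof (cases "j < n")
    case False
    then have "j - n < length (delta n)" using Suc.prems by (simp add: delta_Suc)
    from Suc.IH[OF this] False show ?thesis by (auto split: prod.splits)
  qed simp
qed simp

subsection \<open>Permutations\<close>

lemma word_perm_append: "word_perm (x @ y) = word_perm x \<circ> word_perm y"
  by (induction x) (auto simp: word_perm_def)

lemma word_perm_Cons: "word_perm (i # x) = Transposition.transpose i (i + 1) \<circ> word_perm x"
  by (simp add: word_perm_def)

lemma word_perm_Nil [simp]: "word_perm [] = id"
  by (simp add: word_perm_def)

lemma word_perm_take_Suc:
  "j < length \<eta> \<Longrightarrow> word_perm (take (Suc j) \<eta>) = word_perm (take j \<eta>) \<circ> Transposition.transpose (\<eta> ! j) (\<eta> ! j + 1)"
  by (simp add: take_Suc_conv_app_nth word_perm_append word_perm_Cons)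

lemma word_perm_permutes: "braid_word n \<eta> \<Longrightarrow> word_perm \<eta> permutes {..<n}"
proof (induction \<eta>)
  case (Cons i \<eta>)
  then have "word_perm \<eta> permutes {..<n}" "Transposition.transpose i (i + 1) permutes {..<n}"
    by (auto simp: braid_word_def intro!: permutes_swap_id)
  then show ?case using permutes_compose by (simp only: word_perm_Cons)
qed (simp add: permutes_id)

lemma word_perm_less: "braid_word n \<eta> \<Longrightarrow> k < n \<Longrightarrow> word_perm \<eta> k < n"
  using permutes_in_image[OF word_perm_permutes] by blast

lemma word_perm_upt: "word_perm [0..<n] k = (if k < n then k + 1 else if k = n then 0 else k)"
proof (induction n arbitrary: k)
  case (Suc n)
  then show ?case
    by (auto simp: word_perm_append word_perm_Cons Transposition.transpose_def)
qed simp

lemma word_perm_delta: "word_perm (delta n) = w0 n"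
proof (induction n)
  case (Suc n)
  show ?case
    by (rule ext) (auto simp: delta_Suc word_perm_append Suc word_perm_upt w0_def)
qed (auto simp: w0_def)

subsection \<open>The torus action\<close>

lemma torus_act_nth: "k < length \<eta> \<Longrightarrow> torus_act \<eta> t z k
    = t (word_perm (take k \<eta>) (\<eta> ! k + 1)) / t (word_perm (take k \<eta>) (\<eta> ! k)) * z k"
  by (simp add: torus_act_def)

text \<open>A braid word only meets strands below n. Torus elements can therefore be changed to 1 on
  the other indices, where \<open>diagonal t\<close> must be invertible too.\<close>

lemma torus_act_cong:
  assumes "braid_word n \<eta>" "\<And>k. k < n \<Longrightarrow> t k = t' k"
  shows "torus_act \<eta> t z = torus_act \<eta> t' z"
proof (rule ext)
  fix k
  have "word_perm (take k \<eta>) (\<eta> ! k + 1) < n" "word_perm (take k \<eta>) (\<eta> ! k) < n" if "k < length \<eta>"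
    using braid_word_nth[OF assms(1) that]
    by (auto intro!: word_perm_less braid_word_take assms(1))
  then show "torus_act \<eta> t z k = torus_act \<eta> t' z k"
    by (simp add: torus_act_def assms(2))
qed

text \<open>The origin of the torus weights: a diagonal matrix that is moved across a letter gets
  permuted, at the price of rescaling the variable.\<close>

lemma diagonal_letter:
  assumes "\<And>k. d k \<noteq> 0"
  shows "diagonal (\<lambda>k. inverse (d k)) * letter i (d (i + 1) / d i * z)
    = letter i z * diagonal (\<lambda>k. inverse (d (Transposition.transpose i (i + 1) k)))"
  by (rule rmat_eqI) (auto simp: ent_diagonal_times ent_times_diagonal ent_letter Transposition.transpose_def assms field_simps)

lemma diagonal_elem:
  assumes "\<And>k. d k \<noteq> 0"
  shows "diagonal (\<lambda>k. inverse (d k)) * elem (i + 1) (i + 1) (d (i + 1) / d i * z)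
    = elem (i + 1) (i + 1) z * diagonal (\<lambda>k. inverse (d (Transposition.transpose i (i + 1) k)))"
  by (rule rmat_eqI) (auto simp: ent_diagonal_times ent_times_diagonal ent_elem Transposition.transpose_def assms field_simps)

lemma wprod_torus_act:
  assumes t: "\<And>k. t k \<noteq> 0" and "j \<le> length \<eta>"
  shows "wprod \<eta> (torus_act \<eta> t z) j
    = diagonal t * wprod \<eta> z j * diagonal (\<lambda>k. inverse (t (word_perm (take j \<eta>) k)))"
  using assms(2)
proof (induction j)
  case 0
  show ?case using diagonal_inverse[OF t] by simp
next
  case (Suc j)
  let ?w = "word_perm (take j \<eta>)"
  have "wprod \<eta> (torus_act \<eta> t z) (Suc j) = diagonal t * wprod \<eta> z j *
      (diagonal (\<lambda>k. inverse (t (?w k))) * letter (\<eta> ! j) (t (?w (\<eta> ! j + 1)) / t (?w (\<eta> ! j)) * z j))"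
    using Suc by (simp add: torus_act_nth mult.assoc)
  also have "\<dots> = diagonal t * wprod \<eta> z (Suc j) * diagonal (\<lambda>k. inverse (t (word_perm (take (Suc j) \<eta>) k)))"
    using diagonal_letter[of "\<lambda>k. t (?w k)"] t Suc.prems
    by (simp add: mult.assoc word_perm_take_Suc)
  finally show ?case .
qed

lemma wdiff_torus_act:
  assumes t: "\<And>k. t k \<noteq> 0" and "j \<le> length \<eta>"
  shows "wdiff \<eta> (torus_act \<eta> t z) (torus_act \<eta> t v) j
    = diagonal t * wdiff \<eta> z v j * diagonal (\<lambda>k. inverse (t (word_perm (take j \<eta>) k)))"
  using assms(2)
proof (induction j)
  case 0
  show ?case by simp
next
  case (Suc j)
  let ?w = "word_perm (take j \<eta>)"
  let ?c = "t (?w (\<eta> ! j + 1)) / t (?w (\<eta> ! j))"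
  have "wdiff \<eta> (torus_act \<eta> t z) (torus_act \<eta> t v) (Suc j) = diagonal t * wdiff \<eta> z v j *
      (diagonal (\<lambda>k. inverse (t (?w k))) * letter (\<eta> ! j) (?c * z j))
      + diagonal t * wprod \<eta> z j * (diagonal (\<lambda>k. inverse (t (?w k))) * elem (\<eta> ! j + 1) (\<eta> ! j + 1) (?c * v j))"
    using Suc wprod_torus_act[OF t, where j=j and \<eta>=\<eta> and z=z] by (simp add: torus_act_nth mult.assoc)
  also have "\<dots> = diagonal t * wdiff \<eta> z v (Suc j) * diagonal (\<lambda>k. inverse (t (word_perm (take (Suc j) \<eta>) k)))"
    using diagonal_letter[of "\<lambda>k. t (?w k)"] diagonal_elem[of "\<lambda>k. t (?w k)"] t Suc.prems
    by (simp add: mult.assoc word_perm_take_Suc distrib_left distrib_right)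
  finally show ?case .
qed

text \<open>The linearization of \<open>diagonal_letter\<close> at the unit of the torus.\<close>

lemma diagonal_letter_infinitesimal:
  "letter i z * diagonal (\<lambda>k. d (Transposition.transpose i (i + 1) k)) + elem (i + 1) (i + 1) ((d (i + 1) - d i) * z)
    = diagonal d * letter i z"
  by (rule rmat_eqI) (auto simp: ent_diagonal_times ent_times_diagonal ent_letter ent_elem Transposition.transpose_def algebra_simps)

text \<open>The derivative of the torus action in the direction \<open>\<tau>\<close> of its Lie algebra.\<close>

definition torus_inf :: "nat list \<Rightarrow> (nat \<Rightarrow> complex) \<Rightarrow> (nat \<Rightarrow> complex) \<Rightarrow> nat \<Rightarrow> complex" where
  "torus_inf \<eta> \<tau> z = (\<lambda>k. if k < length \<eta>
     then (\<tau> (word_perm (take k \<eta>) (\<eta> ! k + 1)) - \<tau> (word_perm (take k \<eta>) (\<eta> ! k))) * z k else 0)"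

lemma wdiff_torus_inf:
  assumes "j \<le> length \<eta>"
  shows "wdiff \<eta> z (torus_inf \<eta> \<tau> z) j
    = diagonal \<tau> * wprod \<eta> z j - wprod \<eta> z j * diagonal (\<lambda>k. \<tau> (word_perm (take j \<eta>) k))"
  using assms
proof (induction j)
  case 0
  show ?case by simp
next
  case (Suc j)
  let ?w = "word_perm (take j \<eta>)"
  let ?e = "elem (\<eta> ! j + 1) (\<eta> ! j + 1) ((\<tau> (?w (\<eta> ! j + 1)) - \<tau> (?w (\<eta> ! j))) * z j)"
  have *: "diagonal (\<lambda>k. \<tau> (?w k)) * letter (\<eta> ! j) (z j)
      = letter (\<eta> ! j) (z j) * diagonal (\<lambda>k. \<tau> (word_perm (take (Suc j) \<eta>) k)) + ?e"
    using diagonal_letter_infinitesimal[of "\<eta> ! j" "z j" "\<lambda>k. \<tau> (?w k)"] Suc.prems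
    by (simp add: word_perm_take_Suc)
  have "wdiff \<eta> z (torus_inf \<eta> \<tau> z) (Suc j) = diagonal \<tau> * wprod \<eta> z j * letter (\<eta> ! j) (z j)
      - wprod \<eta> z j * (diagonal (\<lambda>k. \<tau> (?w k)) * letter (\<eta> ! j) (z j)) + wprod \<eta> z j * ?e"
    using Suc by (simp add: torus_inf_def left_diff_distrib mult.assoc)
  also have "\<dots> = diagonal \<tau> * wprod \<eta> z (Suc j)
      - wprod \<eta> z (Suc j) * diagonal (\<lambda>k. \<tau> (word_perm (take (Suc j) \<eta>) k))"
    unfolding * by (simp add: algebra_simps)
  finally show ?case .
qed

text \<open>The torus conjugates \<open>wlog\<close> by a diagonal matrix; the resulting factor of
  the entry (i,i+1) is the inverse of the weight by which the variable of the letter is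
  multiplied.\<close>

lemma wform_torus_act:
  assumes t: "\<And>k. t k \<noteq> 0"
  shows "wform \<eta> (torus_act \<eta> t z) (torus_act \<eta> t u) (torus_act \<eta> t v) = wform \<eta> z u v"
proof -
  have inv: "winv \<eta> (torus_act \<eta> t z) j
      = diagonal (\<lambda>k. t (word_perm (take j \<eta>) k)) * winv \<eta> z j * diagonal (\<lambda>k. inverse (t k))"
    if "j \<le> length \<eta>" for j
  proof -
    let ?d = "diagonal (\<lambda>k. t (word_perm (take j \<eta>) k))" and ?di = "diagonal (\<lambda>k. inverse (t (word_perm (take j \<eta>) k)))"
    let ?R = "?d * winv \<eta> z j * diagonal (\<lambda>k. inverse (t k))"
    have d: "?di * (?d * X) = X" "diagonal t * (diagonal (\<lambda>k. inverse (t k)) * X) = X" for X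
      using diagonal_inverse[of "\<lambda>k. t (word_perm (take j \<eta>) k)"] diagonal_inverse[of t] t by (simp_all flip: mult.assoc)
    have "wprod \<eta> (torus_act \<eta> t z) j * ?R = 1"
      using diagonal_inverse[OF t] by (simp add: wprod_torus_act[OF t that] mult.assoc d)
    then have "winv \<eta> (torus_act \<eta> t z) j * (wprod \<eta> (torus_act \<eta> t z) j * ?R) = winv \<eta> (torus_act \<eta> t z) j"
      by simp
    then show ?thesis by simp
  qed
  have log: "wlog \<eta> (torus_act \<eta> t z) (torus_act \<eta> t u) j
      = diagonal (\<lambda>k. t (word_perm (take j \<eta>) k)) * wlog \<eta> z u j * diagonal (\<lambda>k. inverse (t (word_perm (take j \<eta>) k)))"
    if "j \<le> length \<eta>" for j u
  proof -
    have "diagonal (\<lambda>k. inverse (t k)) * (diagonal t * X) = X" for X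
      using diagonal_inverse[of t] t by (simp flip: mult.assoc)
    then show ?thesis
      by (simp add: wlog_def inv[OF that] wdiff_torus_act[OF t that] mult.assoc)
  qed
  show ?thesis
    unfolding wform_def
    by (intro sum.cong refl) (simp add: log ent_diagonal_times ent_times_diagonal torus_act_nth t field_simps)
qed

section \<open>The kernel of the 2-form\<close>

text \<open>dY Y^-1, as opposed to Y^-1 dY for \<open>wlog\<close>. It is additive along the word,
  each letter adding a conjugate of an elementary matrix, and for the full word it is upper
  triangular along the braid variety.\<close>

definition wlogr :: "nat list \<Rightarrow> (nat \<Rightarrow> complex) \<Rightarrow> (nat \<Rightarrow> complex) \<Rightarrow> nat \<Rightarrow> rmat" where
  "wlogr \<eta> z v j = wdiff \<eta> z v j * winv \<eta> z j"

lemma zero_block_wlogr: "braid_word n \<eta> \<Longrightarrow> j \<le> length \<eta> \<Longrightarrow> zero_block n (wlogr \<eta> z v j)"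
  by (simp add: wlogr_def zero_block_wdiff unit_block_winv)

lemma wlogr_0 [simp]: "wlogr \<eta> z v 0 = 0"
  by (simp add: wlogr_def)

lemma wlogr_Suc: "wlogr \<eta> z v (Suc j)
    = wlogr \<eta> z v j + wprod \<eta> z j * elem (\<eta> ! j + 1) (\<eta> ! j) (v j) * winv \<eta> z j"
proof -
  have "wlogr \<eta> z v (Suc j) = wdiff \<eta> z v j * (letter (\<eta> ! j) (z j) * letter_inv (\<eta> ! j) (z j)) * winv \<eta> z j
      + wprod \<eta> z j * (elem (\<eta> ! j + 1) (\<eta> ! j + 1) (v j) * letter_inv (\<eta> ! j) (z j)) * winv \<eta> z j"
    unfolding wlogr_def wdiff.simps winv.simps by (simp only: distrib_right mult.assoc)
  then show ?thesis unfolding elem_letter_inv by (simp add: wlogr_def)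
qed

text \<open>By cyclicity of the trace, pairing S with the increment Y E Y^-1 of \<open>wlogr\<close>
  reads off one entry of Y^-1 S Y.\<close>

lemma tr_conj_elem:
  assumes "braid_word n \<eta>" "j < length \<eta>"
  shows "tr n (S * (wprod \<eta> z j * elem (\<eta> ! j + 1) (\<eta> ! j) c * winv \<eta> z j))
    = c * ent (winv \<eta> z j * S * wprod \<eta> z j) (\<eta> ! j) (\<eta> ! j + 1)"
proof -
  let ?i = "\<eta> ! j"
  have i: "Suc ?i < n" using assms by (rule braid_word_nth)
  have b: "unit_block n (winv \<eta> z j)" using assms by (intro unit_block_winv) auto
  have z: "zero_block n (elem (?i + 1) ?i c)" using i by (intro zero_block_elem) auto
  have z': "zero_block n (elem (?i + 1) ?i c * winv \<eta> z j)" using z b by (rule zero_block_times_unit_block)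
  have "tr n (S * (wprod \<eta> z j * elem (?i + 1) ?i c * winv \<eta> z j))
      = tr n ((S * wprod \<eta> z j) * (elem (?i + 1) ?i c * winv \<eta> z j))"
    by (simp add: mult.assoc)
  also have "\<dots> = tr n (elem (?i + 1) ?i c * (winv \<eta> z j * S * wprod \<eta> z j))"
    by (subst tr_commute[OF z', symmetric]) (simp add: mult.assoc)
  also have "\<dots> = tr n ((winv \<eta> z j * S * wprod \<eta> z j) * elem (?i + 1) ?i c)"
    by (rule tr_commute[OF z])
  also have "\<dots> = c * ent (winv \<eta> z j * S * wprod \<eta> z j) ?i (?i + 1)"
    using i by (subst tr_times_elem) auto
  finally show ?thesis .
qed

text \<open>The coefficients of the linear functional v \<mapsto> tr (S dY(v) Y^-1) in the
  coordinates v_k; with S a matrix of multipliers they are compared with those of the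
  2-form.\<close>

lemma tr_wlogr:
  assumes "braid_word n \<eta>" "j \<le> length \<eta>"
  shows "tr n (S * wlogr \<eta> z v j)
    = (\<Sum>k<j. v k * ent (winv \<eta> z k * S * wprod \<eta> z k) (\<eta> ! k) (\<eta> ! k + 1))"
  using assms(2)
proof (induction j)
  case 0
  show ?case by (simp add: tr_def)
next
  case (Suc j)
  then show ?case
    by (simp add: wlogr_Suc distrib_left tr_add tr_conj_elem[OF assms(1), unfolded Suc_eq_plus1[symmetric]])
qed

lemma winv_wlogr_wprod: "winv \<eta> z j * wlogr \<eta> z u j * wprod \<eta> z j = wlog \<eta> z u j"
  by (simp add: wlogr_def wlog_def mult.assoc)

text \<open>The symmetric bilinear form \<open>tr (R(u) R(v))\<close> has the same coefficients above the diagonal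
  as the 2-form, because \<open>E\<^sup>2 = 0\<close> for the logarithmic derivative \<open>E\<close> of a letter.\<close>

lemma tr_wlogr_wlogr:
  assumes "braid_word n \<eta>" "j \<le> length \<eta>"
  shows "tr n (wlogr \<eta> z u j * wlogr \<eta> z v j)
    = (\<Sum>k<j. v k * ent (wlog \<eta> z u k) (\<eta> ! k) (\<eta> ! k + 1) + u k * ent (wlog \<eta> z v k) (\<eta> ! k) (\<eta> ! k + 1))"
  using assms(2)
proof (induction j)
  case 0
  show ?case by (simp add: tr_def)
next
  case (Suc j)
  let ?i = "\<eta> ! j" and ?Y = "wprod \<eta> z j" and ?Z = "winv \<eta> z j"
  let ?E = "\<lambda>v. ?Y * elem (?i + 1) ?i (v j) * ?Z"
  have j: "j < length \<eta>" using Suc.prems by simp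
  have i: "Suc ?i < n" using assms(1) j by (rule braid_word_nth)
  have "?E u * ?E v = ?Y * (elem (?i + 1) ?i (u j) * elem (?i + 1) ?i (v j)) * ?Z"
    by (simp add: mult.assoc)
  also have "elem (?i + 1) ?i (u j) * elem (?i + 1) ?i (v j) = 0"
    by (rule rmat_eqI) (simp add: ent_elem_times ent_elem)
  finally have EE: "?E u * ?E v = 0" by simp
  have zE: "zero_block n (?E u)"
    using i j by (intro zero_block_times_unit_block zero_block_unit_block_times unit_block_wprod unit_block_winv zero_block_elem assms(1)) auto
  have "tr n (wlogr \<eta> z u (Suc j) * wlogr \<eta> z v (Suc j))
      = tr n (wlogr \<eta> z u j * wlogr \<eta> z v j) + tr n (wlogr \<eta> z u j * ?E v) + tr n (?E u * wlogr \<eta> z v j)"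
    using EE by (simp add: wlogr_Suc distrib_left distrib_right tr_add)
  also have "tr n (?E u * wlogr \<eta> z v j) = tr n (wlogr \<eta> z v j * ?E u)"
    by (rule tr_commute[OF zE])
  also have "tr n (wlogr \<eta> z u j * ?E v) = v j * ent (wlog \<eta> z u j) ?i (?i + 1)"
    by (simp only: tr_conj_elem[OF assms(1) j] winv_wlogr_wprod)
  also have "tr n (wlogr \<eta> z v j * ?E u) = u j * ent (wlog \<eta> z v j) ?i (?i + 1)"
    by (simp only: tr_conj_elem[OF assms(1) j] winv_wlogr_wprod)
  finally show ?case using Suc by simp
qed

text \<open>The identity a - b = 2 a - (a + b), whose symmetric part a + b is the trace form. The
  latter becomes a sum over diagonal entries when the arguments are tangent to the braid
  variety.\<close>

lemma wform_eq_trace: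
  assumes "braid_word n \<eta>"
  shows "wform \<eta> z u v = 2 * (\<Sum>k<length \<eta>. v k * ent (wlog \<eta> z u k) (\<eta> ! k) (\<eta> ! k + 1))
    - tr n (wlogr \<eta> z u (length \<eta>) * wlogr \<eta> z v (length \<eta>))"
  unfolding tr_wlogr_wlogr[OF assms order_refl] wform_def
  by (simp add: sum_distrib_left sum_subtractf sum.distrib algebra_simps)

text \<open>The matrices that are propagated through the word: the derivative of the 2-form along the
  variable of a letter, with \<open>S\<close> a Lagrange multiplier, is an entry of one of them.\<close>

definition prop_mat :: "nat list \<Rightarrow> (nat \<Rightarrow> complex) \<Rightarrow> (nat \<Rightarrow> complex) \<Rightarrow> rmat \<Rightarrow> nat \<Rightarrow> rmat" where
  "prop_mat \<eta> z u S j = winv \<eta> z j * S * wprod \<eta> z j - 2 * wlog \<eta> z u j"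

lemma prop_mat_0 [simp]: "prop_mat \<eta> z u S 0 = S"
  by (simp add: prop_mat_def wlog_def)

lemma wlog_Suc: "wlog \<eta> z u (Suc j)
    = letter_inv (\<eta> ! j) (z j) * wlog \<eta> z u j * letter (\<eta> ! j) (z j) + elem (\<eta> ! j) (\<eta> ! j + 1) (u j)"
proof -
  have "wlog \<eta> z u (Suc j) = letter_inv (\<eta> ! j) (z j) * wlog \<eta> z u j * letter (\<eta> ! j) (z j)
      + letter_inv (\<eta> ! j) (z j) * (winv \<eta> z j * wprod \<eta> z j) * elem (\<eta> ! j + 1) (\<eta> ! j + 1) (u j)"
    unfolding wlog_def wdiff.simps winv.simps by (simp only: distrib_left mult.assoc)
  also have "letter_inv (\<eta> ! j) (z j) * (winv \<eta> z j * wprod \<eta> z j) * elem (\<eta> ! j + 1) (\<eta> ! j + 1) (u j)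
      = elem (\<eta> ! j) (\<eta> ! j + 1) (u j)"
    by (simp only: winv_wprod mult_1_right letter_inv_elem)
  finally show ?thesis .
qed

lemma prop_mat_Suc: "prop_mat \<eta> z u S (Suc j)
    = letter_inv (\<eta> ! j) (z j) * prop_mat \<eta> z u S j * letter (\<eta> ! j) (z j) - 2 * elem (\<eta> ! j) (\<eta> ! j + 1) (u j)"
  unfolding prop_mat_def wlog_Suc by (simp add: algebra_simps mult_2 mult_2_right)

text \<open>Conjugation by a letter carries the entry (i,i+1) to (i+1,i) and swaps two diagonal
  entries; the entry that is assumed to vanish is the only obstruction to staying
  triangular.\<close>

lemma upper_conj_letter:
  assumes "upper X" "ent X i (i + 1) = 0"
  shows "upper (letter_inv i z * X * letter i z)"
    and "ent (letter_inv i z * X * letter i z) k k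
      = ent X (Transposition.transpose i (i + 1) k) (Transposition.transpose i (i + 1) k)"
  using assms
  by (auto simp: upper_def ent_times_letter ent_letter_inv_times Transposition.transpose_def)

text \<open>Besides the conjugation, a step subtracts a multiple of the elementary matrix at
  (i,i+1), which affects neither triangularity nor the diagonal.\<close>

lemma prop_mat_upper:
  assumes "upper S"
    and "\<And>k. k < length \<eta> \<Longrightarrow> ent (prop_mat \<eta> z u S k) (\<eta> ! k) (\<eta> ! k + 1) = 0"
    and "j \<le> length \<eta>"
  shows "upper (prop_mat \<eta> z u S j) \<and>
    (\<forall>k. ent (prop_mat \<eta> z u S j) k k = ent S (word_perm (take j \<eta>) k) (word_perm (take j \<eta>) k))"
  using assms(3)
proof (induction j)
  case 0
  then show ?case using assms(1) by simp
next
  case (Suc j)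
  then have IH: "upper (prop_mat \<eta> z u S j)"
    "\<And>k. ent (prop_mat \<eta> z u S j) k k = ent S (word_perm (take j \<eta>) k) (word_perm (take j \<eta>) k)" by auto
  have j: "j < length \<eta>" using Suc.prems by simp
  note c = upper_conj_letter[OF IH(1) assms(2)[OF j], of "z j"]
  have "upper (2 * elem (\<eta> ! j) (\<eta> ! j + 1) (u j))" by (auto simp: upper_def ent_elem)
  then show ?case
    using c j by (simp add: prop_mat_Suc IH(2) ent_elem word_perm_take_Suc)
qed

text \<open>If the matrix after a letter is 0, then undoing the step leaves 2 u_j times the
  elementary matrix at (i+1,i). This lies below the diagonal, so triangularity forces u_j =
  0.\<close>

lemma prop_mat_back:
  assumes up: "\<And>k. k \<le> length \<eta> \<Longrightarrow> upper (prop_mat \<eta> z u S k)"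
    and 0: "prop_mat \<eta> z u S (length \<eta>) = 0" and "j \<le> length \<eta>"
  shows "prop_mat \<eta> z u S j = 0 \<and> (\<forall>k. j \<le> k \<longrightarrow> k < length \<eta> \<longrightarrow> u k = 0)"
  using assms(3)
proof (induction j rule: inc_induct)
  case base
  then show ?case using 0 by simp
next
  case (step j)
  let ?i = "\<eta> ! j" and ?D = "prop_mat \<eta> z u S j"
  have "letter_inv ?i (z j) * ?D * letter ?i (z j) = 2 * elem ?i (?i + 1) (u j)"
    using step.IH by (simp add: prop_mat_Suc)
  then have "letter ?i (z j) * (letter_inv ?i (z j) * ?D * letter ?i (z j)) * letter_inv ?i (z j)
      = 2 * (letter ?i (z j) * elem ?i (?i + 1) (u j) * letter_inv ?i (z j))"
    by (simp add: algebra_simps mult_2 mult_2_right)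
  moreover have "letter ?i (z j) * (letter_inv ?i (z j) * ?D * letter ?i (z j)) * letter_inv ?i (z j)
      = (letter ?i (z j) * letter_inv ?i (z j)) * ?D * (letter ?i (z j) * letter_inv ?i (z j))"
    by (simp only: mult.assoc)
  ultimately have D: "?D = 2 * elem (?i + 1) ?i (u j)"
    unfolding letter_elem_letter_inv by simp
  have "ent ?D (?i + 1) ?i = 0"
    using up[of j] step.hyps by (simp add: upper_def)
  then have "u j = 0" by (simp add: D ent_elem)
  then show ?case using D step.IH
    by (metis Suc_leI elem_zero le_neq_implies_less mult_zero_right)
qed

section \<open>Linear functionals\<close>

definition lin_on :: "('i \<Rightarrow> complex) set \<Rightarrow> (('i \<Rightarrow> complex) \<Rightarrow> complex) \<Rightarrow> bool" where
  "lin_on V f \<longleftrightarrow> (\<forall>u\<in>V. \<forall>v\<in>V. \<forall>c. f (\<lambda>i. u i + c * v i) = f u + c * f v)"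

definition subsp :: "('i \<Rightarrow> complex) set \<Rightarrow> bool" where
  "subsp V \<longleftrightarrow> (\<lambda>_. 0) \<in> V \<and> (\<forall>u\<in>V. \<forall>v\<in>V. \<forall>c. (\<lambda>i. u i + c * v i) \<in> V)"

lemma subsp_0: "subsp V \<Longrightarrow> (\<lambda>_. 0) \<in> V"
  by (simp add: subsp_def)

lemma subspD: "subsp V \<Longrightarrow> u \<in> V \<Longrightarrow> v \<in> V \<Longrightarrow> (\<lambda>i. u i + c * v i) \<in> V"
  by (simp add: subsp_def)

lemma subsp_scale: "subsp V \<Longrightarrow> v \<in> V \<Longrightarrow> (\<lambda>i. c * v i) \<in> V"
  using subspD[OF _ subsp_0, of V v c] by simp

lemma lin_onD: "lin_on V f \<Longrightarrow> u \<in> V \<Longrightarrow> v \<in> V \<Longrightarrow> f (\<lambda>i. u i + c * v i) = f u + c * f v"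
  by (simp add: lin_on_def)

lemma lin_on_0: "lin_on V f \<Longrightarrow> subsp V \<Longrightarrow> f (\<lambda>_. 0) = 0"
  using lin_onD[of V f "\<lambda>_. 0" "\<lambda>_. 0" 1] subsp_0[of V] by simp

lemma lin_on_scale: "lin_on V f \<Longrightarrow> subsp V \<Longrightarrow> v \<in> V \<Longrightarrow> f (\<lambda>i. c * v i) = c * f v"
  using lin_onD[of V f "\<lambda>_. 0" v c] subsp_0[of V] lin_on_0[of V f] by simp

lemma subsp_coord_space: "subsp (coord_space I)"
  by (auto simp: subsp_def coord_space_def)

text \<open>Induction on the constraints. If the new one follows from the others, its multiplier is
  0; otherwise some v0 satisfies the others but not the new one, and the multiplier g(v0) / f_k(v0)
  reduces g to the previous case.\<close>

lemma lagrange_multipliers: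
  assumes "finite K" "subsp V" "\<And>k. k \<in> K \<Longrightarrow> lin_on V (f k)" "lin_on V g"
    and "\<And>v. v \<in> V \<Longrightarrow> (\<And>k. k \<in> K \<Longrightarrow> f k v = 0) \<Longrightarrow> g v = 0"
  shows "\<exists>l. \<forall>v\<in>V. g v = (\<Sum>k\<in>K. l k * f k v)"
  using assms
proof (induction K arbitrary: g rule: finite_induct)
  case empty
  then show ?case by simp
next
  case (insert k K)
  show ?case
  proof (cases "\<forall>v\<in>V. (\<forall>j\<in>K. f j v = 0) \<longrightarrow> f k v = 0")
    case True
    then have "\<exists>l. \<forall>v\<in>V. g v = (\<Sum>k\<in>K. l k * f k v)"
      using insert.prems by (intro insert.IH) auto
    then obtain l where l: "\<And>v. v \<in> V \<Longrightarrow> g v = (\<Sum>k\<in>K. l k * f k v)" by blast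
    have "(\<Sum>j\<in>insert k K. (l(k := 0)) j * f j v) = (\<Sum>j\<in>K. l j * f j v)" for v
      using insert.hyps by (simp, intro sum.cong) auto
    then show ?thesis using l by (intro exI[of _ "l(k := 0)"]) simp
  next
    case False
    then obtain v0 where v0: "v0 \<in> V" "\<And>j. j \<in> K \<Longrightarrow> f j v0 = 0" "f k v0 \<noteq> 0" by blast
    define c where "c = g v0 / f k v0"
    have "lin_on V (\<lambda>v. g v - c * f k v)"
      using insert.prems(2)[of k] insert.prems(3) by (auto simp: lin_on_def algebra_simps)
    moreover have "g v - c * f k v = 0" if "v \<in> V" "\<And>j. j \<in> K \<Longrightarrow> f j v = 0" for v
    proof -
      let ?w = "\<lambda>i. v i + (- (f k v / f k v0)) * v0 i"
      have w: "?w \<in> V" by (rule subspD[OF insert.prems(1) that(1) v0(1)])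
      have fw: "h ?w = h v + (- (f k v / f k v0)) * h v0" if "lin_on V h" for h
        by (rule lin_onD[OF that \<open>v \<in> V\<close> v0(1)])
      have "f j ?w = 0" if "j \<in> insert k K" for j
        using fw[OF insert.prems(2)[OF that]] that v0 \<open>\<And>j. j \<in> K \<Longrightarrow> f j v = 0\<close> by auto
      then have "g ?w = 0" by (intro insert.prems(4) w)
      then show ?thesis using fw[OF insert.prems(3)] v0(3) by (simp add: c_def)
    qed
    ultimately have "\<exists>l. \<forall>v\<in>V. g v - c * f k v = (\<Sum>k\<in>K. l k * f k v)"
      using insert.prems by (intro insert.IH) auto
    then obtain l where l: "\<And>v. v \<in> V \<Longrightarrow> g v - c * f k v = (\<Sum>k\<in>K. l k * f k v)" by blast
    have "(\<Sum>j\<in>insert k K. (l(k := c)) j * f j v) = c * f k v + (\<Sum>j\<in>K. l j * f j v)" for v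
      using insert.hyps by (simp, intro sum.cong) auto
    then show ?thesis using l by (intro exI[of _ "l(k := c)"]) (simp add: algebra_simps flip: l)
  qed
qed

text \<open>Independence provides a dual vector for each functional: without one, f_k would vanish
  on the common kernel of the others and hence be a combination of them, a relation with coefficient
  -1 at k.\<close>

lemma independent_functionals_surj:
  assumes K: "finite K" and V: "subsp V" and lin: "\<And>k. k \<in> K \<Longrightarrow> lin_on V (f k)"
    and ind: "\<And>l. (\<And>v. v \<in> V \<Longrightarrow> (\<Sum>k\<in>K. l k * f k v) = 0) \<Longrightarrow> (\<And>k. k \<in> K \<Longrightarrow> l k = 0)"
  shows "\<exists>v\<in>V. \<forall>k\<in>K. f k v = b k"
proof -
  have dual: "\<exists>v\<in>V. f k v = 1 \<and> (\<forall>j\<in>K - {k}. f j v = 0)" if "k \<in> K" for k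
  proof (rule ccontr)
    assume no: "\<not> ?thesis"
    have "f k v = 0" if v: "v \<in> V" "\<And>j. j \<in> K - {k} \<Longrightarrow> f j v = 0" for v
    proof (rule ccontr)
      assume "f k v \<noteq> 0"
      let ?w = "\<lambda>i. inverse (f k v) * v i"
      have w: "?w \<in> V" by (rule subsp_scale[OF V v(1)])
      have fw: "f j ?w = inverse (f k v) * f j v" if "j \<in> K" for j
        by (rule lin_on_scale[OF lin[OF that] V v(1)])
      have "f k ?w = 1" using fw[OF \<open>k \<in> K\<close>] \<open>f k v \<noteq> 0\<close> by simp
      moreover have "\<forall>j\<in>K - {k}. f j ?w = 0" using fw v(2) by simp
      ultimately show False using no w by blast
    qed
    then have "\<exists>l. \<forall>v\<in>V. f k v = (\<Sum>j\<in>K - {k}. l j * f j v)"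
      using K V lin that by (intro lagrange_multipliers) auto
    then obtain l where l: "\<And>v. v \<in> V \<Longrightarrow> f k v = (\<Sum>j\<in>K - {k}. l j * f j v)" by blast
    have "(\<Sum>j\<in>K. (l(k := - 1)) j * f j v) = 0" if "v \<in> V" for v
    proof -
      have "(\<Sum>j\<in>K. (l(k := - 1)) j * f j v) = - f k v + (\<Sum>j\<in>K - {k}. (l(k := - 1)) j * f j v)"
        using K \<open>k \<in> K\<close> by (simp add: sum.remove)
      also have "(\<Sum>j\<in>K - {k}. (l(k := - 1)) j * f j v) = (\<Sum>j\<in>K - {k}. l j * f j v)"
        by (intro sum.cong) auto
      finally show ?thesis using l[OF that] by simp
    qed
    from ind[OF this \<open>k \<in> K\<close>] show False by simp
  qed
  have "\<exists>v\<in>V. (\<forall>k\<in>F. f k v = b k) \<and> (\<forall>k\<in>K - F. f k v = 0)" if "finite F" "F \<subseteq> K" for F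
    using that
  proof (induction F rule: finite_induct)
    case empty
    have "f j (\<lambda>_. 0) = 0" if "j \<in> K" for j
      by (rule lin_on_0[OF lin[OF that] V])
    then show ?case using subsp_0[OF V] by auto
  next
    case (insert k F)
    then obtain v where v: "v \<in> V" "\<forall>k\<in>F. f k v = b k" "\<forall>k\<in>K - F. f k v = 0" by auto
    obtain w where w: "w \<in> V" "f k w = 1" "\<forall>j\<in>K - {k}. f j w = 0" using dual insert.prems by blast
    let ?x = "\<lambda>i. v i + b k * w i"
    have x: "?x \<in> V" by (rule subspD[OF V v(1) w(1)])
    have fx: "f j ?x = f j v + b k * f j w" if "j \<in> K" for j
      by (rule lin_onD[OF lin[OF that] v(1) w(1)])
    have "f j ?x = b j" if "j \<in> insert k F" for j
      using that insert.prems insert.hyps v w fx[of j] by (cases "j = k") auto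
    moreover have "f j ?x = 0" if "j \<in> K - insert k F" for j
      using that v w fx[of j] by auto
    ultimately show ?case using x by blast
  qed
  from this[OF K order_refl] show ?thesis by auto
qed

section \<open>Regular functions and their differentials\<close>

lemma regular_uminus: "f \<in> regular V \<Longrightarrow> (\<lambda>x. - f x) \<in> regular V"
  using regular.mult[OF regular.const[of "-1"], of f V] by simp

lemma regular_diff: "f \<in> regular V \<Longrightarrow> g \<in> regular V \<Longrightarrow> (\<lambda>x. f x - g x) \<in> regular V"
  using regular.add[OF _ regular_uminus, of f V g] by simp

lemma regular_sum: "(\<And>s. s \<in> S \<Longrightarrow> f s \<in> regular V) \<Longrightarrow> (\<lambda>x. \<Sum>s\<in>S. f s x) \<in> regular V"
  by (induction S rule: infinite_finite_induct) (auto intro: regular.intros)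

lemma regular_prod: "(\<And>s. s \<in> S \<Longrightarrow> f s \<in> regular V) \<Longrightarrow> (\<lambda>x. \<Prod>s\<in>S. f s x) \<in> regular V"
  by (induction S rule: infinite_finite_induct) (auto intro: regular.intros)

lemma regular_compose:
  assumes "f \<in> regular V" "invs V = {}" "\<And>i. i \<in> idx V \<Longrightarrow> (\<lambda>x. g x i) \<in> regular W"
  shows "(\<lambda>x. f (g x)) \<in> regular W"
  using assms(1) by induction (use assms in \<open>auto intro: regular.intros\<close>)

text \<open>\<open>dderiv\<close> is defined through \<open>deriv\<close>, so existence of the
  derivative has to be secured before any calculus with it.\<close>

lemma regular_line:
  assumes "f \<in> regular V" "\<And>j. j \<in> invs V \<Longrightarrow> x j \<noteq> 0"
  shows "((\<lambda>s. f (\<lambda>i. x i + s * v i)) has_field_derivative dderiv f x v) (at 0)"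
proof -
  have "\<exists>d. ((\<lambda>s. f (\<lambda>i. x i + s * v i)) has_field_derivative d) (at 0)"
    using assms(1)
  proof induction
    case (const c)
    show ?case by (auto intro: exI[of _ 0])
  next
    case (coord i)
    show ?case by (auto intro: line_deriv)
  next
    case (inv_coord j)
    show ?case
      by (rule exI, rule DERIV_inverse'[OF line_deriv]) (use assms(2)[OF inv_coord] in simp)
  next
    case (add f g)
    then obtain d e where "((\<lambda>s. f (\<lambda>i. x i + s * v i)) has_field_derivative d) (at 0)"
      "((\<lambda>s. g (\<lambda>i. x i + s * v i)) has_field_derivative e) (at 0)" by blast
    from DERIV_add[OF this] show ?case by blast
  next
    case (mult f g)
    then obtain d e where "((\<lambda>s. f (\<lambda>i. x i + s * v i)) has_field_derivative d) (at 0)"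
      "((\<lambda>s. g (\<lambda>i. x i + s * v i)) has_field_derivative e) (at 0)" by blast
    from DERIV_mult[OF this] show ?case by blast
  qed
  then show ?thesis by (metis dderivI)
qed

lemma dderiv_const [simp]: "dderiv (\<lambda>_. c) x v = 0"
  by (rule dderivI) simp

lemma dderiv_coord [simp]: "dderiv (\<lambda>x. x i) x v = v i"
  by (rule dderivI) (rule line_deriv)

lemma dderiv_add:
  assumes "f \<in> regular V" "g \<in> regular V" "\<And>j. j \<in> invs V \<Longrightarrow> x j \<noteq> 0"
  shows "dderiv (\<lambda>x. f x + g x) x v = dderiv f x v + dderiv g x v"
  by (rule dderivI, rule DERIV_add) (rule regular_line[OF _ assms(3)], use assms in auto)+

lemma dderiv_mult:
  assumes "f \<in> regular V" "g \<in> regular V" "\<And>j. j \<in> invs V \<Longrightarrow> x j \<noteq> 0"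
  shows "dderiv (\<lambda>x. f x * g x) x v = dderiv f x v * g x + dderiv g x v * f x"
proof (rule dderivI)
  have "((\<lambda>s. f (\<lambda>i. x i + s * v i) * g (\<lambda>i. x i + s * v i)) has_field_derivative
      dderiv f x v * g (\<lambda>i. x i + 0 * v i) + dderiv g x v * f (\<lambda>i. x i + 0 * v i)) (at 0)"
    by (rule DERIV_mult) (rule regular_line[OF _ assms(3)], use assms in auto)+
  then show "((\<lambda>s. f (\<lambda>i. x i + s * v i) * g (\<lambda>i. x i + s * v i)) has_field_derivative
      dderiv f x v * g x + dderiv g x v * f x) (at 0)" by simp
qed

lemma dderiv_inverse:
  assumes "x j \<noteq> 0"
  shows "dderiv (\<lambda>x. inverse (x j)) x v = - (inverse (x j) * v j * inverse (x j))"
  using DERIV_inverse'[OF line_deriv[of "x j" "v j"]] assms by (intro dderivI) simp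

text \<open>The last clause is the symmetry of the second derivatives.\<close>

definition partials :: "'i aff_scheme \<Rightarrow> (('i \<Rightarrow> complex) \<Rightarrow> complex) \<Rightarrow> ('i \<Rightarrow> ('i \<Rightarrow> complex) \<Rightarrow> complex) \<Rightarrow> bool" where
  "partials V f D \<longleftrightarrow> (\<forall>i\<in>idx V. D i \<in> regular V) \<and>
    (\<forall>\<gamma> \<gamma>'. (\<forall>i\<in>idx V. ((\<lambda>s. \<gamma> s i) has_field_derivative \<gamma>' i) (at (0::complex))) \<longrightarrow>
       (\<forall>j\<in>invs V. \<gamma> 0 j \<noteq> 0) \<longrightarrow>
       ((\<lambda>s. f (\<gamma> s)) has_field_derivative (\<Sum>i\<in>idx V. D i (\<gamma> 0) * \<gamma>' i)) (at 0)) \<and>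
    (\<forall>x u v. (\<forall>j\<in>invs V. x j \<noteq> 0) \<longrightarrow>
       (\<Sum>i\<in>idx V. dderiv (D i) x u * v i) = (\<Sum>i\<in>idx V. dderiv (D i) x v * u i))"

lemma partialsD:
  assumes "partials V f D"
  shows "i \<in> idx V \<Longrightarrow> D i \<in> regular V"
    and "\<lbrakk>\<And>i. i \<in> idx V \<Longrightarrow> ((\<lambda>s. \<gamma> s i) has_field_derivative \<gamma>' i) (at 0);
        \<And>j. j \<in> invs V \<Longrightarrow> \<gamma> 0 j \<noteq> 0\<rbrakk>
      \<Longrightarrow> ((\<lambda>s. f (\<gamma> s)) has_field_derivative (\<Sum>i\<in>idx V. D i (\<gamma> 0) * \<gamma>' i)) (at 0)"
    and "(\<And>j. j \<in> invs V \<Longrightarrow> x j \<noteq> 0) \<Longrightarrow>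
       (\<Sum>i\<in>idx V. dderiv (D i) x u * v i) = (\<Sum>i\<in>idx V. dderiv (D i) x v * u i)"
  using assms unfolding partials_def by blast+

lemma dderiv_eq_partials:
  assumes "partials V f D" "\<And>j. j \<in> invs V \<Longrightarrow> x j \<noteq> 0"
  shows "dderiv f x v = (\<Sum>i\<in>idx V. D i x * v i)"
  using partialsD(2)[OF assms(1), where \<gamma>="\<lambda>s i. x i + s * v i" and \<gamma>'=v] assms(2)
  by (intro dderivI) (simp add: line_deriv)

text \<open>Induction on the construction of f. The chain rule is stated for all curves, so that it
  survives composition with the section and the quotient map.\<close>

lemma regular_partials:
  assumes "f \<in> regular V" "finite (idx V)" "invs V \<subseteq> idx V"
  shows "\<exists>D. partials V f D"
  using assms(1)
proof induction
  case (const c)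
  show ?case by (rule exI[of _ "\<lambda>_ _. 0"]) (auto simp: partials_def intro: regular.const)
next
  case (coord i)
  then show ?case using assms(2)
    by (intro exI[of _ "\<lambda>k _. if k = i then 1 else 0"])
      (auto simp: partials_def regular.const if_distrib[of "\<lambda>x. x * _"] sum.delta cong: if_cong)
next
  case (inv_coord j)
  then have j: "j \<in> idx V" using assms(3) by auto
  let ?D = "\<lambda>k x. if k = j then - (inverse (x j) * inverse (x j)) else (0 :: complex)"
  have "(\<lambda>x. - (inverse (x j) * inverse (x j))) \<in> regular V"
    by (intro regular_uminus regular.mult regular.inv_coord inv_coord)
  then have reg: "?D k \<in> regular V" for k by (cases "k = j") (simp_all add: regular.const)
  have "partials V (\<lambda>x. inverse (x j)) ?D"
    unfolding partials_def
  proof (intro conjI ballI allI impI)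
    fix k show "?D k \<in> regular V" by (rule reg)
  next
    fix \<gamma> :: "complex \<Rightarrow> 'a \<Rightarrow> complex" and \<gamma>'
    assume "\<forall>i\<in>idx V. ((\<lambda>s. \<gamma> s i) has_field_derivative \<gamma>' i) (at 0)" "\<forall>j\<in>invs V. \<gamma> 0 j \<noteq> 0"
    then have "((\<lambda>s. inverse (\<gamma> s j)) has_field_derivative
        - (inverse (\<gamma> 0 j) * \<gamma>' j * inverse (\<gamma> 0 j))) (at 0)"
      using inv_coord j by (intro DERIV_inverse') auto
    also have "- (inverse (\<gamma> 0 j) * \<gamma>' j * inverse (\<gamma> 0 j)) = (\<Sum>i\<in>idx V. ?D i (\<gamma> 0) * \<gamma>' i)"
      using j assms(2) by (simp add: if_distrib[of "\<lambda>x. x * _"] sum.delta cong: if_cong)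
    finally show "((\<lambda>s. inverse (\<gamma> s j)) has_field_derivative (\<Sum>i\<in>idx V. ?D i (\<gamma> 0) * \<gamma>' i)) (at 0)" .
  next
    fix x u v :: "'a \<Rightarrow> complex"
    assume nz: "\<forall>j\<in>invs V. x j \<noteq> 0"
    have inv: "(\<lambda>x. inverse (x j)) \<in> regular V" using inv_coord by (rule regular.inv_coord)
    have minv: "dderiv (\<lambda>x. - inverse (x j)) x u = inverse (x j) * u j * inverse (x j)" for u
    proof -
      have "((\<lambda>s. inverse (x j + s * u j)) has_field_derivative - (inverse (x j) * u j * inverse (x j))) (at 0)"
        using DERIV_inverse'[OF line_deriv[of "x j" "u j"]] inv_coord nz by simp
      from DERIV_minus[OF this] show ?thesis by (intro dderivI) simp
    qed
    have "dderiv (?D j) x u = 2 * inverse (x j) * inverse (x j) * inverse (x j) * u j" for u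
      using dderiv_mult[OF regular_uminus[OF inv] inv, of x u] nz inv_coord
      by (simp add: dderiv_inverse minv)
    moreover have "(\<Sum>i\<in>idx V. dderiv (?D i) x u * v i) = dderiv (?D j) x u * v j" for u v
    proof -
      have "(\<Sum>i\<in>idx V. dderiv (?D i) x u * v i) = (\<Sum>i\<in>{j}. dderiv (?D i) x u * v i)"
        by (rule sum.mono_neutral_right) (use j assms(2) in auto)
      then show ?thesis by simp
    qed
    ultimately show "(\<Sum>i\<in>idx V. dderiv (?D i) x u * v i) = (\<Sum>i\<in>idx V. dderiv (?D i) x v * u i)"
      by simp
  qed
  then show ?case by blast
next
  case (add f g)
  then obtain D E where DE: "partials V f D" "partials V g E" by blast
  have "partials V (\<lambda>x. f x + g x) (\<lambda>i x. D i x + E i x)"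
    unfolding partials_def
  proof (intro conjI ballI allI impI)
    fix i assume "i \<in> idx V"
    then show "(\<lambda>x. D i x + E i x) \<in> regular V"
      by (intro regular.add partialsD(1)[OF DE(1)] partialsD(1)[OF DE(2)])
  next
    fix \<gamma> :: "complex \<Rightarrow> 'a \<Rightarrow> complex" and \<gamma>'
    assume "\<forall>i\<in>idx V. ((\<lambda>s. \<gamma> s i) has_field_derivative \<gamma>' i) (at 0)" "\<forall>j\<in>invs V. \<gamma> 0 j \<noteq> 0"
    then show "((\<lambda>s. f (\<gamma> s) + g (\<gamma> s)) has_field_derivative
        (\<Sum>i\<in>idx V. (D i (\<gamma> 0) + E i (\<gamma> 0)) * \<gamma>' i)) (at 0)"
      unfolding distrib_right sum.distrib
      by (intro DERIV_add partialsD(2)[OF DE(1)] partialsD(2)[OF DE(2)]) auto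
  next
    fix x u v :: "'a \<Rightarrow> complex"
    assume nz: "\<forall>j\<in>invs V. x j \<noteq> 0"
    have "(\<Sum>i\<in>idx V. dderiv (\<lambda>x. D i x + E i x) x u * v i)
        = (\<Sum>i\<in>idx V. dderiv (D i) x u * v i) + (\<Sum>i\<in>idx V. dderiv (E i) x u * v i)" for u v
      unfolding sum.distrib[symmetric] distrib_right[symmetric]
      using nz by (intro sum.cong refl) (simp add: dderiv_add[OF partialsD(1)[OF DE(1)] partialsD(1)[OF DE(2)]])
    then show "(\<Sum>i\<in>idx V. dderiv (\<lambda>x. D i x + E i x) x u * v i)
        = (\<Sum>i\<in>idx V. dderiv (\<lambda>x. D i x + E i x) x v * u i)"
      using partialsD(3)[OF DE(1), of x u v] partialsD(3)[OF DE(2), of x u v] nz by simp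
  qed
  then show ?case by blast
next
  case (mult f g)
  then obtain D E where DE: "partials V f D" "partials V g E" by blast
  have "partials V (\<lambda>x. f x * g x) (\<lambda>i x. D i x * g x + f x * E i x)"
    unfolding partials_def
  proof (intro conjI ballI allI impI)
    fix i assume "i \<in> idx V"
    then show "(\<lambda>x. D i x * g x + f x * E i x) \<in> regular V"
      by (intro regular.add regular.mult mult.hyps partialsD(1)[OF DE(1)] partialsD(1)[OF DE(2)])
  next
    fix \<gamma> :: "complex \<Rightarrow> 'a \<Rightarrow> complex" and \<gamma>'
    assume a: "\<forall>i\<in>idx V. ((\<lambda>s. \<gamma> s i) has_field_derivative \<gamma>' i) (at 0)" "\<forall>j\<in>invs V. \<gamma> 0 j \<noteq> 0"
    have "((\<lambda>s. f (\<gamma> s) * g (\<gamma> s)) has_field_derivative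
        (\<Sum>i\<in>idx V. D i (\<gamma> 0) * \<gamma>' i) * g (\<gamma> 0) + (\<Sum>i\<in>idx V. E i (\<gamma> 0) * \<gamma>' i) * f (\<gamma> 0)) (at 0)"
      by (intro DERIV_mult partialsD(2)[OF DE(1)] partialsD(2)[OF DE(2)]) (use a in auto)
    also have "(\<Sum>i\<in>idx V. D i (\<gamma> 0) * \<gamma>' i) * g (\<gamma> 0) + (\<Sum>i\<in>idx V. E i (\<gamma> 0) * \<gamma>' i) * f (\<gamma> 0)
        = (\<Sum>i\<in>idx V. (D i (\<gamma> 0) * g (\<gamma> 0) + f (\<gamma> 0) * E i (\<gamma> 0)) * \<gamma>' i)"
      unfolding sum_distrib_right sum.distrib[symmetric] by (intro sum.cong) (auto simp: algebra_simps)
    finally show "((\<lambda>s. f (\<gamma> s) * g (\<gamma> s)) has_field_derivative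
        (\<Sum>i\<in>idx V. (D i (\<gamma> 0) * g (\<gamma> 0) + f (\<gamma> 0) * E i (\<gamma> 0)) * \<gamma>' i)) (at 0)" .
  next
    fix x u v :: "'a \<Rightarrow> complex"
    assume nz: "\<forall>j\<in>invs V. x j \<noteq> 0"
    \<comment> \<open>Besides the Hessians of the factors, the Hessian of a product has the cross
      terms dg(u) df(v) + df(u) dg(v), which are symmetric together.\<close>
    have "(\<Sum>i\<in>idx V. dderiv (\<lambda>x. D i x * g x + f x * E i x) x u * v i)
        = g x * (\<Sum>i\<in>idx V. dderiv (D i) x u * v i) + f x * (\<Sum>i\<in>idx V. dderiv (E i) x u * v i)
          + dderiv g x u * dderiv f x v + dderiv f x u * dderiv g x v" for u v
    proof -
      have "dderiv (\<lambda>x. D i x * g x + f x * E i x) x u * v i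
          = g x * (dderiv (D i) x u * v i) + f x * (dderiv (E i) x u * v i)
            + dderiv g x u * (D i x * v i) + dderiv f x u * (E i x * v i)" if "i \<in> idx V" for i
      proof -
        note r = partialsD(1)[OF DE(1) that] partialsD(1)[OF DE(2) that]
        have "dderiv (\<lambda>x. D i x * g x + f x * E i x) x u
            = dderiv (\<lambda>x. D i x * g x) x u + dderiv (\<lambda>x. f x * E i x) x u"
          by (rule dderiv_add[where V=V]) (use nz r mult.hyps in \<open>auto intro: regular.mult\<close>)
        also have "dderiv (\<lambda>x. D i x * g x) x u = dderiv (D i) x u * g x + dderiv g x u * D i x"
          by (rule dderiv_mult[where V=V]) (use nz r mult.hyps in auto)
        also have "dderiv (\<lambda>x. f x * E i x) x u = dderiv f x u * E i x + dderiv (E i) x u * f x"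
          by (rule dderiv_mult[where V=V]) (use nz r mult.hyps in auto)
        finally show ?thesis by (simp add: algebra_simps)
      qed
      then show ?thesis
        using nz by (simp add: sum.distrib sum_distrib_left dderiv_eq_partials[OF DE(1), of x v]
            dderiv_eq_partials[OF DE(2), of x v])
    qed
    then show "(\<Sum>i\<in>idx V. dderiv (\<lambda>x. D i x * g x + f x * E i x) x u * v i)
        = (\<Sum>i\<in>idx V. dderiv (\<lambda>x. D i x * g x + f x * E i x) x v * u i)"
      using partialsD(3)[OF DE(1), of x u v] partialsD(3)[OF DE(2), of x u v] nz by simp
  qed
  then show ?case by blast
qed

lemma regular_chain:
  assumes "f \<in> regular V" "finite (idx V)" "invs V \<subseteq> idx V"
    and "\<And>i. i \<in> idx V \<Longrightarrow> ((\<lambda>s. \<gamma> s i) has_field_derivative \<gamma>' i) (at 0)"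
    and "\<And>j. j \<in> invs V \<Longrightarrow> \<gamma> 0 j \<noteq> 0"
  shows "((\<lambda>s. f (\<gamma> s)) has_field_derivative dderiv f (\<gamma> 0) \<gamma>') (at 0)"
proof -
  obtain D where D: "partials V f D" using regular_partials assms(1-3) by blast
  show ?thesis
    using partialsD(2)[OF D assms(4,5)] dderiv_eq_partials[OF D assms(5), where v=\<gamma>'] by simp
qed

lemma dderiv_compose:
  assumes f: "f \<in> regular V" "finite (idx V)" "invs V = {}"
    and g: "\<And>i. i \<in> idx V \<Longrightarrow> (\<lambda>x. g x i) \<in> regular W" "\<And>j. j \<in> invs W \<Longrightarrow> x j \<noteq> 0"
  shows "dderiv (\<lambda>x. f (g x)) x v = dderiv f (g x) (dmap g x v)"
proof -
  have "((\<lambda>s. f (g (\<lambda>i. x i + s * v i))) has_field_derivative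
      dderiv f (g (\<lambda>i. x i + 0 * v i)) (dmap g x v)) (at 0)"
    by (rule regular_chain[where V=V and \<gamma>="\<lambda>s. g (\<lambda>i. x i + s * v i)"])
      (use f regular_line[OF g(1) g(2)] in \<open>auto simp: dmap_def\<close>)
  then show ?thesis by (intro dderivI) simp
qed

subsection \<open>Forms as sums of \<open>f dg \<and> dh\<close>\<close>

definition wedge2 :: "(('i \<Rightarrow> complex) \<Rightarrow> complex) \<Rightarrow> (('i \<Rightarrow> complex) \<Rightarrow> complex) \<Rightarrow>
    (('i \<Rightarrow> complex) \<Rightarrow> complex) \<Rightarrow> 'i two_form" where
  "wedge2 f g h x u v = f x * (dderiv g x u * dderiv h x v - dderiv g x v * dderiv h x u)"

definition wedge3 :: "(('i \<Rightarrow> complex) \<Rightarrow> complex) \<Rightarrow> (('i \<Rightarrow> complex) \<Rightarrow> complex) \<Rightarrow>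
    (('i \<Rightarrow> complex) \<Rightarrow> complex) \<Rightarrow> ('i \<Rightarrow> complex) \<Rightarrow> ('i \<Rightarrow> complex) \<Rightarrow> ('i \<Rightarrow> complex) \<Rightarrow>
    ('i \<Rightarrow> complex) \<Rightarrow> complex" where
  "wedge3 f g h x u v w =
          dderiv f x u * (dderiv g x v * dderiv h x w - dderiv g x w * dderiv h x v)
        + dderiv f x v * (dderiv g x w * dderiv h x u - dderiv g x u * dderiv h x w)
        + dderiv f x w * (dderiv g x u * dderiv h x v - dderiv g x v * dderiv h x u)"

text \<open>Agreement is demanded on the whole ambient space where the inverted coordinates are
  nonzero, not just on the variety, so that exterior derivatives can be taken first and restricted
  afterwards.\<close>

definition represents where
  "represents V c \<Phi> \<Psi> \<longleftrightarrow> (\<forall>i\<in>idx V. \<forall>j\<in>idx V. c i j \<in> regular V) \<and>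
    (\<forall>x u v w. (\<forall>j\<in>invs V. x j \<noteq> 0) \<longrightarrow>
      coeff_form (idx V) c x u v = \<Phi> x u v \<and> d_coeff_form (idx V) c x u v w = \<Psi> x u v w)"

text \<open>d(f dg \<and> dh) = df \<and> dg \<and> dh, with coefficients f times products of
  partial derivatives of g and h; the terms with second derivatives cancel.\<close>

lemma represents_wedge:
  assumes fin: "finite (idx V)" "invs V \<subseteq> idx V"
    and f: "f \<in> regular V" and g: "g \<in> regular V" and h: "h \<in> regular V"
  shows "\<exists>c. represents V c (wedge2 f g h) (wedge3 f g h)"
proof -
  obtain D where D: "partials V g D" using regular_partials g fin by blast
  obtain E where E: "partials V h E" using regular_partials h fin by blast
  let ?c = "\<lambda>i j x. f x * (D i x * E j x)"
  have reg: "?c i j \<in> regular V" if "i \<in> idx V" "j \<in> idx V" for i j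
    by (intro regular.mult f partialsD(1)[OF D] partialsD(1)[OF E] that)
  have "coeff_form (idx V) ?c x u v = f x * (dderiv g x u * dderiv h x v - dderiv g x v * dderiv h x u) \<and>
      d_coeff_form (idx V) ?c x u v w =
          dderiv f x u * (dderiv g x v * dderiv h x w - dderiv g x w * dderiv h x v)
        + dderiv f x v * (dderiv g x w * dderiv h x u - dderiv g x u * dderiv h x w)
        + dderiv f x w * (dderiv g x u * dderiv h x v - dderiv g x v * dderiv h x u)"
    if nz: "\<And>j. j \<in> invs V \<Longrightarrow> x j \<noteq> 0" for x u v w
  proof
    have dg: "dderiv g x v = (\<Sum>i\<in>idx V. D i x * v i)" for v
      by (rule dderiv_eq_partials[OF D nz])
    have dh: "dderiv h x v = (\<Sum>i\<in>idx V. E i x * v i)" for v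
      by (rule dderiv_eq_partials[OF E nz])
    have prod: "(\<Sum>i\<in>idx V. \<Sum>j\<in>idx V. a * (p i * q j)) = a * ((\<Sum>i\<in>idx V. p i) * (\<Sum>j\<in>idx V. q j))"
      for a :: complex and p q
      unfolding sum_product by (simp only: sum_distrib_left)
    show "coeff_form (idx V) ?c x u v = f x * (dderiv g x u * dderiv h x v - dderiv g x v * dderiv h x u)"
    proof -
      have "coeff_form (idx V) ?c x u v = (\<Sum>i\<in>idx V. \<Sum>j\<in>idx V. f x * ((D i x * u i) * (E j x * v j)))
          - (\<Sum>i\<in>idx V. \<Sum>j\<in>idx V. f x * ((D i x * v i) * (E j x * u j)))"
        unfolding coeff_form_def sum_subtractf[symmetric] by (intro sum.cong refl) (simp add: algebra_simps)
      then show ?thesis unfolding prod by (simp add: dg dh algebra_simps)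
    qed
    \<comment> \<open>The Hessians of g and h; their symmetry makes the cyclic sum over u, v, w
      collapse.\<close>
    define G where "G u v = (\<Sum>i\<in>idx V. dderiv (D i) x u * v i)" for u v
    define H where "H u v = (\<Sum>i\<in>idx V. dderiv (E i) x u * v i)" for u v
    have G: "G u v = G v u" for u v unfolding G_def by (rule partialsD(3)[OF D nz])
    have H: "H u v = H v u" for u v unfolding H_def by (rule partialsD(3)[OF E nz])
    have part: "(\<Sum>i\<in>idx V. \<Sum>j\<in>idx V. dderiv (?c i j) x u * (v i * w j - w i * v j))
        = dderiv f x u * (dderiv g x v * dderiv h x w - dderiv g x w * dderiv h x v)
          + f x * (G u v * dderiv h x w - G u w * dderiv h x v)
          + f x * (dderiv g x v * H u w - dderiv g x w * H u v)" for u v w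
    proof -
      have dc: "dderiv (?c i j) x u = dderiv f x u * (D i x * E j x)
          + f x * (dderiv (D i) x u * E j x) + f x * (D i x * dderiv (E j) x u)"
        if "i \<in> idx V" "j \<in> idx V" for i j
      proof -
        note r = partialsD(1)[OF D that(1)] partialsD(1)[OF E that(2)]
        have "dderiv (\<lambda>x. D i x * E j x) x u = dderiv (D i) x u * E j x + dderiv (E j) x u * D i x"
          by (rule dderiv_mult[OF r nz])
        moreover have "dderiv (?c i j) x u
            = dderiv f x u * (D i x * E j x) + dderiv (\<lambda>x. D i x * E j x) x u * f x"
          by (rule dderiv_mult[OF f regular.mult[OF r] nz])
        ultimately show ?thesis by (simp add: algebra_simps)
      qed
      have "(\<Sum>i\<in>idx V. \<Sum>j\<in>idx V. dderiv (?c i j) x u * (v i * w j - w i * v j))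
          = (\<Sum>i\<in>idx V. \<Sum>j\<in>idx V. dderiv f x u * ((D i x * v i) * (E j x * w j)))
          - (\<Sum>i\<in>idx V. \<Sum>j\<in>idx V. dderiv f x u * ((D i x * w i) * (E j x * v j)))
          + (\<Sum>i\<in>idx V. \<Sum>j\<in>idx V. f x * ((dderiv (D i) x u * v i) * (E j x * w j)))
          - (\<Sum>i\<in>idx V. \<Sum>j\<in>idx V. f x * ((dderiv (D i) x u * w i) * (E j x * v j)))
          + (\<Sum>i\<in>idx V. \<Sum>j\<in>idx V. f x * ((D i x * v i) * (dderiv (E j) x u * w j)))
          - (\<Sum>i\<in>idx V. \<Sum>j\<in>idx V. f x * ((D i x * w i) * (dderiv (E j) x u * v j)))"
        unfolding sum_subtractf[symmetric] sum.distrib[symmetric]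
        by (intro sum.cong refl) (simp add: dc algebra_simps)
      then show ?thesis unfolding prod G_def H_def by (simp add: dg dh algebra_simps)
    qed
    show "d_coeff_form (idx V) ?c x u v w =
          dderiv f x u * (dderiv g x v * dderiv h x w - dderiv g x w * dderiv h x v)
        + dderiv f x v * (dderiv g x w * dderiv h x u - dderiv g x u * dderiv h x w)
        + dderiv f x w * (dderiv g x u * dderiv h x v - dderiv g x v * dderiv h x u)"
    proof -
      have "d_coeff_form (idx V) ?c x u v w =
          (\<Sum>i\<in>idx V. \<Sum>j\<in>idx V. dderiv (?c i j) x u * (v i * w j - w i * v j))
        + (\<Sum>i\<in>idx V. \<Sum>j\<in>idx V. dderiv (?c i j) x v * (w i * u j - u i * w j))
        + (\<Sum>i\<in>idx V. \<Sum>j\<in>idx V. dderiv (?c i j) x w * (u i * v j - v i * u j))"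
        unfolding d_coeff_form_def by (simp add: sum.distrib)
      then show ?thesis
        unfolding part using G[of u v] G[of u w] G[of v w] H[of u v] H[of u w] H[of v w]
        by (simp add: algebra_simps)
    qed
  qed
  with reg show ?thesis
    by (intro exI[of _ ?c]) (simp add: represents_def wedge2_def wedge3_def)
qed

lemma represents_zero: "represents V (\<lambda>_ _ _. 0) (\<lambda>_ _ _. 0) (\<lambda>_ _ _ _. 0)"
  by (auto simp: represents_def coeff_form_def d_coeff_form_def intro: regular.const)

lemma represents_add:
  fixes V :: "'a aff_scheme"
  assumes "represents V c \<Phi> \<Psi>" "represents V c' \<Phi>' \<Psi>'"
  shows "represents V (\<lambda>i j x. c i j x + c' i j x)
    (\<lambda>x u v. \<Phi> x u v + \<Phi>' x u v) (\<lambda>x u v w. \<Psi> x u v w + \<Psi>' x u v w)"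
  unfolding represents_def
proof (intro conjI ballI allI impI)
  fix i j assume "i \<in> idx V" "j \<in> idx V"
  then show "(\<lambda>x. c i j x + c' i j x) \<in> regular V"
    using assms by (auto simp: represents_def intro: regular.add)
next
  fix x u v w :: "'a \<Rightarrow> complex"
  assume x: "\<forall>j\<in>invs V. x j \<noteq> 0"
  let ?c = "\<lambda>i j x. c i j x + c' i j x"
  have "coeff_form (idx V) ?c x u v = coeff_form (idx V) c x u v + coeff_form (idx V) c' x u v"
    unfolding coeff_form_def sum.distrib[symmetric] by (intro sum.cong refl) (simp add: algebra_simps)
  then show "coeff_form (idx V) ?c x u v = \<Phi> x u v + \<Phi>' x u v"
    using assms x by (simp add: represents_def)
  have "d_coeff_form (idx V) ?c x u v w = d_coeff_form (idx V) c x u v w + d_coeff_form (idx V) c' x u v w"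
    unfolding d_coeff_form_def sum.distrib[symmetric]
  proof (intro sum.cong refl)
    fix i j assume ij: "i \<in> idx V" "j \<in> idx V"
    have "dderiv (?c i j) x u = dderiv (c i j) x u + dderiv (c' i j) x u" for u
      using assms ij x by (intro dderiv_add[where V=V]) (auto simp: represents_def)
    then show "dderiv (?c i j) x u * (v i * w j - w i * v j) + dderiv (?c i j) x v * (w i * u j - u i * w j)
        + dderiv (?c i j) x w * (u i * v j - v i * u j)
      = dderiv (c i j) x u * (v i * w j - w i * v j) + dderiv (c i j) x v * (w i * u j - u i * w j)
        + dderiv (c i j) x w * (u i * v j - v i * u j)
        + (dderiv (c' i j) x u * (v i * w j - w i * v j) + dderiv (c' i j) x v * (w i * u j - u i * w j)
        + dderiv (c' i j) x w * (u i * v j - v i * u j))"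
      by (simp add: algebra_simps)
  qed
  then show "d_coeff_form (idx V) ?c x u v w = \<Psi> x u v w + \<Psi>' x u v w"
    using assms x by (simp add: represents_def)
qed

lemma represents_wedge_sum:
  assumes fin: "finite (idx V)" "invs V \<subseteq> idx V" and "finite S"
    and reg: "\<And>s. s \<in> S \<Longrightarrow> f s \<in> regular V \<and> g s \<in> regular V \<and> h s \<in> regular V"
  shows "\<exists>c. represents V c (\<lambda>x u v. \<Sum>s\<in>S. wedge2 (f s) (g s) (h s) x u v)
    (\<lambda>x u v w. \<Sum>s\<in>S. wedge3 (f s) (g s) (h s) x u v w)"
  using assms(3) reg
proof (induction S rule: finite_induct)
  case empty
  show ?case using represents_zero by (intro exI) simp
next
  case (insert s S)
  then obtain c where c: "represents V c (\<lambda>x u v. \<Sum>s\<in>S. wedge2 (f s) (g s) (h s) x u v)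
    (\<lambda>x u v w. \<Sum>s\<in>S. wedge3 (f s) (g s) (h s) x u v w)" by auto
  obtain c' where c': "represents V c' (wedge2 (f s) (g s) (h s)) (wedge3 (f s) (g s) (h s))"
    using represents_wedge[OF fin, of "f s" "g s" "h s"] insert.prems by auto
  show ?case
    using represents_add[OF c' c] insert.hyps by (intro exI) simp
qed

section \<open>The exterior derivative of the 2-form\<close>

lemma regular_wprod:
  assumes "\<And>k. k < j \<Longrightarrow> (\<lambda>x. g x k) \<in> regular V"
  shows "(\<lambda>x. ent (wprod \<eta> (g x) j) a b) \<in> regular V"
  using assms
proof (induction j arbitrary: a b)
  case 0
  show ?case by (simp add: regular.const)
next
  case (Suc j)
  then have "(\<lambda>x. ent (wprod \<eta> (g x) j) a b) \<in> regular V" for a b by simp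
  with Suc.prems[of j] show ?case
    by (cases "b = \<eta> ! j"; cases "b = \<eta> ! j + 1")
      (auto simp: ent_times_letter intro!: regular.add regular.mult)
qed

lemma regular_winv:
  assumes "\<And>k. k < j \<Longrightarrow> (\<lambda>x. g x k) \<in> regular V"
  shows "(\<lambda>x. ent (winv \<eta> (g x) j) a b) \<in> regular V"
  using assms
proof (induction j arbitrary: a b)
  case 0
  show ?case by (simp add: regular.const)
next
  case (Suc j)
  then have "(\<lambda>x. ent (winv \<eta> (g x) j) a b) \<in> regular V" for a b by simp
  with Suc.prems[of j] show ?case
    by (cases "a = \<eta> ! j"; cases "a = \<eta> ! j + 1")
      (auto simp: ent_letter_inv_times intro!: regular_diff regular.mult)
qed

lemma regular_wdiff:
  assumes "\<And>k. k < j \<Longrightarrow> (\<lambda>x. g x k) \<in> regular V"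
  shows "(\<lambda>x. ent (wdiff \<eta> (g x) v j) a b) \<in> regular V"
  using assms
proof (induction j arbitrary: a b)
  case 0
  show ?case by (simp add: regular.const)
next
  case (Suc j)
  then have "(\<lambda>x. ent (wdiff \<eta> (g x) v j) a b) \<in> regular V" for a b by simp
  moreover have "(\<lambda>x. ent (wprod \<eta> (g x) j) a b) \<in> regular V" for a b
    using Suc.prems by (intro regular_wprod) simp
  ultimately show ?case using Suc.prems[of j]
    by (cases "b = \<eta> ! j"; cases "b = \<eta> ! j + 1")
      (auto simp: ent_times_letter ent_times_elem intro!: regular.add regular.mult regular.const)
qed

lemma regular_wlog:
  assumes "braid_word n \<eta>" "j \<le> length \<eta>" "\<And>k. k < j \<Longrightarrow> (\<lambda>x. g x k) \<in> regular V"
  shows "(\<lambda>x. ent (wlog \<eta> (g x) v j) a b) \<in> regular V"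
  unfolding wlog_def ent_times_zer'[OF zero_block_wdiff[OF assms(1,2)]]
  by (intro regular_sum regular.mult regular_winv regular_wdiff assms(3))

text \<open>The source of the Maurer-Cartan equation: the second-derivative term is symmetric in u
  and v, so the exterior derivative of Y^-1 dY retains only the product.\<close>

lemma mderiv_wlog:
  assumes "braid_word n \<eta>" "j \<le> length \<eta>"
  shows "mderiv (\<lambda>s. wlog \<eta> (\<lambda>k. z k + s * u k) v j)
    (winv \<eta> z j * wdiff2 \<eta> z u v j - wlog \<eta> z u j * wlog \<eta> z v j)"
proof -
  have "mderiv (\<lambda>s. winv \<eta> (\<lambda>k. z k + s * u k) j * wdiff \<eta> (\<lambda>k. z k + s * u k) v j)
      (- (winv \<eta> z j * wdiff \<eta> z u j * winv \<eta> z j) * wdiff \<eta> (\<lambda>k. z k + 0 * u k) v j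
        + winv \<eta> (\<lambda>k. z k + 0 * u k) j * wdiff2 \<eta> z u v j)"
    by (rule mderiv_times[OF mderiv_winv_line mderiv_wdiff unit_block_rows[OF unit_block_winv[OF assms]]])
  then show ?thesis by (simp add: wlog_def mult.assoc)
qed

abbreviation (input) coord_vec :: "nat \<Rightarrow> nat \<Rightarrow> complex" where
  "coord_vec k \<equiv> (\<lambda>i. if i = k then 1 else 0)"

lemma wdiff_units: "wdiff \<eta> z v j = (\<Sum>k<j. diagonal (\<lambda>_. v k) * wdiff \<eta> z (coord_vec k) j)"
proof -
  have "wdiff \<eta> z v j = wdiff \<eta> z (\<lambda>i. \<Sum>k<j. v k * coord_vec k i) j"
    by (rule wdiff_cong) (simp add: if_distrib[of "\<lambda>x. _ * x"] sum.delta cong: if_cong)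
  also have "\<dots> = (\<Sum>k<j. wdiff \<eta> z (\<lambda>i. v k * coord_vec k i) j)"
    by (rule wdiff_sum) simp
  finally show ?thesis by (simp only: wdiff_scale)
qed

lemma ent_wlog_units: "ent (wlog \<eta> z v j) a b = (\<Sum>k<j. v k * ent (wlog \<eta> z (coord_vec k) j) a b)"
proof -
  have "winv \<eta> z j * (diagonal (\<lambda>_. c) * X) = diagonal (\<lambda>_. c) * (winv \<eta> z j * X)" for c X
    by (metis diagonal_const_commute mult.assoc)
  then have "wlog \<eta> z v j = (\<Sum>k<j. diagonal (\<lambda>_. v k) * wlog \<eta> z (coord_vec k) j)"
    unfolding wlog_def by (subst wdiff_units) (simp add: sum_distrib_left)
  then show ?thesis by (simp add: ent_diagonal_times)
qed

lemma wform_eq_coeff: "wform \<eta> z u v = (\<Sum>j<length \<eta>. \<Sum>k<j.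
    ent (wlog \<eta> z (coord_vec k) j) (\<eta> ! j) (\<eta> ! j + 1) * (u k * v j - v k * u j))"
  unfolding wform_def
proof (rule sum.cong[OF refl])
  fix j
  show "ent (wlog \<eta> z u j) (\<eta> ! j) (\<eta> ! j + 1) * v j - ent (wlog \<eta> z v j) (\<eta> ! j) (\<eta> ! j + 1) * u j
    = (\<Sum>k<j. ent (wlog \<eta> z (coord_vec k) j) (\<eta> ! j) (\<eta> ! j + 1) * (u k * v j - v k * u j))"
    unfolding ent_wlog_units[of \<eta> z u j] ent_wlog_units[of \<eta> z v j] sum_distrib_right sum_subtractf[symmetric]
    by (intro sum.cong refl) (simp add: algebra_simps)
qed

lemma tr_rotate: "zero_block n X \<Longrightarrow> tr n (X * Y * Z) = tr n (Y * Z * X)"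
  using tr_commute[of n X "Y * Z"] by (simp add: mult.assoc)

text \<open>tr (X [Y,Z]), the invariant expression behind the Cartan 3-form.\<close>

definition tr3 :: "nat \<Rightarrow> rmat \<Rightarrow> rmat \<Rightarrow> rmat \<Rightarrow> complex" where
  "tr3 n X Y Z = tr n (X * Y * Z) - tr n (X * Z * Y)"

text \<open>Each letter adds an increment E to dY Y^-1. Products of two such increments vanish, and
  so does tr (E R E) by cyclicity, so only terms with a single E survive; each reads off an entry of
  a commutator.\<close>

lemma tr3_wlogr:
  assumes "braid_word n \<eta>" "m \<le> length \<eta>"
  shows "tr3 n (wlogr \<eta> z u m) (wlogr \<eta> z v m) (wlogr \<eta> z w m) = (\<Sum>j<m.
      w j * ent (wlog \<eta> z u j * wlog \<eta> z v j - wlog \<eta> z v j * wlog \<eta> z u j) (\<eta> ! j) (\<eta> ! j + 1)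
    + u j * ent (wlog \<eta> z v j * wlog \<eta> z w j - wlog \<eta> z w j * wlog \<eta> z v j) (\<eta> ! j) (\<eta> ! j + 1)
    + v j * ent (wlog \<eta> z w j * wlog \<eta> z u j - wlog \<eta> z u j * wlog \<eta> z w j) (\<eta> ! j) (\<eta> ! j + 1))"
  using assms(2)
proof (induction m)
  case 0
  show ?case by (simp add: tr3_def tr_def)
next
  case (Suc m)
  let ?i = "\<eta> ! m"
  let ?E = "\<lambda>v. wprod \<eta> z m * elem (?i + 1) ?i (v m) * winv \<eta> z m"
  let ?R = "\<lambda>v. wlogr \<eta> z v m"
  have m: "m < length \<eta>" using Suc.prems by simp
  have i: "Suc ?i < n" using assms(1) m by (rule braid_word_nth)
  have EE: "?E u * ?E v = 0" for u v
  proof -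
    have "?E u * ?E v = wprod \<eta> z m * (elem (?i + 1) ?i (u m) * elem (?i + 1) ?i (v m)) * winv \<eta> z m"
      by (simp add: mult.assoc)
    also have "elem (?i + 1) ?i (u m) * elem (?i + 1) ?i (v m) = 0"
      by (rule rmat_eqI) (simp add: ent_elem_times ent_elem)
    finally show ?thesis by simp
  qed
  have zE: "zero_block n (?E u)" for u
    using i m by (intro zero_block_times_unit_block zero_block_unit_block_times unit_block_wprod unit_block_winv zero_block_elem assms(1)) auto
  have zR: "zero_block n (?R u)" for u using m by (intro zero_block_wlogr assms(1)) simp
  have RRE: "tr n (?R u * ?R v * ?E w) = w m * ent (wlog \<eta> z u m * wlog \<eta> z v m) ?i (?i + 1)" for u v w
    unfolding tr_conj_elem[OF assms(1) m]
    by (simp add: wlogr_def wlog_def mult.assoc)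
  have ERE: "tr n (?E u * ?R v * ?E w) = 0" for u v w
    unfolding tr_rotate[OF zE[of w], symmetric] EE by (simp add: tr_def)
  have step: "tr n ((?R u + ?E u) * (?R v + ?E v) * (?R w + ?E w)) = tr n (?R u * ?R v * ?R w)
      + w m * ent (wlog \<eta> z u m * wlog \<eta> z v m) ?i (?i + 1)
      + v m * ent (wlog \<eta> z w m * wlog \<eta> z u m) ?i (?i + 1)
      + u m * ent (wlog \<eta> z v m * wlog \<eta> z w m) ?i (?i + 1)" for u v w
  proof -
    have "(?R u + ?E u) * (?R v + ?E v) * (?R w + ?E w) = ?R u * ?R v * ?R w + ?R u * ?R v * ?E w
        + ?R u * ?E v * ?R w + ?E u * ?R v * ?R w + ?R u * (?E v * ?E w) + ?E u * ?R v * ?E w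
        + (?E u * ?E v) * ?R w + (?E u * ?E v) * ?E w"
      by (simp only: distrib_left distrib_right mult.assoc add.assoc add.commute add.left_commute)
    then have "tr n ((?R u + ?E u) * (?R v + ?E v) * (?R w + ?E w)) = tr n (?R u * ?R v * ?R w)
        + tr n (?R u * ?R v * ?E w) + tr n (?R u * ?E v * ?R w) + tr n (?E u * ?R v * ?R w)"
      by (simp only: EE mult_zero_left mult_zero_right add_0_right tr_add ERE)
    also have "tr n (?R u * ?E v * ?R w) = tr n (?R w * ?R u * ?E v)"
      by (rule tr_rotate[OF zR, symmetric])
    also have "tr n (?E u * ?R v * ?R w) = tr n (?R v * ?R w * ?E u)"
      by (rule tr_rotate[OF zE])
    finally show ?thesis unfolding RRE by (simp add: algebra_simps)
  qed
  show ?case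
    unfolding sum.lessThan_Suc Suc.IH[OF Suc_leD[OF Suc.prems], symmetric]
    unfolding tr3_def wlogr_Suc step by (simp add: algebra_simps)
qed

text \<open>The form is a sum of terms f dz_k \<and> dz_j with k < j, where f is an entry of
  \<open>wlog\<close>. Differentiating f by the Maurer-Cartan equation gives the sum of
  \<open>tr3_wlogr\<close> up to sign. The pullback along a regular map \<sigma> is treated
  directly, to be applied to the section.\<close>

lemma wform_pullback_represents:
  assumes eta: "braid_word n \<eta>" and W: "finite (idx W)" "invs W \<subseteq> idx W"
    and reg: "\<And>k. k < length \<eta> \<Longrightarrow> (\<lambda>x. \<sigma> x k) \<in> regular W"
  shows "\<exists>c. represents W c (\<lambda>x u v. wform \<eta> (\<sigma> x) (dmap \<sigma> x u) (dmap \<sigma> x v))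
    (\<lambda>x u v w. - tr3 n (wlogr \<eta> (\<sigma> x) (dmap \<sigma> x u) (length \<eta>))
      (wlogr \<eta> (\<sigma> x) (dmap \<sigma> x v) (length \<eta>)) (wlogr \<eta> (\<sigma> x) (dmap \<sigma> x w) (length \<eta>)))"
proof -
  define S where "S = (SIGMA j:{..<length \<eta>}. {..<j})"
  define V :: "nat aff_scheme" where "V = \<lparr>idx = {..<length \<eta>}, invs = {}, eqs = {}\<rparr>"
  define T where "T k j x = ent (wlog \<eta> x (coord_vec k) j) (\<eta> ! j) (\<eta> ! j + 1)" for k j x
  let ?f = "\<lambda>(j, k) x. T k j (\<sigma> x)" and ?g = "\<lambda>(j, k) x. \<sigma> x k" and ?h = "\<lambda>(j :: nat, k :: nat) x. \<sigma> x j"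
  have V: "finite (idx V)" "invs V = {}" "idx V = {..<length \<eta>}" by (auto simp: V_def)
  have regT: "T k j \<in> regular V" if "j < length \<eta>" for k j
    unfolding T_def using that by (intro regular_wlog[OF eta] regular.coord) (auto simp: V)
  have "finite S" by (simp add: S_def)
  have "?f s \<in> regular W \<and> ?g s \<in> regular W \<and> ?h s \<in> regular W" if "s \<in> S" for s
    using that by (auto simp: S_def V intro!: reg regular_compose[OF regT, where W=W])
  then have "\<exists>c. represents W c (\<lambda>x u v. \<Sum>s\<in>S. wedge2 (?f s) (?g s) (?h s) x u v)
      (\<lambda>x u v w. \<Sum>s\<in>S. wedge3 (?f s) (?g s) (?h s) x u v w)"
    by (rule represents_wedge_sum[OF W \<open>finite S\<close>])
  then obtain c where c: "represents W c (\<lambda>x u v. \<Sum>s\<in>S. wedge2 (?f s) (?g s) (?h s) x u v)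
      (\<lambda>x u v w. \<Sum>s\<in>S. wedge3 (?f s) (?g s) (?h s) x u v w)" by blast
  have Phi: "(\<Sum>s\<in>S. wedge2 (?f s) (?g s) (?h s) x u v)
      = wform \<eta> (\<sigma> x) (dmap \<sigma> x u) (dmap \<sigma> x v)" for x u v
  proof -
    have "(\<Sum>s\<in>S. wedge2 (?f s) (?g s) (?h s) x u v)
        = (\<Sum>j<length \<eta>. \<Sum>k<j. wedge2 (?f (j, k)) (?g (j, k)) (?h (j, k)) x u v)"
      by (subst sum.Sigma) (auto intro!: sum.cong simp: S_def)
    then show ?thesis by (simp add: wform_eq_coeff wedge2_def T_def dmap_def)
  qed
  have Psi: "(\<Sum>s\<in>S. wedge3 (?f s) (?g s) (?h s) x u v w)
      = - tr3 n (wlogr \<eta> (\<sigma> x) (dmap \<sigma> x u) (length \<eta>))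
      (wlogr \<eta> (\<sigma> x) (dmap \<sigma> x v) (length \<eta>)) (wlogr \<eta> (\<sigma> x) (dmap \<sigma> x w) (length \<eta>))"
    if x: "\<And>j. j \<in> invs W \<Longrightarrow> x j \<noteq> 0" for x u v w
  proof -
    let ?d = "dmap \<sigma> x"
    define \<theta> where "\<theta> v j = wlog \<eta> (\<sigma> x) v j" for v j
    have dT: "dderiv (\<lambda>x. T k j (\<sigma> x)) x u = dderiv (T k j) (\<sigma> x) (?d u)" if "j < length \<eta>" for k j u
      using that x V by (intro dderiv_compose[where V=V and W=W] regT reg) auto
    have dTsum: "(\<Sum>k<j. dderiv (T k j) z u * v k) = ent (winv \<eta> z j * wdiff2 \<eta> z u v j
        - wlog \<eta> z u j * wlog \<eta> z v j) (\<eta> ! j) (\<eta> ! j + 1)" if j: "j < length \<eta>" for j z u v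
    proof -
      have "((\<lambda>s. \<Sum>k<j. v k * T k j (\<lambda>k. z k + s * u k)) has_field_derivative
          (\<Sum>k<j. v k * dderiv (T k j) z u)) (at 0)"
        using V by (intro DERIV_sum DERIV_cmult regular_line[OF regT[OF j]]) auto
      then have "((\<lambda>s. ent (wlog \<eta> (\<lambda>k. z k + s * u k) v j) (\<eta> ! j) (\<eta> ! j + 1)) has_field_derivative
          (\<Sum>k<j. v k * dderiv (T k j) z u)) (at 0)"
        unfolding T_def ent_wlog_units[symmetric] .
      moreover have "((\<lambda>s. ent (wlog \<eta> (\<lambda>k. z k + s * u k) v j) (\<eta> ! j) (\<eta> ! j + 1)) has_field_derivative
          ent (winv \<eta> z j * wdiff2 \<eta> z u v j - wlog \<eta> z u j * wlog \<eta> z v j) (\<eta> ! j) (\<eta> ! j + 1)) (at 0)"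
        using j by (intro mderivD mderiv_wlog[OF eta]) simp
      ultimately show ?thesis by (metis (no_types, lifting) DERIV_unique mult.commute sum.cong)
    qed
    have "(\<Sum>s\<in>S. wedge3 (?f s) (?g s) (?h s) x u v w)
        = (\<Sum>j<length \<eta>. \<Sum>k<j. wedge3 (?f (j, k)) (?g (j, k)) (?h (j, k)) x u v w)"
      by (subst sum.Sigma) (auto intro!: sum.cong simp: S_def)
    also have "\<dots> = (\<Sum>j<length \<eta>.
        - (?d w j * ent (\<theta> (?d u) j * \<theta> (?d v) j - \<theta> (?d v) j * \<theta> (?d u) j) (\<eta> ! j) (\<eta> ! j + 1)
         + ?d u j * ent (\<theta> (?d v) j * \<theta> (?d w) j - \<theta> (?d w) j * \<theta> (?d v) j) (\<eta> ! j) (\<eta> ! j + 1)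
         + ?d v j * ent (\<theta> (?d w) j * \<theta> (?d u) j - \<theta> (?d u) j * \<theta> (?d w) j) (\<eta> ! j) (\<eta> ! j + 1)))"
    proof (rule sum.cong[OF refl])
      fix j assume "j \<in> {..<length \<eta>}"
      then have j: "j < length \<eta>" by simp
      let ?D = "\<lambda>k u. dderiv (T k j) (\<sigma> x) (?d u)"
      let ?i = "\<eta> ! j"
      have "(\<Sum>k<j. wedge3 (?f (j, k)) (?g (j, k)) (?h (j, k)) x u v w)
          = ?d w j * ((\<Sum>k<j. ?D k u * ?d v k) - (\<Sum>k<j. ?D k v * ?d u k))
          + ?d u j * ((\<Sum>k<j. ?D k v * ?d w k) - (\<Sum>k<j. ?D k w * ?d v k))
          + ?d v j * ((\<Sum>k<j. ?D k w * ?d u k) - (\<Sum>k<j. ?D k u * ?d w k))"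
        unfolding sum_subtractf[symmetric] sum_distrib_left sum.distrib[symmetric]
        by (intro sum.cong refl) (simp add: wedge3_def dT[OF j] dmap_def[of \<sigma>] algebra_simps)
      then show "(\<Sum>k<j. wedge3 (?f (j, k)) (?g (j, k)) (?h (j, k)) x u v w) =
        - (?d w j * ent (\<theta> (?d u) j * \<theta> (?d v) j - \<theta> (?d v) j * \<theta> (?d u) j) ?i (?i + 1)
         + ?d u j * ent (\<theta> (?d v) j * \<theta> (?d w) j - \<theta> (?d w) j * \<theta> (?d v) j) ?i (?i + 1)
         + ?d v j * ent (\<theta> (?d w) j * \<theta> (?d u) j - \<theta> (?d u) j * \<theta> (?d w) j) ?i (?i + 1))"
        \<comment> \<open>The symmetric second derivatives cancel in each difference and leave
          commutators.\<close>
        unfolding dTsum[OF j] \<theta>_def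
        using wdiff2_commute[of \<eta> "\<sigma> x" "?d u" "?d v" j] wdiff2_commute[of \<eta> "\<sigma> x" "?d v" "?d w" j]
          wdiff2_commute[of \<eta> "\<sigma> x" "?d w" "?d u" j]
        by (simp add: algebra_simps)
    qed
    also have "\<dots> = - tr3 n (wlogr \<eta> (\<sigma> x) (?d u) (length \<eta>)) (wlogr \<eta> (\<sigma> x) (?d v) (length \<eta>))
        (wlogr \<eta> (\<sigma> x) (?d w) (length \<eta>))"
      unfolding tr3_wlogr[OF eta order_refl] sum_negf \<theta>_def ..
    finally show ?thesis .
  qed
  from c show ?thesis
    unfolding represents_def Phi using Psi by (intro exI[of _ c]) auto
qed

section \<open>The braid variety\<close>

lemma diagonal_pmat:
  assumes "\<And>a. \<pi> (\<pi> a) = a"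
  shows "diagonal d * pmat \<pi> = pmat \<pi> * diagonal (\<lambda>k. d (\<pi> k))"
  by (rule rmat_eqI) (auto simp: ent_diagonal_times ent_pmat_times ent_pmat ent_diagonal assms)

lemma unit_block_pmat_w0 [simp]: "unit_block n (pmat (w0 n))"
  by (auto simp: unit_block_def ent_pmat w0_def)

lemma mderiv_lmat: "mderiv (\<lambda>s. lmat n (\<lambda>k. y k + s * v k)) (lmat n v - 1)"
  by (auto simp: mderiv_def ent_lmat ent_one line_deriv)

lemma lower_lmat: "lower (lmat n y)"
  by (auto simp: lower_def ent_lmat)

locale braid_closure =
  fixes n :: nat and \<beta> :: "nat list" and M :: "nat set"
  assumes word: "braid_word n \<beta>" and M: "cycle_transversal n \<beta> M"
begin

abbreviation "\<eta> \<equiv> \<beta> @ delta n"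
abbreviation "N \<equiv> length \<beta> + length (delta n)"
abbreviation "w \<equiv> word_perm \<beta>"
abbreviation "X \<equiv> X0 n \<eta> (w0 n)"

lemma eta: "braid_word n \<eta>"
  using word braid_word_delta[of n] by (auto simp: braid_word_def)

lemma idx_X [simp]: "idx X = {..<N}" and invs_X [simp]: "invs X = {}"
  by (simp_all add: X0_def)

text \<open>A point of the braid variety is a decomposition \<open>Um = Pm * Lm\<close> of an upper triangular
  matrix, \<open>Lm\<close> being unit lower triangular.  In the directions tangent to it, \<open>ups\<close> is the
  derivative of \<open>ln U\<^sub>k\<^sub>k\<close>; in the other directions it still depends only on the variables of \<open>\<beta>\<close>.\<close>

definition Pm :: "(nat \<Rightarrow> complex) \<Rightarrow> rmat" where "Pm x = wprod \<beta> x (length \<beta>)"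
definition Lm :: "(nat \<Rightarrow> complex) \<Rightarrow> rmat" where "Lm x = lmat n (\<lambda>k. x (length \<beta> + k))"
definition Um :: "(nat \<Rightarrow> complex) \<Rightarrow> rmat" where "Um x = wprod \<eta> x N * pmat (w0 n)"
definition Ui :: "(nat \<Rightarrow> complex) \<Rightarrow> rmat" where "Ui x = pmat (w0 n) * winv \<eta> x N"
definition dU :: "(nat \<Rightarrow> complex) \<Rightarrow> (nat \<Rightarrow> complex) \<Rightarrow> rmat" where
  "dU x v = wdiff \<eta> x v N * pmat (w0 n)"
definition dP :: "(nat \<Rightarrow> complex) \<Rightarrow> (nat \<Rightarrow> complex) \<Rightarrow> rmat" where
  "dP x v = wdiff \<beta> x v (length \<beta>)"
text \<open>\<open>lmat\<close> is affine in its variables with constant part 1, which has to be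
  removed for a derivative.\<close>

definition dL :: "(nat \<Rightarrow> complex) \<Rightarrow> rmat" where
  "dL v = lmat n (\<lambda>k. v (length \<beta> + k)) - 1"
definition ups :: "(nat \<Rightarrow> complex) \<Rightarrow> (nat \<Rightarrow> complex) \<Rightarrow> nat \<Rightarrow> complex" where
  "ups x v k = ent (Ui x * dU x v) k k"

lemma pmat_w0 [simp]: "pmat (w0 n) * pmat (w0 n) = 1"
  by (rule pmat_pmat) simp

lemma pmat_w0_assoc [simp]: "pmat (w0 n) * (pmat (w0 n) * Y) = Y"
  by (simp flip: mult.assoc)

lemma Um_Ui [simp]: "Um x * Ui x = 1" and Ui_Um [simp]: "Ui x * Um x = 1"
  by (simp_all add: Um_def Ui_def mult.assoc)

lemma Um_eq: "Um x = Pm x * Lm x"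
proof -
  have "Um x = Pm x * (wprod (delta n) (\<lambda>k. x (length \<beta> + k)) (length (delta n)) * pmat (w0 n))"
    by (simp add: Um_def wprod_append Pm_def mult.assoc)
  then show ?thesis by (simp add: wprod_delta Lm_def)
qed

text \<open>The half twist is differentiated through \<open>wprod_delta\<close>: both sides have the
  same derivative, and that of \<open>lmat\<close> is evident.\<close>

lemma dU_eq: "dU x v = dP x v * Lm x + Pm x * dL v"
proof -
  let ?y = "\<lambda>k. x (length \<beta> + k)" and ?v = "\<lambda>k. v (length \<beta> + k)"
  have "mderiv (\<lambda>s. wprod (delta n) (\<lambda>k. ?y k + s * ?v k) (length (delta n)) * pmat (w0 n))
      (wdiff (delta n) ?y ?v (length (delta n)) * pmat (w0 n))"
    using mderivD[OF mderiv_wprod_line] by (auto simp: mderiv_def ent_times_pmat)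
  then have "wdiff (delta n) ?y ?v (length (delta n)) * pmat (w0 n) = dL v"
    unfolding wprod_delta dL_def by (rule mderiv_unique[OF _ mderiv_lmat])
  moreover have "dU x v = dP x v * (wprod (delta n) ?y (length (delta n)) * pmat (w0 n))
      + Pm x * (wdiff (delta n) ?y ?v (length (delta n)) * pmat (w0 n))"
    by (simp add: dU_def wdiff_append dP_def Pm_def distrib_right mult.assoc)
  ultimately show ?thesis by (simp add: wprod_delta Lm_def)
qed

lemma unit_block_Pm [simp]: "unit_block n (Pm x)" by (simp add: Pm_def unit_block_wprod word)
lemma unit_block_Um [simp]: "unit_block n (Um x)" using unit_block_wprod[OF eta, of N x] by (simp add: Um_def)
lemma unit_block_Ui [simp]: "unit_block n (Ui x)" using unit_block_winv[OF eta, of N x] by (simp add: Ui_def)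
lemma zero_block_dU [simp]: "zero_block n (dU x v)" using zero_block_wdiff[OF eta, of N x v] by (simp add: dU_def)

lemma lower_Lm [simp]: "lower (Lm x)" by (simp add: Lm_def lower_lmat)
lemma Lm_diag [simp]: "ent (Lm x) k k = 1" by (simp add: Lm_def ent_lmat)
lemma lower_dL [simp]: "lower (dL v)" by (simp add: dL_def lower_lmat)
lemma dL_diag [simp]: "ent (dL v) k k = 0" by (simp add: dL_def ent_lmat ent_one)

lemma ent_Lm: "b < a \<Longrightarrow> a < n \<Longrightarrow> ent (Lm x) a b = x (length \<beta> + delta_pos n a b)"
  by (simp add: Lm_def ent_lmat)

lemma ent_dL: "b < a \<Longrightarrow> a < n \<Longrightarrow> ent (dL v) a b = v (length \<beta> + delta_pos n a b)"
  by (simp add: dL_def ent_lmat ent_one)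

text \<open>U = P L makes U^-1 P the inverse of L.\<close>

definition Li :: "(nat \<Rightarrow> complex) \<Rightarrow> rmat" where "Li x = Ui x * Pm x"

lemma Lm_Li [simp]: "Lm x * Li x = 1"
proof -
  let ?Q = "winv \<beta> x (length \<beta>)"
  have "?Q * (Um x * Ui x) * Pm x = Lm x * Li x"
    by (simp add: Um_eq Li_def Pm_def mult.assoc del: Um_Ui)
  then show ?thesis by (simp add: Pm_def)
qed

lemma lower_Li [simp]: "lower (Li x)"
  by (rule lower_right_inverse[OF lower_Lm Lm_Li])

lemma Li_diag [simp]: "ent (Li x) k k = 1"
  using ent_lower_times_diag[OF lower_Lm[of x] lower_Li[of x], of k] by (simp add: ent_one)

section \<open>Equations and tangent spaces of the braid variety\<close>

lemma X0_eq_ent: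
  assumes "a < n" "b < n"
  shows "(braid_mat n \<eta> x * perm_mat n (w0 n)) $$ (a,b) = ent (Um x) a b"
proof -
  have p: "perm_mat n (w0 n) = to_mat n (pmat (w0 n))"
    by (rule eq_matI) (auto simp: perm_mat_def to_mat_def ent_pmat)
  have "braid_mat n \<eta> x * perm_mat n (w0 n) = to_mat n (Um x)"
    unfolding braid_mat_eq[OF eta] p Um_def
    using unit_block_wprod[OF eta, of N x] by (simp add: to_mat_times)
  then show ?thesis using assms by simp
qed

lemma points_X: "x \<in> points X \<longleftrightarrow> x \<in> coord_space {..<N} \<and> upper (Um x)"
proof -
  have "(\<forall>f\<in>eqs X. f x = 0)
      \<longleftrightarrow> (\<forall>a b. b < a \<and> a < n \<longrightarrow> (braid_mat n \<eta> x * perm_mat n (w0 n)) $$ (a,b) = 0)"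
    by (simp add: X0_def) blast
  also have "\<dots> \<longleftrightarrow> (\<forall>a b. b < a \<and> a < n \<longrightarrow> ent (Um x) a b = 0)"
    by (auto simp: X0_eq_ent)
  also have "\<dots> \<longleftrightarrow> upper (Um x)"
  proof -
    have "ent (Um x) a b = 0" if "b < a" "n \<le> a" for a b
      using unit_block_Um[of x] that by (auto simp: unit_block_def)
    then show ?thesis unfolding upper_def by (meson not_le)
  qed
  finally show ?thesis by (auto simp: points_def)
qed

lemma mderiv_Um: "mderiv (\<lambda>s. Um (\<lambda>k. x k + s * v k)) (dU x v)"
  using mderivD[OF mderiv_wprod_line] by (auto simp: mderiv_def Um_def dU_def ent_times_pmat)

lemma tangent_X: "v \<in> tangent X x \<longleftrightarrow> v \<in> coord_space {..<N} \<and> upper (dU x v)"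
proof -
  have d: "dderiv (\<lambda>z. (braid_mat n \<eta> z * perm_mat n (w0 n)) $$ (a,b)) x v = ent (dU x v) a b"
    if "b < a" "a < n" for a b
    using that by (intro dderivI) (simp add: X0_eq_ent mderivD[OF mderiv_Um])
  have "(\<forall>f\<in>eqs X. dderiv f x v = 0) \<longleftrightarrow> (\<forall>a b. b < a \<and> a < n \<longrightarrow>
      dderiv (\<lambda>z. (braid_mat n \<eta> z * perm_mat n (w0 n)) $$ (a,b)) x v = 0)"
    by (simp add: X0_def) blast
  also have "\<dots> \<longleftrightarrow> (\<forall>a b. b < a \<and> a < n \<longrightarrow> ent (dU x v) a b = 0)"
    by (auto simp: d)
  also have "\<dots> \<longleftrightarrow> upper (dU x v)"
    using zero_block_dU[of x v] unfolding upper_def zero_block_def by (meson not_le)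
  finally show ?thesis by (auto simp: tangent_def)
qed

lemma upper_Ui: "upper (Um x) \<Longrightarrow> upper (Ui x)"
  by (rule upper_left_inverse) auto

lemma Um_Ui_diag: "upper (Um x) \<Longrightarrow> ent (Um x) k k * ent (Ui x) k k = 1"
  using ent_upper_times_diag[of "Um x" "Ui x" k] upper_Ui[of x] by (simp add: ent_one)

lemma Um_diag_nz: "upper (Um x) \<Longrightarrow> ent (Um x) k k \<noteq> 0"
  using Um_Ui_diag[of x k] by auto

lemma Ui_diag: "upper (Um x) \<Longrightarrow> ent (Ui x) k k = 1 / ent (Um x) k k"
  using Um_Ui_diag[of x k] Um_diag_nz[of x k] by (simp add: field_simps)

lemma ups_upper: "upper (Um x) \<Longrightarrow> upper (dU x v) \<Longrightarrow> ups x v k = ent (dU x v) k k / ent (Um x) k k"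
  by (simp add: ups_def ent_upper_times_diag upper_Ui Ui_diag)

lemma dU_lin: "dU x (\<lambda>i. u i + c * v i) = dU x u + diagonal (\<lambda>_. c) * dU x v"
  by (simp add: dU_def wdiff_add wdiff_scale distrib_right mult.assoc)

lemma ent_dU_lin: "ent (dU x (\<lambda>i. u i + c * v i)) a b = ent (dU x u) a b + c * ent (dU x v) a b"
  by (simp add: dU_lin ent_diagonal_times)

lemma Y_diagonal_commute: "Y * (diagonal (\<lambda>_. c) * Z) = diagonal (\<lambda>_. c) * (Y * Z)"
  by (metis diagonal_const_commute mult.assoc)

lemma ups_lin: "ups x (\<lambda>i. u i + c * v i) k = ups x u k + c * ups x v k"
  by (simp add: ups_def dU_lin distrib_left Y_diagonal_commute ent_diagonal_times)

lemma dP_cong: "(\<And>j. j < length \<beta> \<Longrightarrow> v j = v' j) \<Longrightarrow> dP x v = dP x v'"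
  unfolding dP_def by (rule wdiff_cong) simp

text \<open>U^-1 P dL = L^-1 dL is strictly lower triangular, so the half-twist part of dU does not
  contribute to \<open>ups\<close>.\<close>

lemma Ui_Pm_dL_diag: "ent (Ui x * (Pm x * dL v)) k k = 0"
proof -
  have "Ui x * (Pm x * dL v) = Li x * dL v" by (simp add: Li_def mult.assoc)
  then show ?thesis by (simp add: ent_lower_times_diag)
qed

lemma ups_eq_dP: "ups x v k = ent (Ui x * (dP x v * Lm x)) k k"
  by (simp add: ups_def dU_eq distrib_left Ui_Pm_dL_diag)

lemma ups_cong: "(\<And>j. j < length \<beta> \<Longrightarrow> v j = v' j) \<Longrightarrow> ups x v k = ups x v' k"
  unfolding ups_eq_dP using dP_cong[of v v' x] by simp

section \<open>Determination of points and tangent vectors by the variables of the braid\<close>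

lemma coord_eqI:
  assumes "x \<in> coord_space {..<N}" "y \<in> coord_space {..<N}" "\<And>j. j < N \<Longrightarrow> x j = y j"
  shows "x = y"
proof
  fix j show "x j = y j" using assms by (cases "j < N") (auto simp: coord_space_def)
qed

lemma coord_eq_Lm:
  assumes "x \<in> coord_space {..<N}" "y \<in> coord_space {..<N}" "\<And>j. j < length \<beta> \<Longrightarrow> x j = y j"
    and "\<And>a b. b < a \<Longrightarrow> a < n \<Longrightarrow> ent (Lm x) a b = ent (Lm y) a b"
  shows "x = y"
proof (rule coord_eqI[OF assms(1,2)])
  fix j assume "j < N"
  show "x j = y j"
  proof (cases "j < length \<beta>")
    case False
    obtain a b where ab: "delta_entry n (j - length \<beta>) = (a, b)" by fastforce
    with delta_pos_delta_entry[of "j - length \<beta>" n] False \<open>j < N\<close>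
    have "b < a" "a < n" "length \<beta> + delta_pos n a b = j" by auto
    with assms(4)[of b a] show ?thesis by (simp add: ent_Lm)
  qed (simp add: assms(3))
qed

text \<open>With the same P, the matrix L(x)^-1 L(y) = U(x)^-1 U(y) is both unit lower and upper
  triangular, hence 1.\<close>

lemma points_X_eqI:
  assumes "x \<in> points X" "y \<in> points X" "\<And>j. j < length \<beta> \<Longrightarrow> x j = y j"
  shows "x = y"
proof (rule coord_eq_Lm)
  have P: "Pm x = Pm y" unfolding Pm_def by (rule wprod_cong) (simp add: assms(3))
  have ux: "upper (Um x)" and uy: "upper (Um y)" using assms by (auto simp: points_X)
  have eq: "Li x * Lm y = Ui x * Um y" by (simp add: Li_def P Um_eq mult.assoc)
  have "Li x * Lm y = 1"
  proof (rule rmat_eqI)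
    fix a b
    have "upper (Li x * Lm y)" unfolding eq by (intro upper_times upper_Ui ux uy)
    moreover have "lower (Li x * Lm y)" by simp
    moreover have "ent (Li x * Lm y) a a = 1" by (simp add: ent_lower_times_diag)
    ultimately show "ent (Li x * Lm y) a b = ent 1 a b"
      unfolding upper_def lower_def by (metis ent_one nat_neq_iff)
  qed
  then have "Lm x * (Li x * Lm y) = Lm x" by simp
  then have "Lm y = Lm x" by (simp flip: mult.assoc)
  then show "ent (Lm x) a b = ent (Lm y) a b" for a b by simp
qed (use assms in \<open>auto simp: points_X\<close>)

text \<open>The infinitesimal version: for the difference d of the vectors, L^-1 dL(d) is strictly
  lower and upper triangular, hence 0.\<close>

lemma tangent_X_eqI:
  assumes x: "x \<in> points X" and u: "u \<in> tangent X x" and v: "v \<in> tangent X x"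
    and "\<And>j. j < length \<beta> \<Longrightarrow> u j = v j"
  shows "u = v"
proof -
  define d where "d = (\<lambda>i. u i + (- 1) * v i)"
  have P0: "dP x d = 0"
    unfolding dP_def using assms(4) by (subst wdiff_cong[where v'="\<lambda>_. 0"]) (auto simp: d_def)
  have "dU x d = dU x u - dU x v"
    unfolding d_def by (rule rmat_eqI) (subst ent_dU_lin, simp)
  then have "upper (dU x d)" using u v by (simp add: tangent_X)
  then have "upper (Pm x * dL d)" by (simp add: dU_eq P0)
  then have "upper (Ui x * (Pm x * dL d))" 
    using x upper_times[OF upper_Ui, of x "Pm x * dL d"] by (simp add: points_X)
  then have up: "upper (Li x * dL d)" by (simp add: Li_def mult.assoc)
  have "Li x * dL d = 0"
  proof (rule rmat_eqI)
    fix a b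
    have "lower (Li x * dL d)" by simp
    moreover have "ent (Li x * dL d) a a = 0" by (simp add: ent_lower_times_diag)
    ultimately show "ent (Li x * dL d) a b = ent 0 a b"
      using up unfolding upper_def lower_def by (metis ent_zero nat_neq_iff)
  qed
  then have "Lm x * (Li x * dL d) = 0" by simp
  then have dL0: "dL d = 0" by (simp flip: mult.assoc)
  show ?thesis
  proof (rule coord_eqI)
    fix j assume "j < N"
    show "u j = v j"
    proof (cases "j < length \<beta>")
      case False
      obtain a b where ab: "delta_entry n (j - length \<beta>) = (a, b)" by fastforce
      with delta_pos_delta_entry[of "j - length \<beta>" n] False \<open>j < N\<close>
      have "b < a" "a < n" "length \<beta> + delta_pos n a b = j" by auto
      with ent_dL[of b a d] have "d j = 0" by (simp add: dL0)
      then show ?thesis by (simp add: d_def)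
    qed (simp add: assms(4))
  qed (use u v in \<open>auto simp: tangent_X\<close>)
qed

subsection \<open>The cycles of the permutation\<close>

lemma w_perm: "w permutes {..<n}"
  by (rule word_perm_permutes[OF word])

lemma w_less: "k < n \<Longrightarrow> w k < n"
  by (rule word_perm_less[OF word])

lemma w_permutation: "permutation w"
  using w_perm by (auto simp: permutation_permutes)

lemma self_in_orbit: "k \<in> orbit w k"
  by (rule permutation_self_in_orbit[OF w_permutation])

lemma orbit_sym: "l \<in> orbit w k \<Longrightarrow> k \<in> orbit w l"
  by (rule orbit_swap[OF self_in_orbit])

lemma orbit_eq: "l \<in> orbit w k \<Longrightarrow> orbit w l = orbit w k"
  using orbit_trans orbit_sym by (metis subsetI subset_antisym)

lemma orbit_w: "orbit w (w k) = orbit w k"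
  by (rule orbit_eq) (rule orbit.base)

lemma orbit_less: "l \<in> orbit w k \<Longrightarrow> k < n \<Longrightarrow> l < n"
  by (induction rule: orbit.induct) (auto intro: w_less)

lemma M_less: "m \<in> M \<Longrightarrow> m < n"
  using M by (auto simp: cycle_transversal_def)

lemma M_ex: "k < n \<Longrightarrow> \<exists>m\<in>M. m \<in> orbit w k"
  using M by (auto simp: cycle_transversal_def)

lemma M_unique: "k < n \<Longrightarrow> m \<in> M \<Longrightarrow> m \<in> orbit w k \<Longrightarrow> m' \<in> M \<Longrightarrow> m' \<in> orbit w k \<Longrightarrow> m = m'"
  using M by (auto simp: cycle_transversal_def)

definition steps :: "nat \<Rightarrow> nat" where
  "steps k = (LEAST p. (w ^^ p) k \<in> M)"

lemma funpow_in_orbit: "(w ^^ p) k \<in> orbit w k"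
  by (cases "p = 0") (simp add: self_in_orbit, auto simp: orbit_altdef)

lemma steps_M:
  assumes "k < n" shows "(w ^^ steps k) k \<in> M"
proof -
  obtain m where "m \<in> M" "m \<in> orbit w k" using M_ex[OF assms] by blast
  then obtain p where "(w ^^ p) k \<in> M" by (auto simp: orbit_altdef)
  then show ?thesis unfolding steps_def by (rule LeastI)
qed

lemma steps_not_M: "p < steps k \<Longrightarrow> (w ^^ p) k \<notin> M"
  unfolding steps_def by (rule not_less_Least)

lemma steps_Suc:
  assumes "k < n" "k \<notin> M" shows "steps k = Suc (steps (w k))"
  unfolding steps_def
  using Least_Suc[of "\<lambda>p. (w ^^ p) k \<in> M" "steps k"] steps_M[OF assms(1)] assms(2)
  by (simp add: funpow_Suc_right del: funpow.simps(2))

text \<open>Nothing is assumed about the step that leaves a marked strand, so cycles are not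
  traversed fully: from k and from l one follows w forward to the first marked strand, which is the
  same one.\<close>

lemma const_on_orbit:
  assumes f: "\<And>k. k < n \<Longrightarrow> k \<notin> M \<Longrightarrow> f (w k) = f k" and "k < n" "l \<in> orbit w k"
  shows "f l = f k"
proof -
  have *: "f ((w ^^ steps k) k) = f k" if "k < n" for k
  proof -
    have "f ((w ^^ p) k) = f k" if "p \<le> steps k" for p
      using that
    proof (induction p)
      case (Suc p)
      then show ?case
        using f[of "(w ^^ p) k"] steps_not_M[of p k] orbit_less[OF funpow_in_orbit \<open>k < n\<close>] by simp
    qed simp
    then show ?thesis by simp
  qed
  have l: "l < n" using assms orbit_less by blast
  have "(w ^^ steps l) l \<in> orbit w k" using funpow_in_orbit[of "steps l" l] orbit_eq[OF assms(3)] by simp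
  then have "(w ^^ steps l) l = (w ^^ steps k) k"
    using M_unique[OF \<open>k < n\<close>] steps_M l \<open>k < n\<close> funpow_in_orbit by blast
  then show ?thesis using *[OF \<open>k < n\<close>] *[OF l] by simp
qed

lemma word_perm_eta: "word_perm \<eta> (w0 n k) = w k"
  by (simp add: word_perm_append word_perm_delta)

subsection \<open>Nondegeneracy\<close>

text \<open>The rank and the smoothness argument meet here. At marked strands the diagonal of U is
  not constrained, so S has no multiplier there; \<open>on\<close> says that its entry comes from
  the trace term of the form alone.\<close>

lemma propagation:
  assumes x: "x \<in> points X" and u: "u \<in> tangent X x" and S: "upper S" "zero_block n S"
    and crit: "\<And>k. k < N \<Longrightarrow> ent (prop_mat \<eta> x u S k) (\<eta> ! k) (\<eta> ! k + 1) = 0"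
    and off: "\<And>k. k < n \<Longrightarrow> k \<notin> M \<Longrightarrow> ups x u k = 0"
    and on: "\<And>m. m \<in> M \<Longrightarrow> ent S m m = ups x u m"
  shows "u = (\<lambda>_. 0) \<and> S = 0"
proof -
  have U: "upper (Um x)" using x by (simp add: points_X)
  have dU: "upper (dU x u)" using u by (simp add: tangent_X)
  let ?D = "prop_mat \<eta> x u S"
  define Z where "Z = Ui x * (S * Um x) - 2 * (Ui x * dU x u)"
  have Zup: "upper Z" unfolding Z_def by (intro upper_simps upper_times upper_Ui U S dU)
  have Zdiag: "ent Z k k = ent S k k - 2 * ups x u k" for k
    using Um_Ui_diag[OF U, of k] S U
    by (simp add: Z_def ent_upper_times_diag upper_Ui ups_def mult.commute mult.left_commute)
  \<comment> \<open>Conjugation by \<open>w0\<close> turns the upper triangular Z into a lower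
    triangular matrix; this is the second triangularity of the last matrix.\<close>
  have DZ: "?D N = pmat (w0 n) * Z * pmat (w0 n)"
  proof -
    have "pmat (w0 n) * Z * pmat (w0 n)
        = pmat (w0 n) * (Ui x * (S * Um x)) * pmat (w0 n) - 2 * (pmat (w0 n) * (Ui x * dU x u) * pmat (w0 n))"
      by (simp add: Z_def algebra_simps mult_2 mult_2_right)
    also have "\<dots> = ?D N"
      by (simp add: Ui_def Um_def dU_def prop_mat_def wlog_def mult.assoc)
    finally show ?thesis ..
  qed
  have ent_D: "ent (?D N) a b = ent Z (w0 n a) (w0 n b)" for a b
    by (simp add: DZ ent_times_pmat ent_pmat_times)
  have up: "upper (?D j) \<and> (\<forall>k. ent (?D j) k k = ent S (word_perm (take j \<eta>) k) (word_perm (take j \<eta>) k))"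
    if "j \<le> N" for j
    using prop_mat_upper[OF S(1), of \<eta> x u j] crit that by simp
  have step: "ent S (w k) (w k) = ent S k k - 2 * ups x u k" for k
    using up[of N] ent_D[of "w0 n k" "w0 n k"] by (simp add: Zdiag word_perm_eta)
  have const: "ent S (w k) (w k) = ent S k k" if "k < n" "k \<notin> M" for k
    using step[of k] off[OF that] by simp
  \<comment> \<open>w(m) lies on the cycle of m, so constancy makes the two diagonal entries of S
    equal. The step relation then gives \<open>ups x u m = 0\<close>, and \<open>on\<close>
    transfers this to S.\<close>
  have M0: "ent S m m = 0 \<and> ups x u m = 0" if "m \<in> M" for m
    using const_on_orbit[of "\<lambda>k. ent S k k", OF const M_less[OF that] orbit.base] step[of m] on[OF that] by simp
  have diag: "ent S k k = 0" for k
  proof (cases "k < n")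
    case True
    then obtain m where "m \<in> M" "m \<in> orbit w k" using M_ex by blast
    then have "ent S m m = ent S k k"
      using const_on_orbit[of "\<lambda>k. ent S k k", OF const True] by simp
    then show ?thesis using M0 \<open>m \<in> M\<close> by simp
  next
    case False
    then show ?thesis using S(2) by (simp add: zero_block_def)
  qed
  have "?D N = 0"
  proof (rule rmat_eqI)
    fix a b
    consider "b < a" | "a = b" | "a < b" "n \<le> b" | "a < b" "b < n" by linarith
    then show "ent (?D N) a b = ent 0 a b"
    proof cases
      case 1
      then show ?thesis using up[of N] by (simp add: upper_def)
    next
      case 2
      then show ?thesis using up[of N] diag by simp
    next
      case 3
      have "zero_block n (prop_mat \<eta> x u S N)"
        using zero_block_wdiff[OF eta, of N x u] unit_block_winv[OF eta, of N x] unit_block_wprod[OF eta, of N x] S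
        by (simp add: prop_mat_def wlog_def)
      then show ?thesis using 3 by (simp add: zero_block_def)
    next
      case 4
      then show ?thesis using upperD[OF Zup w0_mono[OF 4]] by (simp add: ent_D)
    qed
  qed
  then have vanish: "?D 0 = 0 \<and> (\<forall>k. 0 \<le> k \<longrightarrow> k < length \<eta> \<longrightarrow> u k = 0)"
    using up by (intro prop_mat_back) simp_all
  have "u k = 0" for k
    using vanish u by (cases "k < N") (auto simp: tangent_X coord_space_def)
  with vanish show ?thesis by auto
qed

end

section \<open>The differential of the cusps as an elimination\<close>

text \<open>Gaussian elimination from the lower right corner, in which every pivot is treated as if it
  were \<open>- 1\<close>.\<close>

primrec eliminate :: "nat \<Rightarrow> rmat \<Rightarrow> nat \<Rightarrow> rmat" where
  "eliminate n A 0 = A"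
| "eliminate n A (Suc m) = eliminate n A m + eliminate n A m * elem (n - Suc m) (n - Suc m) 1 * eliminate n A m"

text \<open>The accumulated row operations; \<open>elim_right\<close> collects column operations
  with the same effect. Step m+1 has its pivot at index n - m - 1.\<close>

primrec elim_left :: "nat \<Rightarrow> rmat \<Rightarrow> nat \<Rightarrow> rmat" where
  "elim_left n A 0 = 1"
| "elim_left n A (Suc m) = (1 + eliminate n A m * elem (n - Suc m) (n - Suc m) 1) * elim_left n A m"

primrec elim_right :: "nat \<Rightarrow> rmat \<Rightarrow> nat \<Rightarrow> rmat" where
  "elim_right n A 0 = 1"
| "elim_right n A (Suc m) = elim_right n A m * (1 + elem (n - Suc m) (n - Suc m) 1 * eliminate n A m)"

lemma ent_eliminate_Suc: "ent (eliminate n A (Suc m)) a b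
    = ent (eliminate n A m) a b + ent (eliminate n A m) a (n - Suc m) * ent (eliminate n A m) (n - Suc m) b"
  by (simp add: mult.assoc ent_times_col[where J="{n - Suc m}"] ent_elem_times)
    (subst ent_times_col[where J="{n - Suc m}"], auto simp: ent_elem_times)

lemma ent_elim_right_Suc: "ent (elim_right n A (Suc m)) a b
    = ent (elim_right n A m) a b + ent (elim_right n A m) a (n - Suc m) * ent (eliminate n A m) (n - Suc m) b"
  by (simp add: distrib_left) (subst ent_times_col[where J="{n - Suc m}"], auto simp: ent_elem_times)

lemma elim_left_times: "elim_left n A m * A = eliminate n A m"
  by (induction m) (simp_all add: mult.assoc distrib_right)

lemma times_elim_right: "A * elim_right n A m = eliminate n A m"
  by (induction m) (simp_all add: distrib_left flip: mult.assoc)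

lemma unit_block_eliminate: "unit_block n A \<Longrightarrow> m \<le> n \<Longrightarrow> unit_block n (eliminate n A m)"
  by (induction m) (auto simp: unit_block_def ent_eliminate_Suc simp del: eliminate.simps(2))

lemma elim_right_row: "m \<le> n \<Longrightarrow> a < n - m \<or> n \<le> a \<Longrightarrow> ent (elim_right n A m) a b = (if a = b then 1 else 0)"
proof (induction m arbitrary: b)
  case 0
  then show ?case by (simp add: ent_one)
next
  case (Suc m)
  then have a: "a < n - m \<or> n \<le> a" "a \<noteq> n - Suc m" "m \<le> n" by auto
  show ?case using Suc.IH[OF a(3,1)] a(2) by (simp add: ent_elim_right_Suc del: elim_right.simps(2))
qed

text \<open>Column b is taken at the moment when exactly the indices above b have been eliminated,
  which yields a unit lower triangular matrix. If all pivots are -1, then A times it has no entries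
  below the diagonal in the first n rows.\<close>

definition lower_factor :: "nat \<Rightarrow> rmat \<Rightarrow> rmat" where
  "lower_factor n A = Rmat (\<lambda>a b. if b < n then ent (elim_right n A (n - Suc b)) a b else if a = b then 1 else 0)"

lemma ent_lower_factor: "ent (lower_factor n A) a b = (if b < n then ent (elim_right n A (n - Suc b)) a b else if a = b then 1 else 0)"
proof -
  have "finite {b. (if b < n then ent (elim_right n A (n - Suc b)) a b else if a = b then 1 else 0) \<noteq> 0}" for a
    by (rule finite_subset[of _ "insert a {..<n}"]) (auto split: if_splits)
  then show ?thesis by (simp add: lower_factor_def ent_Rmat)
qed

lemma ent_lower_factor_le: "a \<le> b \<or> n \<le> a \<Longrightarrow> ent (lower_factor n A) a b = (if a = b then 1 else 0)"
  by (auto simp: ent_lower_factor elim_right_row)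

lemma ent_times_cong_col: "(\<And>j. ent Y j b = ent Y' j b) \<Longrightarrow> ent (X * Y) a b = ent (X * Y') a b"
  by (simp add: ent_times_raw)

lemma ent_times_lower_factor: "b < n \<Longrightarrow> ent (A * lower_factor n A) a b = ent (eliminate n A (n - Suc b)) a b"
  unfolding times_elim_right[symmetric] by (rule ent_times_cong_col) (simp add: ent_lower_factor)

text \<open>With pivot -1 a step replaces the pivot row r by r + (-1) r = 0, and rows that are zero
  stay zero.\<close>

lemma eliminate_rows_zero:
  assumes "\<And>k. k < n \<Longrightarrow> ent (eliminate n A (n - Suc k)) k k = - 1"
  shows "m \<le> n \<Longrightarrow> n - m \<le> a \<Longrightarrow> a < n \<Longrightarrow> ent (eliminate n A m) a b = 0"
proof (induction m arbitrary: b)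
  case (Suc m)
  show ?case
  proof (cases "a = n - Suc m")
    case True
    then have "ent (eliminate n A m) a a = - 1" using assms[of a] Suc.prems by simp
    then show ?thesis by (simp add: ent_eliminate_Suc True del: eliminate.simps(2))
  next
    case False
    then have "n - m \<le> a" using Suc.prems by simp
    then show ?thesis using Suc by (simp add: ent_eliminate_Suc del: eliminate.simps(2))
  qed
qed simp

subsection \<open>Itineraries\<close>

primrec path_weight :: "rmat \<Rightarrow> nat \<Rightarrow> nat list \<Rightarrow> nat \<Rightarrow> complex" where
  "path_weight A b [] a = ent A a b"
| "path_weight A b (c # s) a = ent A c b * path_weight A c s a"

lemma path_weight_append: "path_weight A b (s @ c # s') a = path_weight A b s c * path_weight A c s' a"
  by (induction s arbitrary: b) auto

definition valid :: "nat list \<Rightarrow> bool" where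
  "valid s \<longleftrightarrow> (\<forall>i j. i < j \<and> j < length s \<and> s ! i = s ! j \<longrightarrow> (\<exists>m. i < m \<and> m < j \<and> s ! m < s ! i))"

text \<open>The lower bound is the induction parameter: descending from n, each step admits one more
  strand and performs one more elimination.\<close>

definition itin :: "nat \<Rightarrow> nat \<Rightarrow> nat list set" where
  "itin n j = {s. set s \<subseteq> {j..<n} \<and> valid s}"

lemma itineraries_eq: "itineraries n k = itin n (Suc k)"
  by (simp add: itineraries_def itin_def valid_def atLeastSucLessThan_greaterThanLessThan)

lemma valid_appendD:
  assumes "valid (s @ s')" shows "valid s" "valid s'"
proof -
  show "valid s"
    unfolding valid_def
  proof (intro allI impI)
    fix i j assume ij: "i < j \<and> j < length s \<and> s ! i = s ! j"
    then have "\<exists>m. i < m \<and> m < j \<and> (s @ s') ! m < (s @ s') ! i"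
      using assms[unfolded valid_def, rule_format, of i j] by (simp add: nth_append)
    with ij show "\<exists>m. i < m \<and> m < j \<and> s ! m < s ! i" by (auto simp: nth_append)
  qed
  show "valid s'"
    unfolding valid_def
  proof (intro allI impI)
    fix i j assume ij: "i < j \<and> j < length s' \<and> s' ! i = s' ! j"
    then obtain m where m: "length s + i < m" "m < length s + j"
      "(s @ s') ! m < (s @ s') ! (length s + i)"
      using assms[unfolded valid_def, rule_format, of "length s + i" "length s + j"] by auto
    then show "\<exists>m. i < m \<and> m < j \<and> s' ! m < s' ! i"
      by (intro exI[of _ "m - length s"]) (auto simp: nth_append)
  qed
qed

text \<open>The separator c is smaller than every strand of both parts, so it is the witness for any
  repetition across it.\<close>

lemma valid_join:
  assumes s: "valid s" "valid s'" and gt: "\<And>x. x \<in> set s \<union> set s' \<Longrightarrow> c < x"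
  shows "valid (s @ c # s')"
  unfolding valid_def
proof (intro allI impI)
  fix i j assume ij: "i < j \<and> j < length (s @ c # s') \<and> (s @ c # s') ! i = (s @ c # s') ! j"
  let ?l = "length s" and ?t = "s @ c # s'"
  have nth1: "?t ! k = s ! k" if "k < ?l" for k using that by (simp add: nth_append)
  have nth2: "?t ! k = s' ! (k - Suc ?l)" if "k > ?l" for k
    using that by (simp add: nth_append nth_Cons')
  have nthc: "?t ! ?l = c" by simp
  have gt1: "c < ?t ! k" if "k < ?l" for k using gt[of "s ! k"] that by (simp add: nth1)
  have gt2: "c < ?t ! k" if "k > ?l" "k < length ?t" for k
  proof -
    have "k - Suc ?l < length s'" using that by auto
    then show ?thesis using gt[of "s' ! (k - Suc ?l)"] nth2[OF that(1)] by simp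
  qed
  consider "j < ?l" | "i < ?l" "j = ?l" | "i < ?l" "?l < j" | "i = ?l" "?l < j" | "?l < i" "?l < j"
    using ij by linarith
  then show "\<exists>m. i < m \<and> m < j \<and> ?t ! m < ?t ! i"
  proof cases
    case 1
    then have "s ! i = s ! j" using ij nth1[of i] nth1[of j] by simp
    then obtain m where "i < m" "m < j" "s ! m < s ! i"
      using s(1)[unfolded valid_def, rule_format, of i j] 1 ij by auto
    then show ?thesis using 1 ij by (intro exI[of _ m]) (simp add: nth1)
  next
    case 2
    then show ?thesis using gt1[of i] ij by simp
  next
    case 3
    then show ?thesis using gt1[of i] by (intro exI[of _ ?l]) simp
  next
    case 4
    then show ?thesis using gt2[of j] ij by simp
  next
    case 5
    let ?i = "i - Suc ?l" and ?j = "j - Suc ?l"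
    have "?i < ?j \<and> ?j < length s' \<and> s' ! ?i = s' ! ?j" using 5 ij nth2[of i] nth2[of j] by auto
    then obtain m where "?i < m" "m < ?j" "s' ! m < s' ! ?i" using s(2) unfolding valid_def by blast
    then show ?thesis using 5 nth2[of i] nth2[of "Suc ?l + m"]
      by (intro exI[of _ "Suc ?l + m"]) (auto simp: nth_append)
  qed
qed

text \<open>The smallest strand j occurs at most once, as a second visit would need a smaller strand
  in between. Splitting at that visit leaves two independent itineraries.\<close>

lemma itin_split:
  assumes "j < n"
  shows "itin n j = itin n (Suc j) \<union> (\<lambda>(s, s'). s @ j # s') ` (itin n (Suc j) \<times> itin n (Suc j))"
proof (intro equalityI subsetI)
  fix t assume t: "t \<in> itin n j"
  show "t \<in> itin n (Suc j) \<union> (\<lambda>(s, s'). s @ j # s') ` (itin n (Suc j) \<times> itin n (Suc j))"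
  proof (cases "j \<in> set t")
    case False
    have "set t \<subseteq> {Suc j..<n}"
    proof
      fix y assume y: "y \<in> set t"
      then have "y \<in> {j..<n}" "y \<noteq> j" using t False by (auto simp: itin_def)
      then show "y \<in> {Suc j..<n}" by simp
    qed
    then show ?thesis using t by (auto simp: itin_def)
  next
    case True
    then obtain s s' where ss: "t = s @ j # s'" "j \<notin> set s" by (meson split_list_first)
    have v: "valid (s @ j # s')" and st: "set s \<subseteq> {j..<n}" "set s' \<subseteq> {j..<n}"
      using t ss by (auto simp: itin_def)
    have "j \<notin> set s'"
    proof
      assume "j \<in> set s'"
      then obtain k where k: "k < length s'" "s' ! k = j" by (auto simp: in_set_conv_nth)
      let ?l = "length s"
      obtain m where m: "?l < m" "m < Suc ?l + k" "(s @ j # s') ! m < (s @ j # s') ! ?l"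
        using v[unfolded valid_def, rule_format, of ?l "Suc ?l + k"] k by (auto simp: nth_append)
      then have "s' ! (m - Suc ?l) < j" by (auto simp: nth_append nth_Cons')
      moreover have "s' ! (m - Suc ?l) \<in> set s'" using m k by (intro nth_mem) linarith
      ultimately show False using st(2) by fastforce
    qed
    with ss(2) st have "set s \<subseteq> {Suc j..<n}" "set s' \<subseteq> {Suc j..<n}"
      by (auto simp: subset_iff Suc_le_eq) (metis le_neq_implies_less)+
    moreover have "valid s" "valid (j # s')" using valid_appendD[OF v] by auto
    moreover have "valid s'" using valid_appendD(2)[of "[j]" s'] \<open>valid (j # s')\<close> by simp
    ultimately show ?thesis using ss(1) by (auto simp: itin_def)
  qed
next
  fix t assume "t \<in> itin n (Suc j) \<union> (\<lambda>(s, s'). s @ j # s') ` (itin n (Suc j) \<times> itin n (Suc j))"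
  then consider "t \<in> itin n (Suc j)"
    | s s' where "t = s @ j # s'" "s \<in> itin n (Suc j)" "s' \<in> itin n (Suc j)" by auto
  then show "t \<in> itin n j"
  proof cases
    case 1
    then show ?thesis by (auto simp: itin_def subset_iff)
  next
    case 2
    have "valid (s @ j # s')"
      using 2 by (intro valid_join) (auto simp: itin_def)
    then show ?thesis using 2 assms by (auto simp: itin_def subset_iff)
  qed
qed

lemma itin_top: "itin n n = {[]}"
  by (auto simp: itin_def valid_def)

text \<open>Paths that avoid j plus pairs of paths into and out of j are the two summands of an
  elimination step.\<close>

lemma sum_itin:
  assumes "j \<le> n"
  shows "finite (itin n j) \<and> (\<forall>a b. (\<Sum>s\<in>itin n j. path_weight A b s a) = ent (eliminate n A (n - j)) a b)"
  using assms
proof (induction j rule: inc_induct)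
  case base
  show ?case by (simp add: itin_top)
next
  case (step j)
  let ?I = "itin n (Suc j)"
  let ?f = "\<lambda>(s, s'). s @ j # s'"
  have fin: "finite ?I" and IH: "\<And>a b. (\<Sum>s\<in>?I. path_weight A b s a) = ent (eliminate n A (n - Suc j)) a b"
    using step.IH by auto
  have split: "itin n j = ?I \<union> ?f ` (?I \<times> ?I)" using step.hyps by (intro itin_split) simp
  have j: "j \<notin> set s" if "s \<in> ?I" for s using that by (auto simp: itin_def)
  have inj: "inj_on ?f (?I \<times> ?I)"
    by (rule inj_onI) (use j in \<open>auto simp: append_Cons_eq_iff\<close>)
  have disj: "?I \<inter> ?f ` (?I \<times> ?I) = {}" using j by fastforce
  have "(\<Sum>s\<in>itin n j. path_weight A b s a) = ent (eliminate n A (n - j)) a b" for a b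
  proof -
    have "(\<Sum>s\<in>itin n j. path_weight A b s a) = (\<Sum>s\<in>?I. path_weight A b s a) + (\<Sum>s\<in>?f ` (?I \<times> ?I). path_weight A b s a)"
      unfolding split using fin by (intro sum.union_disjoint disj) auto
    also have "(\<Sum>s\<in>?f ` (?I \<times> ?I). path_weight A b s a) = (\<Sum>(s, s')\<in>?I \<times> ?I. path_weight A b s j * path_weight A j s' a)"
      by (subst sum.reindex[OF inj]) (auto intro!: sum.cong simp: path_weight_append)
    also have "\<dots> = (\<Sum>s\<in>?I. path_weight A b s j) * (\<Sum>s\<in>?I. path_weight A j s a)"
      by (simp add: sum_product sum.cartesian_product)
    finally have "(\<Sum>s\<in>itin n j. path_weight A b s a) = ent (eliminate n A (Suc (n - Suc j))) a b"
      using step.hyps by (simp add: IH ent_eliminate_Suc mult.commute del: eliminate.simps(2))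
    then show ?thesis using step.hyps by (simp add: Suc_diff_Suc)
  qed
  then show ?case using fin by (simp add: split)
qed

lemma prod_path: "(\<Prod>j\<le>length s. ent A ((b # s @ [a]) ! Suc j) ((b # s @ [a]) ! j)) = path_weight A b s a"
proof (induction s arbitrary: b)
  case (Cons c s)
  have "(\<Prod>j\<le>length (c # s). ent A ((b # (c # s) @ [a]) ! Suc j) ((b # (c # s) @ [a]) ! j))
      = ent A c b * (\<Prod>j\<le>length s. ent A ((c # s @ [a]) ! Suc j) ((c # s @ [a]) ! j))"
    unfolding list.size add_Suc_right add_0_right prod.atMost_Suc_shift
    by (simp only: append_Cons nth_Cons_Suc nth_Cons_0)
  then show ?case by (simp only: Cons path_weight.simps)
qed simp

subsection \<open>The derivative of the elimination\<close>

primrec eliminate_deriv :: "nat \<Rightarrow> rmat \<Rightarrow> rmat \<Rightarrow> nat \<Rightarrow> rmat" where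
  "eliminate_deriv n A A' 0 = A'"
| "eliminate_deriv n A A' (Suc m) = eliminate_deriv n A A' m + eliminate_deriv n A A' m * elem (n - Suc m) (n - Suc m) 1 * eliminate n A m
     + eliminate n A m * elem (n - Suc m) (n - Suc m) 1 * eliminate_deriv n A A' m"

lemma ent_sandwich: "ent (Y * elem k k c * Z) a b = ent Y a k * c * ent Z k b"
  unfolding mult.assoc by (subst ent_times_col[where J="{k}"]) (auto simp: ent_elem_times)

lemma mderiv_eliminate:
  assumes "mderiv F F'"
  shows "mderiv (\<lambda>s. eliminate n (F s) m) (eliminate_deriv n (F 0) F' m)"
proof (induction m)
  case 0
  show ?case using assms by simp
next
  case (Suc m)
  show ?case
    unfolding mderiv_def
    by (auto simp: ent_sandwich intro!: derivative_eq_intros mderivD[OF Suc])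
qed

text \<open>The correction to the naive derivative \<open>G dA H\<close> of \<open>G A H\<close> that is due to the variation \<open>p\<close> of the pivots.\<close>

primrec pivot_error :: "nat \<Rightarrow> rmat \<Rightarrow> (nat \<Rightarrow> complex) \<Rightarrow> nat \<Rightarrow> rmat" where
  "pivot_error n A p 0 = 0"
| "pivot_error n A p (Suc m) = (1 + eliminate n A m * elem (n - Suc m) (n - Suc m) 1) * pivot_error n A p m
     * (1 + elem (n - Suc m) (n - Suc m) 1 * eliminate n A m)
     + eliminate n A m * elem (n - Suc m) (n - Suc m) (p m) * eliminate n A m"

lemma pivot_error_cong: "(\<And>j. j < m \<Longrightarrow> p j = p' j) \<Longrightarrow> pivot_error n A p m = pivot_error n A p' m"
  by (induction m) auto

lemma pivot_error_zero: "(\<And>j. j < m \<Longrightarrow> p j = 0) \<Longrightarrow> pivot_error n A p m = 0"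
  by (induction m) auto

text \<open>With L the current matrix, d its derivative and E the pivot projection, (1 + L E) d (1 +
  E L) exceeds the derivative of the step by L E d E L; this excess is what
  \<open>pivot_error\<close> accumulates.\<close>

lemma eliminate_deriv_eq: "eliminate_deriv n A A' m = elim_left n A m * A' * elim_right n A m
    - pivot_error n A (\<lambda>j. ent (eliminate_deriv n A A' j) (n - Suc j) (n - Suc j)) m"
proof (induction m)
  case (Suc m)
  let ?E = "elem (n - Suc m) (n - Suc m) 1" and ?L = "eliminate n A m" and ?d = "eliminate_deriv n A A' m"
  let ?p = "\<lambda>j. ent (eliminate_deriv n A A' j) (n - Suc j) (n - Suc j)"
  \<comment> \<open>The excess sees only the variation of the pivot itself.\<close>
  have "?E * ?d * ?E = elem (n - Suc m) (n - Suc m) (?p m)"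
    by (rule rmat_eqI) (auto simp: ent_times_elem ent_elem_times ent_elem)
  then have "?L * elem (n - Suc m) (n - Suc m) (?p m) * ?L = ?L * ?E * ?d * ?E * ?L"
    by (simp add: mult.assoc)
  then have "eliminate_deriv n A A' (Suc m) = (1 + ?L * ?E) * ?d * (1 + ?E * ?L)
      - ?L * elem (n - Suc m) (n - Suc m) (?p m) * ?L"
    by (simp add: algebra_simps)
  also have "\<dots> = (1 + ?L * ?E) * (elim_left n A m * A' * elim_right n A m - pivot_error n A ?p m) * (1 + ?E * ?L)
      - ?L * elem (n - Suc m) (n - Suc m) (?p m) * ?L"
    using Suc by simp
  also have "\<dots> = elim_left n A (Suc m) * A' * elim_right n A (Suc m) - pivot_error n A ?p (Suc m)"
    by (simp add: algebra_simps)
  finally show ?case .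
qed simp

section \<open>The augmentation variety and its section\<close>

context braid_closure
begin

abbreviation "AV \<equiv> Aug n \<beta> M"

definition tau :: "(gen \<Rightarrow> complex) \<Rightarrow> nat \<Rightarrow> complex" where "tau p = marking M p"

definition dtau :: "(gen \<Rightarrow> complex) \<Rightarrow> nat \<Rightarrow> complex" where
  "dtau v k = (if k \<in> M then v (Marked k) else 0)"

abbreviation "zp p \<equiv> (\<lambda>i. p (Crossing i))"

definition Am :: "(gen \<Rightarrow> complex) \<Rightarrow> rmat" where
  "Am p = wprod \<beta> (zp p) (length \<beta>) * diagonal (tau p)"

definition dAm :: "(gen \<Rightarrow> complex) \<Rightarrow> (gen \<Rightarrow> complex) \<Rightarrow> rmat" where
  "dAm p v = wdiff \<beta> (zp p) (zp v) (length \<beta>) * diagonal (tau p) + wprod \<beta> (zp p) (length \<beta>) * diagonal (dtau v)"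

lemma idx_AV: "idx AV = Crossing ` {..<length \<beta>} \<union> Marked ` M" and invs_AV: "invs AV = Marked ` M"
  by (simp_all add: Aug_def)

lemma finite_M: "finite M"
  using M by (auto simp: cycle_transversal_def intro: finite_subset)

lemma fin_AV: "finite (idx AV)" "invs AV \<subseteq> idx AV"
  using finite_M by (auto simp: idx_AV invs_AV)

lemma tau_eq: "tau p k = (if k \<in> M then p (Marked k) else 1)"
  by (simp add: tau_def marking_def)

lemma tau_ge: "n \<le> k \<Longrightarrow> tau p k = 1"
  using M_less[of k] by (auto simp: tau_eq)

lemma unit_block_Am: "unit_block n (Am p)"
proof -
  have "unit_block n (diagonal (tau p))" by (auto simp: unit_block_def ent_diagonal tau_ge)
  then show ?thesis by (simp add: Am_def unit_block_wprod word)
qed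

text \<open>A disk word is the weight of a path from k back to k in P diag(tau), each marked point
  being absorbed into a column. Summing over itineraries performs the elimination of all strands
  inside k.\<close>

lemma cusp_eq:
  assumes "k < n"
  shows "cusp_differential n \<beta> M k p = 1 + ent (eliminate n (Am p) (n - Suc k)) k k"
proof -
  have ent_Am: "marking M p b * braid_mat n \<beta> (zp p) $$ (a, b) = ent (Am p) a b" if "a < n" "b < n" for a b
    using that by (simp add: Am_def braid_mat_eq[OF word] ent_times_diagonal tau_def)
  have "disk_word n \<beta> M p k s = path_weight (Am p) k s k" if "s \<in> itin n (Suc k)" for s
  proof -
    have lt: "(k # s @ [k]) ! j < n" if "j \<le> Suc (length s)" for j
    proof -
      have "(k # s @ [k]) ! j \<in> set (k # s @ [k])" using that by (intro nth_mem) simp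
      then show ?thesis using \<open>s \<in> itin n (Suc k)\<close> assms by (auto simp: itin_def)
    qed
    have "disk_word n \<beta> M p k s = (\<Prod>j\<le>length s. ent (Am p) ((k # s @ [k]) ! Suc j) ((k # s @ [k]) ! j))"
      unfolding disk_word_def Let_def by (intro prod.cong refl ent_Am lt) simp_all
    then show ?thesis by (simp only: prod_path)
  qed
  then have "(\<Sum>s\<in>itineraries n k. disk_word n \<beta> M p k s) = (\<Sum>s\<in>itin n (Suc k). path_weight (Am p) k s k)"
    unfolding itineraries_eq by simp
  then show ?thesis using sum_itin[of "Suc k" n] assms by (simp add: cusp_differential_def)
qed

lemma points_AV: "p \<in> points AV \<longleftrightarrow> p \<in> coord_space (idx AV) \<and> (\<forall>m\<in>M. p (Marked m) \<noteq> 0) \<and>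
    (\<forall>k<n. ent (eliminate n (Am p) (n - Suc k)) k k = - 1)"
proof -
  have "(\<forall>f\<in>eqs AV. f p = 0) \<longleftrightarrow> (\<forall>k<n. cusp_differential n \<beta> M k p = 0)"
    by (auto simp: Aug_def)
  also have "\<dots> \<longleftrightarrow> (\<forall>k<n. ent (eliminate n (Am p) (n - Suc k)) k k = - 1)"
    by (auto simp: cusp_eq add_eq_0_iff)
  finally show ?thesis by (auto simp: points_def invs_AV)
qed

lemma tau_nz: "p \<in> points AV \<Longrightarrow> tau p k \<noteq> 0"
  by (simp add: points_AV tau_eq)

lemma tau_line: "tau (\<lambda>i. p i + s * v i) k = tau p k + s * dtau v k"
  by (simp add: tau_eq dtau_def)

lemma mderiv_Am: "mderiv (\<lambda>s. Am (\<lambda>i. p i + s * v i)) (dAm p v)"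
  unfolding mderiv_def
proof (intro allI)
  fix a b
  note Y = mderivD[OF mderiv_wprod_line[of \<beta> "zp p" "zp v" "length \<beta>"], of a b]
  show "((\<lambda>s. ent (Am (\<lambda>i. p i + s * v i)) a b) has_field_derivative ent (dAm p v) a b) (at 0)"
    using DERIV_mult[OF Y line_deriv[of "tau p b" "dtau v b"]]
    by (simp add: Am_def dAm_def ent_times_diagonal tau_line mult.commute)
qed

section \<open>Differentials of the cusps\<close>

abbreviation dE :: "(gen \<Rightarrow> complex) \<Rightarrow> (gen \<Rightarrow> complex) \<Rightarrow> nat \<Rightarrow> rmat" where
  "dE p v m \<equiv> eliminate_deriv n (Am p) (dAm p v) m"

lemma mderiv_eliminate_Am: "mderiv (\<lambda>s. eliminate n (Am (\<lambda>i. p i + s * v i)) m) (dE p v m)"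
  using mderiv_eliminate[OF mderiv_Am[of p v], of n m] by simp

lemma dderiv_cusp: "k < n \<Longrightarrow> dderiv (cusp_differential n \<beta> M k) p v = ent (dE p v (n - Suc k)) k k"
  by (rule dderivI) (auto simp: cusp_eq intro!: derivative_eq_intros mderivD[OF mderiv_eliminate_Am])

lemma tangent_AV: "v \<in> tangent AV p \<longleftrightarrow>
    v \<in> coord_space (idx AV) \<and> (\<forall>k<n. ent (dE p v (n - Suc k)) k k = 0)"
proof -
  have "(\<forall>f\<in>eqs AV. dderiv f p v = 0) \<longleftrightarrow> (\<forall>k<n. dderiv (cusp_differential n \<beta> M k) p v = 0)"
    by (simp add: Aug_def) blast
  then show ?thesis by (simp add: tangent_def dderiv_cusp)
qed

text \<open>With T = diag(tau) and F the lower factor of A = P T, triangularity of A F makes P (T F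
  T^-1) triangular too, so T F T^-1 is the L that belongs to P. Its entries are the variables of the
  half twist.\<close>

definition sec :: "(gen \<Rightarrow> complex) \<Rightarrow> nat \<Rightarrow> complex" where
  "sec p j = (if j < length \<beta> then p (Crossing j)
     else if j < N then (case delta_entry n (j - length \<beta>) of (a, b) \<Rightarrow>
       tau p a * ent (lower_factor n (Am p)) a b * inverse (tau p b))
     else 0)"

lemma sec_crossing [simp]: "j < length \<beta> \<Longrightarrow> sec p j = p (Crossing j)"
  by (simp add: sec_def)

lemma sec_coord: "sec p \<in> coord_space {..<N}"
  by (simp add: coord_space_def sec_def)

lemma ent_Lm_sec:
  "b < a \<Longrightarrow> a < n \<Longrightarrow> ent (Lm (sec p)) a b = tau p a * ent (lower_factor n (Am p)) a b * inverse (tau p b)"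
  using delta_pos_less[of b a n] by (simp add: ent_Lm sec_def delta_entry_delta_pos)

lemma Pm_sec: "Pm (sec p) = wprod \<beta> (zp p) (length \<beta>)"
  unfolding Pm_def by (rule wprod_cong) simp

text \<open>Valid wherever tau_b is nonzero, not only on the augmentation variety; it can therefore
  be differentiated along lines that leave the variety.\<close>

lemma ent_Um_sec:
  assumes "b < n" "tau p b \<noteq> 0"
  shows "ent (Um (sec p)) a b = ent (eliminate n (Am p) (n - Suc b)) a b * inverse (tau p b)"
proof -
  have "ent (Lm (sec p)) j b = ent (diagonal (tau p) * lower_factor n (Am p) * diagonal (\<lambda>k. inverse (tau p k))) j b" for j
  proof -
    consider "j < b \<or> n \<le> j" | "j = b" | "b < j" "j < n" by linarith
    then show ?thesis
    proof cases
      case 1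
      then have "ent (lower_factor n (Am p)) j b = 0" using assms(1) by (subst ent_lower_factor_le) auto
      moreover have "ent (Lm (sec p)) j b = 0" using 1 assms(1) by (auto simp: Lm_def ent_lmat)
      ultimately show ?thesis by (simp add: ent_times_diagonal ent_diagonal_times)
    next
      case 2
      then show ?thesis using assms by (simp add: ent_times_diagonal ent_diagonal_times ent_lower_factor_le)
    next
      case 3
      then show ?thesis by (simp add: ent_times_diagonal ent_diagonal_times ent_Lm_sec)
    qed
  qed
  then have "ent (Um (sec p)) a b = ent (Pm (sec p) * (diagonal (tau p) * lower_factor n (Am p) * diagonal (\<lambda>k. inverse (tau p k)))) a b"
    unfolding Um_eq by (rule ent_times_cong_col)
  also have "\<dots> = ent (Am p * lower_factor n (Am p) * diagonal (\<lambda>k. inverse (tau p k))) a b"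
    by (simp add: Am_def Pm_sec mult.assoc)
  also have "\<dots> = ent (eliminate n (Am p) (n - Suc b)) a b * inverse (tau p b)"
    using assms by (simp add: ent_times_diagonal ent_times_lower_factor)
  finally show ?thesis .
qed

lemma eliminate_zero_points:
  "p \<in> points AV \<Longrightarrow> b < a \<Longrightarrow> a < n \<Longrightarrow> ent (eliminate n (Am p) (n - Suc b)) a c = 0"
  by (rule eliminate_rows_zero) (auto simp: points_AV)

lemma Um_sec_upper:
  assumes p: "p \<in> points AV" shows "upper (Um (sec p))"
  unfolding upper_def
proof (intro allI impI)
  fix a b :: nat assume "b < a"
  show "ent (Um (sec p)) a b = 0"
  proof (cases "a < n")
    case True
    then show ?thesis
      using \<open>b < a\<close> by (simp add: ent_Um_sec tau_nz[OF p] eliminate_zero_points[OF p])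
  next
    case False
    then show ?thesis using unit_block_Um[of "sec p"] \<open>b < a\<close> by (auto simp: unit_block_def)
  qed
qed

lemma sec_points: "p \<in> points AV \<Longrightarrow> sec p \<in> points X"
  by (simp add: points_X sec_coord Um_sec_upper)

text \<open>\<open>x\<close> is the point of the slice \<open>U\<^sub>k\<^sub>k = - 1 / \<tau>\<^sub>k\<close> of the braid variety that belongs to \<open>p\<close>.\<close>

definition compat :: "(gen \<Rightarrow> complex) \<Rightarrow> (nat \<Rightarrow> complex) \<Rightarrow> bool" where
  "compat p x \<longleftrightarrow> x \<in> points X \<and> (\<forall>j<length \<beta>. x j = p (Crossing j)) \<and>
     (\<forall>m\<in>M. p (Marked m) \<noteq> 0) \<and> (\<forall>k<n. ent (Um x) k k = - inverse (tau p k))"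

lemma compat_sec: "p \<in> points AV \<Longrightarrow> compat p (sec p)"
  using sec_points[of p] by (auto simp: compat_def points_AV ent_Um_sec tau_eq)

text \<open>T^-1 L T with T = diag(tau), chosen so that U T = A (T^-1 L T).\<close>

definition slice_lower :: "(gen \<Rightarrow> complex) \<Rightarrow> (nat \<Rightarrow> complex) \<Rightarrow> rmat" where
  "slice_lower p x = diagonal (\<lambda>k. inverse (tau p k)) * Lm x * diagonal (tau p)"

definition slice_lower_inv :: "(gen \<Rightarrow> complex) \<Rightarrow> (nat \<Rightarrow> complex) \<Rightarrow> rmat" where
  "slice_lower_inv p x = diagonal (\<lambda>k. inverse (tau p k)) * Li x * diagonal (tau p)"

lemma compat_tau: "compat p x \<Longrightarrow> tau p k \<noteq> 0"
  by (auto simp: compat_def tau_eq)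

lemma diagonal_tau_inv:
  assumes "\<And>k. tau p k \<noteq> 0"
  shows "diagonal (tau p) * (diagonal (\<lambda>k. inverse (tau p k)) * Y) = Y"
    "diagonal (\<lambda>k. inverse (tau p k)) * (diagonal (tau p) * Y) = Y"
    "diagonal (tau p) * diagonal (\<lambda>k. inverse (tau p k)) = 1"
    "diagonal (\<lambda>k. inverse (tau p k)) * diagonal (tau p) = 1"
  using diagonal_inverse[of "tau p", OF assms] by (simp_all flip: mult.assoc)

lemma slice_lower_slice_lower_inv:
  assumes "compat p x" shows "slice_lower p x * slice_lower_inv p x = 1"
proof -
  have "Lm x * (Li x * Y) = Y" for Y by (simp flip: mult.assoc)
  then show ?thesis by (simp add: slice_lower_def slice_lower_inv_def mult.assoc diagonal_tau_inv[OF compat_tau[OF assms]])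
qed

lemma Am_slice_lower:
  assumes "compat p x" shows "Am p * slice_lower p x = Um x * diagonal (tau p)"
proof -
  have "Pm x = wprod \<beta> (zp p) (length \<beta>)"
    unfolding Pm_def using assms by (intro wprod_cong) (auto simp: compat_def)
  then show ?thesis by (simp add: Am_def slice_lower_def Um_eq mult.assoc diagonal_tau_inv[OF compat_tau[OF assms]])
qed

lemma unit_block_slice_lower_inv:
  assumes "n \<le> c" "b < n" shows "ent (slice_lower_inv p x) c b = 0"
proof -
  have "unit_block n (Li x)" by (simp add: Li_def)
  then show ?thesis using assms by (auto simp: slice_lower_inv_def ent_times_diagonal ent_diagonal_times unit_block_def)
qed

text \<open>Induction on m: the first n - m columns are still those of U T, the others are already
  wiped out. Multiplying back by the lower triangular inverse exposes the next pivot column; its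
  pivot is -1 by compatibility, so the step cancels this column and changes no column before
  it.\<close>

lemma eliminate_times_slice_lower:
  assumes c: "compat p x" and "m \<le> n" "a < n" "b < n"
  shows "ent (eliminate n (Am p) m * slice_lower p x) a b = (if b < n - m then ent (Um x * diagonal (tau p)) a b else 0)"
    and "m < n \<Longrightarrow> n - Suc m \<le> b \<Longrightarrow> ent (eliminate n (Am p) m) a b
      = (if b = n - Suc m then ent (Um x * diagonal (tau p)) a b else 0)"
proof -
  let ?H = "slice_lower p x" and ?U = "Um x * diagonal (tau p)"
  have U: "upper ?U" using c by (simp add: compat_def points_X)
  have Ukk: "ent ?U k k = - 1" if "k < n" for k
    using c compat_tau[OF c, of k] that by (simp add: compat_def ent_times_diagonal)
  have low: "lower (slice_lower_inv p x)" and dia: "ent (slice_lower_inv p x) k k = 1" for k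
    using compat_tau[OF c, of k] by (simp_all add: slice_lower_inv_def ent_times_diagonal ent_diagonal_times)
  have solve: "ent (eliminate n (Am p) m) a b = (if b = n - Suc m then ent ?U a b else 0)"
    if IH: "\<And>b. b < n \<Longrightarrow> ent (eliminate n (Am p) m * ?H) a b = (if b < n - m then ent ?U a b else 0)"
      and mb: "m < n" "b < n" "n - Suc m \<le> b" for m a b
  proof -
    have "ent (eliminate n (Am p) m) a b = ent (eliminate n (Am p) m * ?H * slice_lower_inv p x) a b"
      by (simp add: mult.assoc slice_lower_slice_lower_inv[OF c])
    also have "\<dots> = (\<Sum>j\<in>{b..<n}. ent (eliminate n (Am p) m * ?H) a j * ent (slice_lower_inv p x) j b)"
    proof (rule ent_times_col)
      fix j assume "j \<notin> {b..<n}"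
      then show "ent (slice_lower_inv p x) j b = 0"
        using lowerD[OF low, of j b] unit_block_slice_lower_inv[of j b] mb(2) by (cases "j < b") auto
    qed simp
    also have "\<dots> = (\<Sum>j\<in>{b}. ent (eliminate n (Am p) m * ?H) a j * ent (slice_lower_inv p x) j b)"
      using mb IH by (intro sum.mono_neutral_right) auto
    also have "\<dots> = (if b = n - Suc m then ent ?U a b else 0)"
      using mb IH[of b] by (auto simp: dia)
    finally show ?thesis .
  qed
  have main: "\<forall>a<n. \<forall>b<n. ent (eliminate n (Am p) m * ?H) a b = (if b < n - m then ent ?U a b else 0)"
    if "m \<le> n" for m
    using that
  proof (induction m)
    case 0
    then show ?case by (simp add: Am_slice_lower[OF c])
  next
    case (Suc m)
    let ?k = "n - Suc m"
    have IH: "ent (eliminate n (Am p) m * ?H) a b = (if b < n - m then ent ?U a b else 0)" if "a < n" "b < n" for a b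
      using Suc that by simp
    show ?case
    proof (intro allI impI)
      fix a b assume ab: "a < n" "b < n"
      have k: "?k < n" using Suc.prems by simp
      have eq: "eliminate n (Am p) (Suc m) * ?H
          = eliminate n (Am p) m * ?H + eliminate n (Am p) m * elem ?k ?k 1 * (eliminate n (Am p) m * ?H)"
        by (simp add: distrib_right mult.assoc)
      have piv: "ent (eliminate n (Am p) m) a ?k = ent ?U a ?k"
        using solve[OF IH[OF ab(1)]] Suc.prems k by simp
      have "ent (eliminate n (Am p) (Suc m) * ?H) a b = ent (eliminate n (Am p) m * ?H) a b
          + ent ?U a ?k * ent (eliminate n (Am p) m * ?H) ?k b"
        unfolding eq ent_add ent_sandwich piv by simp
      also have "\<dots> = (if b < n - Suc m then ent ?U a b else 0)"
        using Suc.prems ab k IH[OF ab] IH[OF k ab(2)] Ukk[OF k] upperD[OF U, of b ?k]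
        by (cases "b = ?k") auto
      finally show "ent (eliminate n (Am p) (Suc m) * ?H) a b = (if b < n - Suc m then ent ?U a b else 0)" .
    qed
  qed
  show "ent (eliminate n (Am p) m * ?H) a b = (if b < n - m then ent ?U a b else 0)"
    using main assms by simp
  show "ent (eliminate n (Am p) m) a b = (if b = n - Suc m then ent ?U a b else 0)"
    if "m < n" "n - Suc m \<le> b"
    using main[of m] assms that by (intro solve) auto
qed

lemma compat_points:
  assumes c: "compat p x" and p: "p \<in> coord_space (idx AV)"
  shows "p \<in> points AV"
  unfolding points_AV
proof (intro conjI ballI allI impI p)
  fix k assume k: "k < n"
  show "ent (eliminate n (Am p) (n - Suc k)) k k = - 1"
    using eliminate_times_slice_lower(2)[OF c, of "n - Suc k" k k] k c compat_tau[OF c, of k]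
    by (simp add: ent_times_diagonal compat_def)
qed (use c in \<open>auto simp: compat_def\<close>)

lemma compat_unique: "compat p x \<Longrightarrow> p \<in> points AV \<Longrightarrow> x = sec p"
  by (rule points_X_eqI) (auto simp: compat_def sec_points)

subsection \<open>Tangent vectors\<close>

text \<open>At this stage row k of G U T has the single entry -1, in column k: columns to the right
  are wiped out and those to the left vanish by triangularity. So row k of G is minus row k of (U
  T)^-1.\<close>

lemma elim_left_row:
  assumes p: "p \<in> points AV" and k: "k < n"
  shows "ent (elim_left n (Am p) (n - Suc k) * Y) k c
    = - ent (diagonal (\<lambda>k. inverse (tau p k)) * Ui (sec p) * Y) k c"
proof -
  let ?U = "Um (sec p) * diagonal (tau p)" and ?V = "diagonal (\<lambda>k. inverse (tau p k)) * Ui (sec p)"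
  let ?m = "n - Suc k"
  note c = compat_sec[OF p]
  have UV: "?U * ?V = 1"
    by (simp add: mult.assoc diagonal_tau_inv[OF tau_nz[OF p]])
  have GU: "elim_left n (Am p) ?m * ?U = eliminate n (Am p) ?m * slice_lower p (sec p)"
    by (simp add: Am_slice_lower[OF c, symmetric] mult.assoc[symmetric] elim_left_times)
  have upU: "upper ?U" by (simp add: Um_sec_upper[OF p])
  have row: "ent (elim_left n (Am p) ?m * ?U) k b = - ent 1 k b" for b
  proof (cases "b < n")
    case True
    then show ?thesis
      using eliminate_times_slice_lower(1)[OF c, of ?m k b] k c compat_tau[OF c, of k] upperD[OF upU, of b k]
      by (auto simp: GU ent_one ent_times_diagonal compat_def)
  next
    case False
    have "unit_block n (slice_lower p (sec p))"
      unfolding slice_lower_def unit_block_def by (auto simp: ent_times_diagonal ent_diagonal_times tau_ge Lm_def ent_lmat)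
    then have "unit_block n (eliminate n (Am p) ?m * slice_lower p (sec p))" by (simp add: unit_block_eliminate unit_block_Am)
    then show ?thesis using False k by (auto simp: GU unit_block_def ent_one)
  qed
  have "ent (elim_left n (Am p) ?m * Y) k c = ent (elim_left n (Am p) ?m * ?U * (?V * Y)) k c"
    using UV by (metis mult.assoc mult_1)
  also have "\<dots> = (\<Sum>j\<in>{k}. ent (elim_left n (Am p) ?m * ?U) k j * ent (?V * Y) j c)"
    by (rule ent_times) (auto simp: row ent_one)
  also have "\<dots> = - ent (?V * Y) k c" by (simp add: row ent_one)
  finally show ?thesis .
qed

text \<open>Rows whose pivot has been processed are zero in G A, hence in G U T, hence in G because
  U T is invertible.\<close>

lemma elim_left_row_zero:
  assumes p: "p \<in> points AV" and ab: "b < a" "a < n"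
  shows "ent (elim_left n (Am p) (n - Suc b) * Y) a c = 0"
proof -
  let ?U = "Um (sec p) * diagonal (tau p)" and ?V = "diagonal (\<lambda>k. inverse (tau p k)) * Ui (sec p)"
  let ?m = "n - Suc b"
  note c = compat_sec[OF p]
  have UV: "?U * ?V = 1"
    by (simp add: mult.assoc diagonal_tau_inv[OF tau_nz[OF p]])
  have "ent (elim_left n (Am p) ?m * ?U) a j = 0" for j
  proof -
    have "elim_left n (Am p) ?m * ?U = eliminate n (Am p) ?m * slice_lower p (sec p)"
      by (simp add: Am_slice_lower[OF c, symmetric] mult.assoc[symmetric] elim_left_times)
    moreover have "ent (eliminate n (Am p) ?m * slice_lower p (sec p)) a j = 0"
      unfolding ent_times_raw using eliminate_zero_points[OF p ab] by simp
    ultimately show ?thesis by simp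
  qed
  moreover have "ent (elim_left n (Am p) ?m * Y) a c = ent (elim_left n (Am p) ?m * ?U * (?V * Y)) a c"
    using UV by (metis mult.assoc mult_1)
  ultimately show ?thesis by (simp add: ent_times_raw)
qed

text \<open>The variation of log (U_kk tau_k), a product that is constantly -1 on the slice.\<close>

definition pivot :: "(gen \<Rightarrow> complex) \<Rightarrow> (gen \<Rightarrow> complex) \<Rightarrow> nat \<Rightarrow> complex" where
  "pivot p v k = ups (sec p) (zp v) k + dtau v k / tau p k"

text \<open>The first variation of pivot k with the elimination held fixed. Row k of G is known from
  \<open>elim_left_row\<close>, and column k of H is that of T^-1 L T; conjugation by L preserves
  the diagonal of the part that varies tau.\<close>

lemma pivot_eq:
  assumes p: "p \<in> points AV" and k: "k < n"
  shows "ent (elim_left n (Am p) (n - Suc k) * dAm p v * elim_right n (Am p) (n - Suc k)) k k = - pivot p v k"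
proof -
  let ?x = "sec p" and ?T = "diagonal (tau p)" and ?Ti = "diagonal (\<lambda>k. inverse (tau p k))"
  let ?m = "n - Suc k"
  note c = compat_sec[OF p] and nz = tau_nz[OF p]
  have H: "ent (elim_right n (Am p) ?m) j k = ent (slice_lower p ?x) j k" for j
  proof -
    have "ent (elim_right n (Am p) ?m) j k = ent (lower_factor n (Am p)) j k" using k by (simp add: ent_lower_factor)
    also have "\<dots> = ent (slice_lower p ?x) j k"
    proof -
      consider "j < k \<or> n \<le> j" | "j = k" | "k < j" "j < n" by linarith
      then show ?thesis
      proof cases
        case 1
        then have "ent (lower_factor n (Am p)) j k = 0" using k by (subst ent_lower_factor_le) auto
        moreover have "ent (Lm ?x) j k = 0" using 1 k by (auto simp: Lm_def ent_lmat)
        ultimately show ?thesis by (simp add: slice_lower_def ent_times_diagonal ent_diagonal_times)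
      next
        case 2
        then show ?thesis using nz[of k] by (simp add: slice_lower_def ent_times_diagonal ent_diagonal_times ent_lower_factor_le)
      next
        case 3
        then show ?thesis using nz[of j] nz[of k]
          by (simp add: slice_lower_def ent_times_diagonal ent_diagonal_times ent_Lm_sec field_simps)
      qed
    qed
    finally show ?thesis .
  qed
  have dPx: "dP ?x (zp v) = wdiff \<beta> (zp p) (zp v) (length \<beta>)"
    unfolding dP_def by (rule wdiff_cong) simp
  have Li: "Ui ?x * (wprod \<beta> (zp p) (length \<beta>) * Y) = Li ?x * Y" for Y
    by (simp add: Li_def Pm_sec mult.assoc)
  have "ent (elim_left n (Am p) ?m * dAm p v * elim_right n (Am p) ?m) k k
      = ent (elim_left n (Am p) ?m * (dAm p v * slice_lower p ?x)) k k"
    unfolding mult.assoc[symmetric] by (rule ent_times_cong_col[OF H])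
  also have "\<dots> = - ent (?Ti * Ui ?x * (dAm p v * slice_lower p ?x)) k k" by (rule elim_left_row[OF p k])
  also have "?Ti * Ui ?x * (dAm p v * slice_lower p ?x) = ?Ti * (Ui ?x * (dP ?x (zp v) * Lm ?x)) * ?T
      + ?Ti * (Li ?x * (diagonal (dtau v) * ?Ti * Lm ?x)) * ?T"
    by (simp add: dAm_def slice_lower_def distrib_left distrib_right mult.assoc diagonal_tau_inv[OF nz] dPx Li)
  also have "ent \<dots> k k = ups ?x (zp v) k + ent (Li ?x * (diagonal (dtau v) * ?Ti * Lm ?x)) k k"
    using nz[of k] by (simp add: ent_times_diagonal ent_diagonal_times ups_eq_dP) (simp add: field_simps)
  also have "ent (Li ?x * (diagonal (dtau v) * ?Ti * Lm ?x)) k k = dtau v k / tau p k"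
    by (simp add: ent_lower_times_diag ent_diagonal divide_inverse)
  finally show ?thesis by (simp add: pivot_def)
qed

lemma dE_pivot:
  assumes p: "p \<in> points AV" and k: "k < n"
  shows "ent (dE p v (n - Suc k)) k k = - pivot p v k
    - ent (pivot_error n (Am p) (\<lambda>j. ent (dE p v j) (n - Suc j) (n - Suc j)) (n - Suc k)) k k"
  unfolding eliminate_deriv_eq[of n "Am p" "dAm p v" "n - Suc k"] ent_minus pivot_eq[OF p k] ..

text \<open>The error in the variation of a pivot involves only pivots treated earlier, so the two
  systems of equations are equivalent by induction along the elimination.\<close>

lemma tangent_AV_pivot:
  assumes p: "p \<in> points AV"
  shows "v \<in> tangent AV p \<longleftrightarrow> v \<in> coord_space (idx AV) \<and> (\<forall>k<n. pivot p v k = 0)"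
proof -
  let ?q = "\<lambda>j. ent (dE p v j) (n - Suc j) (n - Suc j)"
  have eq: "?q m = - pivot p v (n - Suc m) - ent (pivot_error n (Am p) ?q m) (n - Suc m) (n - Suc m)" if "m < n" for m
    using dE_pivot[OF p, of "n - Suc m" v] that by simp
  have "(\<forall>k<n. ent (dE p v (n - Suc k)) k k = 0) \<longleftrightarrow> (\<forall>m<n. ?q m = 0)"
  proof (intro iffI allI impI)
    fix k assume "\<forall>m<n. ?q m = 0" "k < n"
    then show "ent (dE p v (n - Suc k)) k k = 0" by (auto dest!: spec[of _ "n - Suc k"])
  next
    fix m assume "\<forall>k<n. ent (dE p v (n - Suc k)) k k = 0" "m < n"
    then show "?q m = 0" by (auto dest!: spec[of _ "n - Suc m"])
  qed
  also have "\<dots> \<longleftrightarrow> (\<forall>k<n. pivot p v k = 0)"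
  proof
    assume q: "\<forall>m<n. ?q m = 0"
    show "\<forall>k<n. pivot p v k = 0"
    proof (intro allI impI)
      fix k assume k: "k < n"
      have "pivot_error n (Am p) ?q (n - Suc k) = 0" using q by (intro pivot_error_zero) auto
      then show "pivot p v k = 0" using eq[of "n - Suc k"] q[rule_format, of "n - Suc k"] k by simp
    qed
  next
    assume pv: "\<forall>k<n. pivot p v k = 0"
    show "\<forall>m<n. ?q m = 0"
    proof (intro allI impI)
      fix m assume "m < n"
      then show "?q m = 0"
      proof (induction m rule: less_induct)
        case (less m)
        then have "pivot_error n (Am p) ?q m = 0" by (intro pivot_error_zero) auto
        then show ?case using eq[of m] pv less.prems by simp
      qed
    qed
  qed
  finally show ?thesis by (simp add: tangent_AV)
qed

section \<open>Regularity and differential of the section\<close>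

lemma regular_tau: "(\<lambda>p. tau p k) \<in> regular AV" "(\<lambda>p. inverse (tau p k)) \<in> regular AV"
  by (cases "k \<in> M"; simp add: tau_eq; intro regular.intros; simp add: idx_AV invs_AV)+

lemma regular_Am: "(\<lambda>p. ent (Am p) a b) \<in> regular AV"
  unfolding Am_def ent_times_diagonal
  by (intro regular.mult regular_tau regular_wprod regular.coord) (simp add: idx_AV)

lemma regular_eliminate: "(\<lambda>p. ent (eliminate n (Am p) m) a b) \<in> regular AV"
  by (induction m arbitrary: a b) (auto simp: regular_Am ent_sandwich intro!: regular.intros)

lemma regular_elim_right: "(\<lambda>p. ent (elim_right n (Am p) m) a b) \<in> regular AV"
  by (induction m arbitrary: a b)
    (auto simp: regular.const ent_one ent_elim_right_Suc simp del: elim_right.simps(2) intro!: regular.intros regular_eliminate)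

lemma regular_sec: "(\<lambda>p. sec p j) \<in> regular AV"
proof (cases "j < length \<beta>")
  case True
  then show ?thesis by (auto simp: idx_AV intro!: regular.coord)
next
  case False
  obtain a b where ab: "delta_entry n (j - length \<beta>) = (a, b)" by fastforce
  have "(\<lambda>p. ent (lower_factor n (Am p)) a b) \<in> regular AV"
    by (cases "b < n") (simp_all add: ent_lower_factor regular_elim_right regular.const)
  then show ?thesis using False
    by (cases "j < N") (auto simp: sec_def ab intro!: regular.const regular.mult regular_tau)
qed

lemma dsec_crossing: "j < length \<beta> \<Longrightarrow> dmap sec p v j = v (Crossing j)"
  by (simp add: dmap_def)

lemma inv_coords_nz: "p \<in> points AV \<Longrightarrow> j \<in> invs AV \<Longrightarrow> p j \<noteq> 0"
  by (auto simp: points_def)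

text \<open>The line p + s u leaves the variety, so vanishing of the lower entries of U along it
  cannot be used. Instead the explicit formula for these entries is differentiated at s = 0.\<close>

lemma dsec_tangent:
  assumes p: "p \<in> points AV" and u: "u \<in> tangent AV p"
  shows "dmap sec p u \<in> tangent X (sec p)"
  unfolding tangent_X
proof
  show "dmap sec p u \<in> coord_space {..<N}"
    by (simp add: coord_space_def dmap_def sec_def)
  let ?\<gamma> = "\<lambda>s. sec (\<lambda>i. p i + s * u i)"
  have "mderiv (\<lambda>s. wprod \<eta> (?\<gamma> s) N) (wdiff \<eta> (?\<gamma> 0) (dmap sec p u) N)"
    unfolding dmap_def by (rule mderiv_wprod) (rule regular_line[OF regular_sec inv_coords_nz[OF p]])
  then have dU: "mderiv (\<lambda>s. Um (?\<gamma> s)) (dU (sec p) (dmap sec p u))"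
    by (simp add: mderiv_def Um_def dU_def ent_times_pmat)
  show "upper (dU (sec p) (dmap sec p u))"
    unfolding upper_def
  proof (intro allI impI)
    fix a b :: nat assume ba: "b < a"
    show "ent (dU (sec p) (dmap sec p u)) a b = 0"
    proof (cases "a < n")
      case True
      let ?t = "\<lambda>s. tau (\<lambda>i. p i + s * u i) b"
      have t: "?t s = tau p b + s * dtau u b" for s by (rule tau_line)
      \<comment> \<open>The formula requires tau_b to be nonzero, which holds for small s.\<close>
      have "open {s. tau p b + s * dtau u b \<noteq> 0}"
        by (intro open_Collect_neq continuous_intros)
      then have "\<forall>\<^sub>F s in nhds 0. s \<in> {s. tau p b + s * dtau u b \<noteq> 0}"
        using tau_nz[OF p] by (intro eventually_nhds_in_open) auto
      then have ev: "\<forall>\<^sub>F s in nhds 0. ?t s \<noteq> 0" by (simp add: t)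
      let ?E = "\<lambda>s. ent (eliminate n (Am (\<lambda>i. p i + s * u i)) (n - Suc b)) a b"
      have E0: "?E 0 = 0" using eliminate_zero_points[OF p ba True] by simp
      \<comment> \<open>Tangency kills all pivot errors, and what remains of the derivative is
        multiplied from the left by a vanishing row.\<close>
      have dE0: "ent (dE p u (n - Suc b)) a b = 0"
      proof -
        have "pivot_error n (Am p) (\<lambda>j. ent (dE p u j) (n - Suc j) (n - Suc j)) (n - Suc b) = 0"
        proof (rule pivot_error_zero)
          fix j assume "j < n - Suc b"
          then have "n - Suc j < n" and j: "n - Suc (n - Suc j) = j" by auto
          then have "ent (dE p u (n - Suc (n - Suc j))) (n - Suc j) (n - Suc j) = 0"
            using u unfolding tangent_AV by blast
          then show "ent (dE p u j) (n - Suc j) (n - Suc j) = 0" by (simp only: j)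
        qed
        then show ?thesis
          unfolding eliminate_deriv_eq[of n "Am p" "dAm p u" "n - Suc b"] mult.assoc
          by (simp add: elim_left_row_zero[OF p ba True])
      qed
      have "((\<lambda>s. inverse (tau p b + s * dtau u b)) has_field_derivative
          - (inverse (tau p b) * dtau u b * inverse (tau p b))) (at 0)"
        using DERIV_inverse'[OF line_deriv[of "tau p b" "dtau u b"]] tau_nz[OF p] by simp
      from DERIV_mult[OF mderivD[OF mderiv_eliminate_Am[of p u "n - Suc b"], of a b] this]
      have D: "((\<lambda>s. ?E s * inverse (?t s)) has_field_derivative 0) (at 0)"
        using E0 by (simp add: t dE0)
      have eq: "\<forall>\<^sub>F s in nhds 0. ent (Um (?\<gamma> s)) a b = ?E s * inverse (?t s)"
        using ev by (rule eventually_mono) (rule ent_Um_sec[OF less_trans[OF ba True]])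
      have "((\<lambda>s. ent (Um (?\<gamma> s)) a b) has_field_derivative 0) (at 0)
          \<longleftrightarrow> ((\<lambda>s. ?E s * inverse (?t s)) has_field_derivative 0) (at 0)"
        by (rule DERIV_cong_ev[OF refl eq refl])
      with D have "((\<lambda>s. ent (Um (?\<gamma> s)) a b) has_field_derivative 0) (at 0)" by simp
      from DERIV_unique[OF mderivD[OF dU] this] show ?thesis .
    next
      case False
      then show ?thesis using zero_block_dU[of "sec p" "dmap sec p u"] by (simp add: zero_block_def)
    qed
  qed
qed

lemma ups_dsec:
  assumes p: "p \<in> points AV" and u: "u \<in> tangent AV p" and k: "k < n"
  shows "ups (sec p) (dmap sec p u) k = - dtau u k / tau p k"
proof -
  have "ups (sec p) (dmap sec p u) k = ups (sec p) (zp u) k"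
    by (rule ups_cong) (simp add: dsec_crossing)
  then show ?thesis
    using u k unfolding tangent_AV_pivot[OF p] pivot_def by (simp add: eq_neg_iff_add_eq_0)
qed

text \<open>The inverse of the differential of \<open>sec\<close> on vectors tangent to the slice;
  the marked coordinate comes from differentiating tau_m U_mm = -1.\<close>

definition lower_tangent :: "(gen \<Rightarrow> complex) \<Rightarrow> (nat \<Rightarrow> complex) \<Rightarrow> gen \<Rightarrow> complex" where
  "lower_tangent p v g = (case g of
     Crossing j \<Rightarrow> if j < length \<beta> then v j else 0
   | Marked m \<Rightarrow> if m \<in> M then - tau p m * ups (sec p) v m else 0)"

lemma lower_tangent:
  assumes p: "p \<in> points AV" and v: "v \<in> tangent X (sec p)"
    and off: "\<And>k. k < n \<Longrightarrow> k \<notin> M \<Longrightarrow> ups (sec p) v k = 0"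
  shows "lower_tangent p v \<in> tangent AV p" "dmap sec p (lower_tangent p v) = v"
proof -
  let ?u = "lower_tangent p v"
  have ups: "ups (sec p) (zp ?u) k = ups (sec p) v k" for k
    by (rule ups_cong) (simp add: lower_tangent_def)
  have "pivot p ?u k = 0" if "k < n" for k
    using off[OF that] tau_nz[OF p, of k] unfolding pivot_def ups by (auto simp: dtau_def lower_tangent_def)
  moreover have "?u \<in> coord_space (idx AV)"
    by (auto simp: coord_space_def idx_AV lower_tangent_def image_iff split: gen.splits)
  ultimately show t: "?u \<in> tangent AV p" by (simp add: tangent_AV_pivot[OF p])
  show "dmap sec p ?u = v"
    by (rule tangent_X_eqI[OF sec_points[OF p] dsec_tangent[OF p t] v])
      (simp add: dsec_crossing lower_tangent_def)
qed

end

section \<open>The symplectic form\<close>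

context braid_closure
begin

lemma wlogr_eta: "wlogr \<eta> x v N = dU x v * Ui x"
  by (simp add: wlogr_def dU_def Ui_def mult.assoc)

lemma upper_wlogr: "x \<in> points X \<Longrightarrow> v \<in> tangent X x \<Longrightarrow> upper (wlogr \<eta> x v N)"
  unfolding wlogr_eta by (intro upper_times upper_Ui) (simp_all add: points_X tangent_X)

lemma wlogr_diag:
  "x \<in> points X \<Longrightarrow> v \<in> tangent X x \<Longrightarrow> ent (wlogr \<eta> x v N) k k = ups x v k"
  by (simp add: wlogr_eta ups_def ent_upper_times_diag upper_Ui points_X tangent_X)

text \<open>Comparison of the coefficients of v_k. The hypothesis ranges over all of coordinate
  space, which is what the multipliers are introduced for.\<close>

lemma critical_from_trace:
  assumes "\<And>v. v \<in> coord_space {..<N} \<Longrightarrow> tr n (S * wlogr \<eta> x v N)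
    = 2 * (\<Sum>k<N. v k * ent (wlog \<eta> x u k) (\<eta> ! k) (\<eta> ! k + 1))"
    and k: "k < N"
  shows "ent (prop_mat \<eta> x u S k) (\<eta> ! k) (\<eta> ! k + 1) = 0"
proof -
  have pick: "(\<Sum>j<N. (if j = k then 1 else 0) * f j) = f k" for f :: "nat \<Rightarrow> complex"
    using k by (simp add: if_distrib[of "\<lambda>x. x * _"] sum.delta cong: if_cong)
  have "coord_vec k \<in> coord_space {..<N}" using k by (auto simp: coord_space_def)
  from assms(1)[OF this] tr_wlogr[OF eta, of N S x "coord_vec k"]
  have "ent (winv \<eta> x k * S * wprod \<eta> x k) (\<eta> ! k) (\<eta> ! k + 1)
      = 2 * ent (wlog \<eta> x u k) (\<eta> ! k) (\<eta> ! k + 1)"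
    by (simp only: pick length_append order_refl)
  then show ?thesis by (simp add: prop_mat_def)
qed

text \<open>Cyclicity: tr (U Lambda U^-1 dU U^-1) = tr (Lambda U^-1 dU). A relation between the
  \<open>ups\<close> becomes a pairing with an upper triangular matrix.\<close>

lemma tr_conj_diag:
  assumes "\<And>k. n \<le> k \<Longrightarrow> l k = 0"
  shows "tr n (Um x * diagonal l * Ui x * wlogr \<eta> x v N) = (\<Sum>k<n. l k * ups x v k)"
proof -
  let ?Z = "diagonal l * Ui x * dU x v * Ui x"
  have "zero_block n (diagonal l)" using assms by (auto simp: zero_block_def ent_diagonal)
  then have "zero_block n ?Z" by simp
  then have "tr n (?Z * Um x) = tr n (Um x * ?Z)" by (rule tr_commute)
  then show ?thesis by (simp add: wlogr_eta mult.assoc tr_def ent_diagonal_times ups_def)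
qed

lemma pivot_independent:
  assumes p: "p \<in> points AV" and l: "\<And>v. v \<in> coord_space (idx AV) \<Longrightarrow> (\<Sum>k<n. l k * pivot p v k) = 0"
    and k: "k < n"
  shows "l k = 0"
proof -
  let ?x = "sec p"
  note x = sec_points[OF p]
  have U: "upper (Um ?x)" using x by (simp add: points_X)
  \<comment> \<open>Varying the marked point m alone changes the pivot m and no other.\<close>
  have lM: "l m = 0" if m: "m \<in> M" for m
  proof -
    let ?v = "\<lambda>g. if g = Marked m then 1 else (0 :: complex)"
    have "ups ?x (zp ?v) j = 0" for j by (simp add: ups_def dU_def)
    then have "pivot p ?v j = (if j = m then 1 / tau p m else 0)" for j
      using m by (simp add: pivot_def dtau_def)
    then have "(\<Sum>k<n. l k * pivot p ?v k) = l m / tau p m"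
      using M_less[OF m] by (simp add: if_distrib[of "\<lambda>x. _ * x"] sum.delta cong: if_cong)
    moreover have "?v \<in> coord_space (idx AV)" using m by (auto simp: coord_space_def idx_AV)
    ultimately show ?thesis using l[of ?v] tau_nz[OF p, of m] by simp
  qed
  define l' where "l' k = (if k < n then l k else 0)" for k
  \<comment> \<open>By \<open>tr_conj_diag\<close> the assumed relation says that S pairs to 0 with
    \<open>wlogr\<close> in every direction, which is criticality for u = 0.\<close>
  define S where "S = Um ?x * diagonal l' * Ui ?x"
  have S: "upper S" unfolding S_def by (intro upper_times upper_Ui U upper_simps)
  have "zero_block n (diagonal l')" by (auto simp: zero_block_def ent_diagonal l'_def)
  then have S0: "zero_block n S" unfolding S_def by (intro zero_block_times_unit_block zero_block_unit_block_times) simp_all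
  have diag: "ent S k k = l' k" for k
    using Um_Ui_diag[OF U, of k] U upper_Ui[OF U] by (simp add: S_def ent_upper_times_diag ent_diagonal)
  have "tr n (S * wlogr \<eta> ?x v N) = 2 * (\<Sum>k<N. v k * ent (wlog \<eta> ?x (\<lambda>_. 0) k) (\<eta> ! k) (\<eta> ! k + 1))"
    if "v \<in> coord_space {..<N}" for v
  proof -
    let ?v = "\<lambda>g. case g of Crossing j \<Rightarrow> if j < length \<beta> then v j else 0 | Marked _ \<Rightarrow> 0"
    have "ups ?x (zp ?v) k = ups ?x v k" for k by (rule ups_cong) simp
    moreover have "dtau ?v k = 0" for k by (simp add: dtau_def)
    ultimately have "pivot p ?v k = ups ?x v k" for k by (simp add: pivot_def)
    moreover have "?v \<in> coord_space (idx AV)"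
      by (auto simp: coord_space_def idx_AV image_iff split: gen.splits)
    ultimately have "(\<Sum>k<n. l k * ups ?x v k) = 0" using l[of ?v] by simp
    moreover have "tr n (S * wlogr \<eta> ?x v N) = (\<Sum>k<n. l' k * ups ?x v k)"
      unfolding S_def by (rule tr_conj_diag) (simp add: l'_def)
    ultimately show ?thesis by (simp add: l'_def wlog_def)
  qed
  then have crit: "ent (prop_mat \<eta> ?x (\<lambda>_. 0) S k) (\<eta> ! k) (\<eta> ! k + 1) = 0" if "k < N" for k
    using critical_from_trace that by blast
  have "(\<lambda>_. 0) \<in> tangent X ?x" by (simp add: tangent_X coord_space_def dU_def)
  moreover have "ups ?x (\<lambda>_. 0) k = 0" for k by (simp add: ups_def dU_def)
  ultimately have "S = 0"
    using propagation[OF x _ S S0 crit] lM by (simp add: diag l'_def)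
  then show ?thesis using diag[of k] k by (simp add: l'_def)
qed

lemma pivot_lin: "pivot p (\<lambda>i. u i + c * v i) k = pivot p u k + c * pivot p v k"
  by (simp add: pivot_def ups_lin dtau_def add_divide_distrib algebra_simps)

text \<open>The variations \<open>pivot\<close> take arbitrary values by independence; the
  triangular relation to the differentials of the cusps then allows arbitrary values of the
  latter.\<close>

lemma smooth_AV: "smooth AV"
  unfolding smooth_def
proof (intro ballI allI)
  fix p and b :: "((gen \<Rightarrow> complex) \<Rightarrow> complex) \<Rightarrow> complex"
  assume p: "p \<in> points AV"
  define t where "t m = b (cusp_differential n \<beta> M (n - Suc m))" for m
  \<comment> \<open>The errors are computed from the desired differentials t instead of the actual
    ones; the induction below shows that the two coincide.\<close>
  have "\<exists>v\<in>coord_space (idx AV). \<forall>k\<in>{..<n}. pivot p v k = - t (n - Suc k) - ent (pivot_error n (Am p) t (n - Suc k)) k k"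
  proof (rule independent_functionals_surj)
    show "lin_on (coord_space (idx AV)) (\<lambda>v. pivot p v k)" for k
      by (simp add: lin_on_def pivot_lin)
    show "l k = 0" if "\<And>v. v \<in> coord_space (idx AV) \<Longrightarrow> (\<Sum>k\<in>{..<n}. l k * pivot p v k) = 0" "k \<in> {..<n}" for l k
      using pivot_independent[OF p, of l k] that by simp
  qed (simp_all add: subsp_coord_space)
  then obtain v where v: "v \<in> coord_space (idx AV)"
    "\<And>k. k < n \<Longrightarrow> pivot p v k = - t (n - Suc k) - ent (pivot_error n (Am p) t (n - Suc k)) k k" by auto
  let ?q = "\<lambda>j. ent (dE p v j) (n - Suc j) (n - Suc j)"
  have q: "?q m = t m" if "m < n" for m
    using that
  proof (induction m rule: less_induct)
    case (less m)
    have "pivot_error n (Am p) ?q m = pivot_error n (Am p) t m"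
      using less by (intro pivot_error_cong) auto
    then show ?case
      using dE_pivot[OF p, of "n - Suc m" v] v(2)[of "n - Suc m"] less.prems by simp
  qed
  have "dderiv f p v = b f" if "f \<in> eqs AV" for f
  proof -
    from that obtain k where "k < n" "f = cusp_differential n \<beta> M k" by (auto simp: Aug_def)
    then show ?thesis using q[of "n - Suc k"] by (simp add: dderiv_cusp t_def)
  qed
  with v(1) show "\<exists>v\<in>coord_space (idx AV). \<forall>f\<in>eqs AV. dderiv f p v = b f" by blast
qed

section \<open>The form on the augmentation variety and its rank\<close>

definition \<Omega> :: "gen two_form" where
  "\<Omega> p u v = wform \<eta> (sec p) (dmap sec p u) (dmap sec p v)"

lemma wform_tangent:
  assumes x: "x \<in> points X" and u: "u \<in> tangent X x" and v: "v \<in> tangent X x"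
  shows "wform \<eta> x u v = 2 * (\<Sum>k<N. v k * ent (wlog \<eta> x u k) (\<eta> ! k) (\<eta> ! k + 1))
    - (\<Sum>k<n. ups x u k * ups x v k)"
  using wform_eq_trace[OF eta, of x u v] tr_upper_times[OF upper_wlogr[OF x u] upper_wlogr[OF x v], of n]
  by (simp add: wlogr_diag[OF x u] wlogr_diag[OF x v])

text \<open>On tangent vectors the form agrees with the functional g, which is linear on the whole
  coordinate space. Where the slice equations vanish, so does g; their multipliers form the matrix S
  for \<open>propagation\<close>.\<close>

lemma slice_nondegenerate:
  assumes x: "x \<in> points X" and u: "u \<in> tangent X x"
    and off: "\<And>k. k < n \<Longrightarrow> k \<notin> M \<Longrightarrow> ups x u k = 0"
    and ker: "\<And>v. v \<in> tangent X x \<Longrightarrow> (\<And>k. k < n \<Longrightarrow> k \<notin> M \<Longrightarrow> ups x v k = 0) \<Longrightarrow> wform \<eta> x u v = 0"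
  shows "u = (\<lambda>_. 0)"
proof -
  let ?V = "coord_space {..<N}" and ?R = "\<lambda>v. wlogr \<eta> x v N"
  \<comment> \<open>The equations of the slice, in terms of R(v) = dU(v) U^-1: entries below the
    diagonal and unmarked diagonal entries.\<close>
  define K where "K = {(a, b). b \<le> a \<and> a < n \<and> (a = b \<longrightarrow> a \<notin> M)}"
  define f where "f = (\<lambda>(a, b) v. ent (?R v) a b)"
  define g where "g v = 2 * (\<Sum>k<N. v k * ent (wlog \<eta> x u k) (\<eta> ! k) (\<eta> ! k + 1))
    - (\<Sum>k<n. ups x u k * ent (?R v) k k)" for v
  have U: "upper (Um x)" using x by (simp add: points_X)
  have "K \<subseteq> {..<n} \<times> {..<n}" by (auto simp: K_def)
  then have finK: "finite K" by (rule finite_subset) simp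
  have Rlin: "ent (?R (\<lambda>i. u i + c * v i)) a b = ent (?R u) a b + c * ent (?R v) a b" for u v c a b
    by (simp add: wlogr_eta dU_lin distrib_right mult.assoc ent_diagonal_times)
  have "\<exists>l. \<forall>v\<in>?V. g v = (\<Sum>k\<in>K. l k * f k v)"
  proof (rule lagrange_multipliers[OF finK subsp_coord_space])
    show "lin_on ?V (f k)" for k
      by (cases k) (simp add: lin_on_def f_def Rlin)
    show "lin_on ?V g"
      by (simp add: lin_on_def g_def Rlin algebra_simps sum.distrib sum_distrib_left)
    fix v assume v: "v \<in> ?V" "\<And>k. k \<in> K \<Longrightarrow> f k v = 0"
    have "upper (?R v)"
      unfolding upper_def
    proof (intro allI impI)
      fix a b :: nat assume ab: "b < a"
      show "ent (?R v) a b = 0"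
      proof (cases "a < n")
        case True
        then have "(a, b) \<in> K" using ab by (simp add: K_def)
        then show ?thesis using v(2)[of "(a, b)"] by (simp add: f_def)
      next
        case False
        have "zero_block n (?R v)" by (simp add: wlogr_eta)
        then show ?thesis using False by (simp add: zero_block_def)
      qed
    qed
    then have "upper (?R v * Um x)" using U by simp
    then have t: "v \<in> tangent X x" using v(1) by (simp add: tangent_X wlogr_eta mult.assoc)
    have "ups x v k = 0" if "k < n" "k \<notin> M" for k
      using v(2)[of "(k, k)"] that by (simp add: K_def f_def wlogr_diag[OF x t])
    then have "wform \<eta> x u v = 0" by (intro ker t)
    then show "g v = 0" by (simp add: wform_tangent[OF x u t] g_def wlogr_diag[OF x t])
  qed
  then obtain l where l: "\<And>v. v \<in> ?V \<Longrightarrow> g v = (\<Sum>k\<in>K. l k * f k v)" by blast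
  \<comment> \<open>The indices are transposed, since the entry (b,a) of S pairs with R_ab in the
    trace. The second summand moves the quadratic term of g to the side of the multipliers.\<close>
  define s where "s b a = (if (a, b) \<in> K then l (a, b) else 0) + (if a = b \<and> a < n then ups x u a else 0)" for a b
  have s0: "s b a = 0" if "n \<le> a \<or> n \<le> b \<or> a < b" for a b
    using that by (auto simp: s_def K_def)
  define S where "S = Rmat s"
  have entS: "ent S = s"
    unfolding S_def
  proof (rule ent_Rmat)
    fix b show "finite {a. s b a \<noteq> 0}"
      by (rule finite_subset[of _ "{..<n}"]) (use s0 in \<open>auto simp: not_le[symmetric]\<close>)
  qed
  have S: "upper S" "zero_block n S" using s0 by (auto simp: upper_def zero_block_def entS)
  have trS: "tr n (S * ?R v) = 2 * (\<Sum>k<N. v k * ent (wlog \<eta> x u k) (\<eta> ! k) (\<eta> ! k + 1))"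
    if "v \<in> ?V" for v
  proof -
    have "(\<Sum>k\<in>K. l k * f k v) = (\<Sum>k\<in>{..<n} \<times> {..<n}. if k \<in> K then l k * f k v else 0)"
      using \<open>K \<subseteq> {..<n} \<times> {..<n}\<close> by (simp add: sum.inter_restrict[symmetric] Int_absorb1)
    also have "\<dots> = (\<Sum>a<n. \<Sum>b<n. if (a, b) \<in> K then l (a, b) * ent (?R v) a b else 0)"
      unfolding sum.cartesian_product by (intro sum.cong refl) (auto simp: f_def)
    finally have 1: "(\<Sum>k\<in>K. l k * f k v) = (\<Sum>a<n. \<Sum>b<n. if (a, b) \<in> K then l (a, b) * ent (?R v) a b else 0)" .
    have 2: "(\<Sum>k<n. ups x u k * ent (?R v) k k)
        = (\<Sum>a<n. \<Sum>b<n. if a = b then ups x u a * ent (?R v) a b else 0)"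
      by (intro sum.cong refl) (simp add: sum.delta)
    have "tr n (S * ?R v) = (\<Sum>b<n. \<Sum>a<n. s b a * ent (?R v) a b)"
      unfolding tr_def ent_times_zero_block[OF S(2)] entS ..
    also have "\<dots> = (\<Sum>a<n. \<Sum>b<n. s b a * ent (?R v) a b)" by (rule sum.swap)
    also have "\<dots> = (\<Sum>k\<in>K. l k * f k v) + (\<Sum>k<n. ups x u k * ent (?R v) k k)"
      unfolding 1 2 sum.distrib[symmetric]
      by (intro sum.cong refl) (auto simp: s_def distrib_right)
    finally show ?thesis using l[OF that] by (simp add: g_def diff_eq_eq)
  qed
  have "ent S m m = ups x u m" if "m \<in> M" for m
    using that M_less[OF that] by (simp add: entS s_def K_def)
  then show ?thesis
    using propagation[OF x u S critical_from_trace[OF trS] off] by blast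
qed

lemma maximal_rank_AV: "maximal_rank AV \<Omega>"
  unfolding maximal_rank_def
proof (intro ballI impI)
  fix p u assume p: "p \<in> points AV" and u: "u \<in> tangent AV p" and ker: "\<forall>v\<in>tangent AV p. \<Omega> p u v = 0"
  let ?u = "dmap sec p u"
  have "?u = (\<lambda>_. 0)"
  proof (rule slice_nondegenerate[OF sec_points[OF p] dsec_tangent[OF p u]])
    show "ups (sec p) ?u k = 0" if "k < n" "k \<notin> M" for k
      using ups_dsec[OF p u that(1)] that(2) by (simp add: dtau_def)
    show "wform \<eta> (sec p) ?u v = 0"
      if "v \<in> tangent X (sec p)" "\<And>k. k < n \<Longrightarrow> k \<notin> M \<Longrightarrow> ups (sec p) v k = 0" for v
      using ker lower_tangent[OF p that] by (auto simp: \<Omega>_def)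
  qed
  then have z: "?u j = 0" for j by simp
  show "u = (\<lambda>_. 0)"
  proof
    fix g
    show "u g = 0"
    proof (cases g)
      case (Crossing j)
      then show ?thesis
        using z[of j] u dsec_crossing[of j p u]
        by (cases "j < length \<beta>") (auto simp: tangent_AV coord_space_def idx_AV)
    next
      case (Marked m)
      show ?thesis
      proof (cases "m \<in> M")
        case True
        have "ups (sec p) ?u m = 0" using \<open>?u = (\<lambda>_. 0)\<close> by (simp add: ups_def dU_def)
        then show ?thesis
          using ups_dsec[OF p u M_less[OF True]] True tau_nz[OF p, of m] Marked by (simp add: dtau_def)
      next
        case False
        then show ?thesis using u Marked by (auto simp: tangent_AV coord_space_def idx_AV)
      qed
    qed
  qed
qed

lemma closed_AV: "closed_algebraic_form AV \<Omega>"
proof -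
  obtain c where c: "represents AV c (\<lambda>x u v. wform \<eta> (sec x) (dmap sec x u) (dmap sec x v))
    (\<lambda>x u v w. - tr3 n (wlogr \<eta> (sec x) (dmap sec x u) (length \<eta>))
      (wlogr \<eta> (sec x) (dmap sec x v) (length \<eta>)) (wlogr \<eta> (sec x) (dmap sec x w) (length \<eta>)))"
    using wform_pullback_represents[OF eta fin_AV, of sec, OF regular_sec] by blast
  show ?thesis
    unfolding closed_algebraic_form_def
  proof (intro exI[of _ c] conjI ballI)
    fix i j assume "i \<in> idx AV" "j \<in> idx AV"
    then show "c i j \<in> regular AV" using c by (simp add: represents_def)
  next
    fix p u v assume p: "p \<in> points AV" and u: "u \<in> tangent AV p" and v: "v \<in> tangent AV p"
    have nz: "\<forall>j\<in>invs AV. p j \<noteq> 0" using inv_coords_nz[OF p] by blast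
    show "\<Omega> p u v = coeff_form (idx AV) c p u v"
      using c nz by (simp add: represents_def \<Omega>_def)
    fix w assume w: "w \<in> tangent AV p"
    note up = upper_wlogr[OF sec_points[OF p] dsec_tangent[OF p]]
    \<comment> \<open>Traces of products of upper triangular matrices only see the diagonals, which
      commute.\<close>
    have "tr3 n (wlogr \<eta> (sec p) (dmap sec p u) N) (wlogr \<eta> (sec p) (dmap sec p v) N)
        (wlogr \<eta> (sec p) (dmap sec p w) N) = 0"
      using up[OF u] up[OF v] up[OF w]
      by (simp add: tr3_def tr_def ent_upper_times_diag mult.commute mult.left_commute)
    then show "d_coeff_form (idx AV) c p u v w = 0"
      using c nz by (simp add: represents_def)
  qed
qed

lemma symplectic_AV: "holomorphic_symplectic AV \<Omega>"
  by (simp add: holomorphic_symplectic_def smooth_AV closed_AV maximal_rank_AV)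

end

section \<open>The quotient by the torus\<close>

lemma torus_act_mult: "torus_act \<eta> s (torus_act \<eta> t x) = torus_act \<eta> (\<lambda>k. s k * t k) x"
  by (rule ext) (simp add: torus_act_def)

lemma torus_act_one: "x \<in> coord_space {..<length \<eta>} \<Longrightarrow> torus_act \<eta> (\<lambda>_. 1) x = x"
  by (rule ext) (auto simp: torus_act_def coord_space_def)

lemma dmap_torus_act: "dmap (torus_act \<eta> t) x v = torus_act \<eta> t v"
proof
  fix j
  show "dmap (torus_act \<eta> t) x v j = torus_act \<eta> t v j"
    unfolding dmap_def
    by (rule dderivI, cases "j < length \<eta>") (auto simp: torus_act_def intro!: DERIV_cdivide DERIV_cmult line_deriv)
qed

text \<open>Along the embedding by zeros the variables of the second half twist do not vary, so its
  letters contribute nothing.\<close>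

lemma wform_append:
  assumes "u \<in> coord_space {..<length \<eta>}" "v \<in> coord_space {..<length \<eta>}"
  shows "wform (\<eta> @ \<delta>) x u v = wform \<eta> x u v"
proof -
  have w: "wlog (\<eta> @ \<delta>) x u j = wlog \<eta> x u j" if "j < length \<eta>" for u j
    unfolding wlog_def using that
    by (intro arg_cong2[of _ _ _ _ "(*)"] winv_cong wdiff_cong) (auto simp: nth_append)
  have "wform (\<eta> @ \<delta>) x u v = (\<Sum>j<length \<eta>.
      ent (wlog (\<eta> @ \<delta>) x u j) ((\<eta> @ \<delta>) ! j) ((\<eta> @ \<delta>) ! j + 1) * v j
      - ent (wlog (\<eta> @ \<delta>) x v j) ((\<eta> @ \<delta>) ! j) ((\<eta> @ \<delta>) ! j + 1) * u j)"
    unfolding wform_def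
    by (rule sum.mono_neutral_right) (use assms in \<open>auto simp: coord_space_def\<close>)
  also have "\<dots> = wform \<eta> x u v"
    unfolding wform_def by (intro sum.cong refl) (simp add: w nth_append)
  finally show ?thesis .
qed

locale braid_closure_torus = braid_closure +
  fixes A :: "nat set"
  assumes A: "cycle_transversal n \<beta> A"
begin

definition T0 :: "(nat \<Rightarrow> complex) set" where
  "T0 = {t. (\<forall>k. t k \<noteq> 0) \<and> (\<forall>a\<in>A. t a = 1)}"

lemma A_less: "a \<in> A \<Longrightarrow> a < n"
  using A by (auto simp: cycle_transversal_def)

lemma torus_c_T0: "torus_act \<eta> ` torus_c n A = torus_act \<eta> ` T0"
proof (intro equalityI subsetI)
  fix g assume "g \<in> torus_act \<eta> ` torus_c n A"
  then obtain t where t: "t \<in> torus_c n A" "g = torus_act \<eta> t" by blast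
  let ?t = "\<lambda>k. if k < n then t k else 1"
  have "?t \<in> T0" using t A_less by (auto simp: T0_def torus_c_def)
  moreover have "g = torus_act \<eta> ?t"
    unfolding t(2) by (rule ext, rule torus_act_cong[OF eta]) simp
  ultimately show "g \<in> torus_act \<eta> ` T0" by blast
next
  fix g assume "g \<in> torus_act \<eta> ` T0"
  then show "g \<in> torus_act \<eta> ` torus_c n A" by (auto simp: T0_def torus_c_def)
qed

section \<open>Torus action on the triangular factor\<close>

lemma Um_torus:
  assumes "\<And>k. t k \<noteq> 0"
  shows "Um (torus_act \<eta> t x) = diagonal t * Um x * diagonal (\<lambda>k. inverse (t (w k)))"
  using wprod_torus_act[OF assms, where j=N and \<eta>=\<eta> and z=x]
    diagonal_pmat[of "w0 n" "\<lambda>k. inverse (t (word_perm \<eta> k))"]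
  by (simp add: Um_def mult.assoc word_perm_eta)

lemma dU_torus:
  assumes "\<And>k. t k \<noteq> 0"
  shows "dU (torus_act \<eta> t x) (torus_act \<eta> t v) = diagonal t * dU x v * diagonal (\<lambda>k. inverse (t (w k)))"
  using wdiff_torus_act[OF assms, where j=N and \<eta>=\<eta> and z=x and v=v]
    diagonal_pmat[of "w0 n" "\<lambda>k. inverse (t (word_perm \<eta> k))"]
  by (simp add: dU_def mult.assoc word_perm_eta)

lemma dU_torus_inf: "dU x (torus_inf \<eta> \<tau> x) = diagonal \<tau> * Um x - Um x * diagonal (\<lambda>k. \<tau> (w k))"
  using wdiff_torus_inf[where j=N and \<eta>=\<eta> and z=x and \<tau>=\<tau>]
    diagonal_pmat[of "w0 n" "\<lambda>k. \<tau> (word_perm \<eta> k)"]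
  by (simp add: dU_def Um_def mult.assoc word_perm_eta left_diff_distrib)

lemma torus_act_coord: "torus_act \<eta> t x \<in> coord_space {..<N}"
  by (simp add: coord_space_def torus_act_def)

lemma torus_points:
  assumes "\<And>k. t k \<noteq> 0" "x \<in> points X" shows "torus_act \<eta> t x \<in> points X"
  using assms(2) unfolding points_X by (simp add: torus_act_coord Um_torus[OF assms(1)])

lemma torus_tangent:
  assumes "\<And>k. t k \<noteq> 0" "v \<in> tangent X x" shows "torus_act \<eta> t v \<in> tangent X (torus_act \<eta> t x)"
  using assms(2) unfolding tangent_X by (simp add: torus_act_coord dU_torus[OF assms(1)])

lemma Um_torus_diag:
  "(\<And>k. t k \<noteq> 0) \<Longrightarrow> ent (Um (torus_act \<eta> t x)) k k = t k * ent (Um x) k k / t (w k)"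
  by (simp add: Um_torus ent_times_diagonal ent_diagonal_times divide_inverse)

lemma ups_torus:
  assumes t: "\<And>k. t k \<noteq> 0" and x: "x \<in> points X" and v: "v \<in> tangent X x"
  shows "ups (torus_act \<eta> t x) (torus_act \<eta> t v) k = ups x v k"
proof -
  have "upper (Um x)" "upper (dU x v)" using x v by (simp_all add: points_X tangent_X)
  moreover have "upper (Um (torus_act \<eta> t x))" "upper (dU (torus_act \<eta> t x) (torus_act \<eta> t v))"
    using torus_points[OF t x] torus_tangent[OF t v] by (simp_all add: points_X tangent_X)
  ultimately show ?thesis
    by (simp add: ups_upper) (simp add: Um_torus[OF t] dU_torus[OF t] ent_times_diagonal ent_diagonal_times t)
qed

section \<open>Normalization of a point by the torus\<close>

definition rep :: "nat \<Rightarrow> nat" where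
  "rep k = (THE a. a \<in> A \<and> a \<in> orbit w k)"

lemma A_ex1: "k < n \<Longrightarrow> \<exists>!a. a \<in> A \<and> a \<in> orbit w k"
  using A by (simp add: cycle_transversal_def)

lemma rep: "k < n \<Longrightarrow> rep k \<in> A \<and> rep k \<in> orbit w k"
  unfolding rep_def by (rule theI', rule A_ex1)

lemma rep_w: "rep (w k) = rep k"
  by (simp add: rep_def orbit_w)

lemma A_unique: "k < n \<Longrightarrow> a \<in> A \<Longrightarrow> a \<in> orbit w k \<Longrightarrow> b \<in> A \<Longrightarrow> b \<in> orbit w k \<Longrightarrow> a = b"
  using A_ex1[of k] by blast

lemma rep_A: "a \<in> A \<Longrightarrow> rep a = a"
  using A_unique[OF A_less] rep[OF A_less] self_in_orbit by simp

text \<open>The torus turns U_kk into t_k U_kk / t_{w(k)}, so reaching -1 requires t_{w(k)} = - U_kk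
  t_k for unmarked k. The factors accumulate along the path from k to the first marked
  strand.\<close>

definition path_prod :: "nat \<Rightarrow> (nat \<Rightarrow> complex) \<Rightarrow> complex" where
  "path_prod k u = (\<Prod>i<steps k. - u ((w ^^ i) k))"

lemma path_prod_step:
  assumes "k < n" "k \<notin> M" shows "path_prod k u = - u k * path_prod (w k) u"
  unfolding path_prod_def steps_Suc[OF assms] prod.lessThan_Suc_shift
  by (simp add: funpow_swap1)

abbreviation "Ud x \<equiv> (\<lambda>k. ent (Um x) k k)"
abbreviation "Vd x \<equiv> (\<lambda>k. ent (Ui x) k k)"

text \<open>The element of the torus that moves \<open>x\<close> to the slice \<open>U\<^sub>k\<^sub>k = - 1\<close>, \<open>k \<notin> M\<close>, and its inverse.
  Both are polynomials, since \<open>1 / U\<^sub>k\<^sub>k\<close> is the diagonal entry of the inverse matrix.\<close>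

definition to_slice :: "(nat \<Rightarrow> complex) \<Rightarrow> nat \<Rightarrow> complex" where
  "to_slice x k = (if k < n then path_prod (rep k) (Ud x) * path_prod k (Vd x) else 1)"

definition from_slice :: "(nat \<Rightarrow> complex) \<Rightarrow> nat \<Rightarrow> complex" where
  "from_slice x k = (if k < n then path_prod (rep k) (Vd x) * path_prod k (Ud x) else 1)"

lemma path_prod_UV:
  assumes "x \<in> points X" shows "path_prod k (Ud x) * path_prod k (Vd x) = 1"
  unfolding path_prod_def prod.distrib[symmetric]
  using assms Um_Ui_diag[of x] by (simp add: points_X)

lemma to_slice_from_slice:
  assumes "x \<in> points X" shows "to_slice x k * from_slice x k = 1"
proof (cases "k < n")
  case True
  then have "to_slice x k * from_slice x k = (path_prod (rep k) (Ud x) * path_prod (rep k) (Vd x))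
      * (path_prod k (Ud x) * path_prod k (Vd x))"
    by (simp add: to_slice_def from_slice_def mult_ac)
  then show ?thesis unfolding path_prod_UV[OF assms] by simp
qed (simp add: to_slice_def from_slice_def)

lemma to_slice_nz: "x \<in> points X \<Longrightarrow> to_slice x k \<noteq> 0"
  using to_slice_from_slice[of x k] by auto

lemma from_slice_eq: "x \<in> points X \<Longrightarrow> from_slice x k = inverse (to_slice x k)"
  by (rule inverse_unique[symmetric]) (rule to_slice_from_slice)

lemma to_slice_A: "x \<in> points X \<Longrightarrow> a \<in> A \<Longrightarrow> to_slice x a = 1"
  using path_prod_UV[of x a] A_less[of a] by (simp add: to_slice_def rep_A)

lemma to_slice_step': "k < n \<Longrightarrow> k \<notin> M \<Longrightarrow> to_slice x k = - Vd x k * to_slice x (w k)"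
  by (simp add: to_slice_def rep_w w_less path_prod_step)

lemma to_slice_step:
  assumes "x \<in> points X" "k < n" "k \<notin> M" shows "to_slice x (w k) = - Ud x k * to_slice x k"
proof -
  have "- Ud x k * to_slice x k = (Ud x k * Vd x k) * to_slice x (w k)"
    unfolding to_slice_step'[OF assms(2,3)] by (simp add: mult_ac)
  then show ?thesis using assms(1) Um_Ui_diag[of x k] by (simp add: points_X)
qed

lemma to_slice_T0: "x \<in> points X \<Longrightarrow> to_slice x \<in> T0"
  by (simp add: T0_def to_slice_nz to_slice_A)

definition norm_pt :: "(nat \<Rightarrow> complex) \<Rightarrow> nat \<Rightarrow> complex" where
  "norm_pt x = torus_act \<eta> (to_slice x) x"

text \<open>The crossings and the values -1 / U_mm of the normalized point, with each division
  replaced by \<open>Vd\<close> or \<open>from_slice\<close>, so that the formula is polynomial on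
  the whole coordinate space.\<close>

definition quot :: "(nat \<Rightarrow> complex) \<Rightarrow> gen \<Rightarrow> complex" where
  "quot x g = (case g of
     Crossing j \<Rightarrow> if j < length \<beta>
       then to_slice x (word_perm (take j \<beta>) (\<beta> ! j + 1)) * from_slice x (word_perm (take j \<beta>) (\<beta> ! j)) * x j else 0
   | Marked m \<Rightarrow> if m \<in> M then - (Vd x m * to_slice x (w m) * from_slice x m) else 0)"

lemma norm_points: "x \<in> points X \<Longrightarrow> norm_pt x \<in> points X"
  unfolding norm_pt_def by (intro torus_points to_slice_nz)

lemma quot_eq:
  assumes x: "x \<in> points X"
  shows "quot x g = (case g of Crossing j \<Rightarrow> if j < length \<beta> then norm_pt x j else 0
     | Marked m \<Rightarrow> if m \<in> M then - inverse (Ud (norm_pt x) m) else 0)"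
proof (cases g)
  case (Crossing j)
  then show ?thesis
    by (simp add: quot_def norm_pt_def torus_act_def nth_append from_slice_eq[OF x] divide_inverse)
next
  case (Marked m)
  have "Vd x m = inverse (Ud x m)" using x Ui_diag[of x m] by (simp add: points_X divide_inverse)
  then show ?thesis using Marked
    by (simp add: quot_def norm_pt_def Um_torus_diag[OF to_slice_nz[OF x]] from_slice_eq[OF x] field_simps)
qed

lemma norm_diag:
  assumes x: "x \<in> points X" and k: "k < n" "k \<notin> M" shows "Ud (norm_pt x) k = - 1"
proof -
  have "Ud x k \<noteq> 0" using x by (simp add: points_X Um_diag_nz)
  then show ?thesis
    using to_slice_step[OF x k] to_slice_nz[OF x, of k] by (simp add: norm_pt_def Um_torus_diag[OF to_slice_nz[OF x]])
qed

lemma quot_coord: "quot x \<in> coord_space (idx AV)"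
  by (auto simp: coord_space_def idx_AV quot_def image_iff split: gen.splits)

lemma compat_quot:
  assumes x: "x \<in> points X" shows "compat (quot x) (norm_pt x)"
proof -
  have nz: "Ud (norm_pt x) k \<noteq> 0" for k
    using norm_points[OF x] by (simp add: points_X Um_diag_nz)
  show ?thesis
    unfolding compat_def using norm_points[OF x] nz norm_diag[OF x]
    by (auto simp: quot_eq[OF x] tau_eq)
qed

lemma quot_points: "x \<in> points X \<Longrightarrow> quot x \<in> points AV"
  by (rule compat_points[OF compat_quot quot_coord])

lemma sec_quot: "x \<in> points X \<Longrightarrow> sec (quot x) = norm_pt x"
  using compat_unique[OF compat_quot quot_points] by simp

lemma const_one:
  assumes "\<And>k. k < n \<Longrightarrow> k \<notin> M \<Longrightarrow> h (w k) = h k" "\<And>a. a \<in> A \<Longrightarrow> h a = c" "k < n"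
  shows "h k = c"
  using const_on_orbit[of h, OF assms(1) assms(3)] rep[OF assms(3)] assms(2) by metis

lemma norm_eqI:
  assumes "\<And>k. k < n \<Longrightarrow> to_slice (torus_act \<eta> t x) k * t k = to_slice x k"
  shows "norm_pt (torus_act \<eta> t x) = norm_pt x"
  unfolding norm_pt_def torus_act_mult by (rule torus_act_cong[OF eta assms])

text \<open>The ratio of the two normalizing elements is constant along unmarked steps and equals 1
  on A, hence is 1 on every cycle.\<close>

lemma norm_torus:
  assumes x: "x \<in> points X" and t: "t \<in> T0"
  shows "norm_pt (torus_act \<eta> t x) = norm_pt x"
proof (rule norm_eqI)
  let ?y = "torus_act \<eta> t x"
  have nz: "t k \<noteq> 0" for k using t by (simp add: T0_def)
  have y: "?y \<in> points X" by (rule torus_points[OF nz x])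
  fix k assume k: "k < n"
  have "to_slice ?y k * t k / to_slice x k = 1"
  proof (rule const_one[OF _ _ k])
    fix k assume k: "k < n" "k \<notin> M"
    have "Ud x k \<noteq> 0" using x by (simp add: points_X Um_diag_nz)
    then show "to_slice ?y (w k) * t (w k) / to_slice x (w k) = to_slice ?y k * t k / to_slice x k"
      unfolding to_slice_step[OF x k] to_slice_step[OF y k] using nz to_slice_nz[OF x] by (simp add: Um_torus_diag[OF nz])
  next
    fix a assume "a \<in> A"
    then show "to_slice ?y a * t a / to_slice x a = 1" using t by (simp add: to_slice_A[OF x] to_slice_A[OF y] T0_def)
  qed
  then show "to_slice ?y k * t k = to_slice x k" using to_slice_nz[OF x, of k] by simp
qed

text \<open>Since \<open>sec (quot x)\<close> is the normalized point, equal images have equal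
  normalizations, and the quotient of the two normalizing elements carries x to y.\<close>

lemma quot_eq_iff:
  assumes x: "x \<in> points X" and y: "y \<in> points X"
  shows "quot x = quot y \<longleftrightarrow> (\<exists>t\<in>T0. y = torus_act \<eta> t x)"
proof
  assume "quot x = quot y"
  then have eq: "norm_pt x = norm_pt y" using sec_quot[OF x] sec_quot[OF y] by simp
  let ?t = "\<lambda>k. inverse (to_slice y k) * to_slice x k"
  have "torus_act \<eta> ?t x = torus_act \<eta> (\<lambda>k. inverse (to_slice y k)) (norm_pt x)"
    by (simp add: norm_pt_def torus_act_mult)
  also have "\<dots> = torus_act \<eta> (\<lambda>_. 1) y"
    unfolding eq by (simp add: norm_pt_def torus_act_mult to_slice_nz[OF y])
  also have "\<dots> = y" using y by (intro torus_act_one) (simp add: points_X)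
  finally have "y = torus_act \<eta> ?t x" ..
  moreover have "?t \<in> T0" by (simp add: T0_def to_slice_nz x y to_slice_A)
  ultimately show "\<exists>t\<in>T0. y = torus_act \<eta> t x" by blast
next
  assume "\<exists>t\<in>T0. y = torus_act \<eta> t x"
  then have eq: "norm_pt y = norm_pt x" using norm_torus[OF x] by auto
  show "quot x = quot y" by (rule ext) (simp only: quot_eq[OF x] quot_eq[OF y] eq)
qed

lemma to_slice_slice:
  assumes p: "p \<in> points AV" and k: "k < n" shows "to_slice (sec p) k = 1"
proof (rule const_one[OF _ _ k])
  note x = sec_points[OF p]
  show "to_slice (sec p) (w k) = to_slice (sec p) k" if "k < n" "k \<notin> M" for k
    using to_slice_step[OF x that] compat_sec[OF p] that by (simp add: compat_def tau_eq)
  show "to_slice (sec p) a = 1" if "a \<in> A" for a by (rule to_slice_A[OF x that])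
qed

lemma norm_sec:
  assumes p: "p \<in> points AV" shows "norm_pt (sec p) = sec p"
proof -
  have "norm_pt (sec p) = torus_act \<eta> (\<lambda>_. 1) (sec p)"
    unfolding norm_pt_def by (rule torus_act_cong[OF eta to_slice_slice[OF p]])
  then show ?thesis by (simp add: torus_act_one sec_coord)
qed

lemma quot_sec:
  assumes p: "p \<in> points AV" shows "quot (sec p) = p"
proof
  fix g
  have z: "p g = 0" if "g \<notin> idx AV" using p that by (auto simp: points_AV coord_space_def)
  show "quot (sec p) g = p g"
  proof (cases g)
    case (Crossing j)
    then show ?thesis using z by (auto simp: quot_eq[OF sec_points[OF p]] norm_sec[OF p] idx_AV)
  next
    case (Marked m)
    then show ?thesis
      using z compat_sec[OF p] M_less[of m]
      by (auto simp: quot_eq[OF sec_points[OF p]] norm_sec[OF p] idx_AV compat_def tau_eq)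
  qed
qed

subsection \<open>The differential of the quotient map\<close>

lemma regular_Ud: "(\<lambda>x. Ud x k) \<in> regular X"
  unfolding Um_def ent_times_pmat[OF w0_w0] by (intro regular_wprod regular.coord) simp

lemma regular_Vd: "(\<lambda>x. Vd x k) \<in> regular X"
  unfolding Ui_def ent_pmat_times by (intro regular_winv regular.coord) simp

lemma regular_path_prod: "(\<lambda>x. path_prod k (Ud x)) \<in> regular X" "(\<lambda>x. path_prod k (Vd x)) \<in> regular X"
  unfolding path_prod_def by (intro regular_prod regular_uminus regular_Ud regular_Vd)+

lemma regular_to_slice: "(\<lambda>x. to_slice x k) \<in> regular X"
  by (cases "k < n") (auto simp: to_slice_def intro!: regular.const regular.mult regular_path_prod)

lemma regular_from_slice: "(\<lambda>x. from_slice x k) \<in> regular X"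
  by (cases "k < n") (auto simp: from_slice_def intro!: regular.const regular.mult regular_path_prod)

lemma regular_quot: "(\<lambda>x. quot x g) \<in> regular X"
proof (cases g)
  case (Crossing j)
  then show ?thesis
    by (cases "j < length \<beta>") (auto simp: quot_def intro!: regular.const regular.mult regular_to_slice regular_from_slice regular.coord)
next
  case (Marked m)
  then show ?thesis
    by (cases "m \<in> M") (auto simp: quot_def intro!: regular.const regular_uminus regular.mult regular_to_slice regular_from_slice regular_Vd)
qed

lemma dd_mult: "f \<in> regular X \<Longrightarrow> g \<in> regular X \<Longrightarrow>
    dderiv (\<lambda>x. f x * g x) x v = dderiv f x v * g x + dderiv g x v * f x"
  by (rule dderiv_mult[where V=X]) auto

lemma dd_uminus: "f \<in> regular X \<Longrightarrow> dderiv (\<lambda>x. - f x) x v = - dderiv f x v"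
  using regular_line[of f X x v] by (intro dderivI) (auto intro: DERIV_minus)

text \<open>U_kk and the diagonal entry of U^-1 are mutually inverse only on the braid variety.
  Relations of this kind are therefore carried to first order along a tangent vector.\<close>

definition one_first_order :: "(nat \<Rightarrow> complex) \<Rightarrow> (nat \<Rightarrow> complex) \<Rightarrow> ((nat \<Rightarrow> complex) \<Rightarrow> complex) \<Rightarrow> bool" where
  "one_first_order x v f \<longleftrightarrow> f \<in> regular X \<and> f x = 1 \<and> dderiv f x v = 0"

lemma one_first_order_mult: "one_first_order x v f \<Longrightarrow> one_first_order x v g \<Longrightarrow> one_first_order x v (\<lambda>x. f x * g x)"
  by (auto simp: one_first_order_def dd_mult intro: regular.mult)

lemma one_first_order_prod:
  fixes m :: nat
  shows "(\<And>i. i < m \<Longrightarrow> one_first_order x v (f i)) \<Longrightarrow> one_first_order x v (\<lambda>x. \<Prod>i<m. f i x)"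
proof (induction m)
  case 0
  show ?case by (simp add: one_first_order_def regular.const)
next
  case (Suc m)
  then show ?case using one_first_order_mult[of x v "\<lambda>x. \<Prod>i<m. f i x" "f m"] by simp
qed

context
  fixes x v assumes x: "x \<in> points X" and v: "v \<in> tangent X x"
begin

lemma UV: "Ud x k * Vd x k = 1"
  using x by (simp add: points_X Um_Ui_diag)

lemma dUd: "dderiv (\<lambda>x. Ud x k) x v = Ud x k * ups x v k"
proof -
  have "dderiv (\<lambda>x. Ud x k) x v = ent (dU x v) k k"
    by (rule dderivI) (rule mderivD[OF mderiv_Um])
  moreover have "Ud x k \<noteq> 0" "upper (Um x)" using x by (simp_all add: points_X Um_diag_nz)
  ultimately show ?thesis using v by (simp add: ups_upper tangent_X)
qed

lemma dVd: "dderiv (\<lambda>x. Vd x k) x v = - Vd x k * ups x v k"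
proof -
  have "mderiv (\<lambda>s. Ui (\<lambda>i. x i + s * v i)) (- (Ui x * dU x v * Ui x))"
    using mderivD[OF mderiv_winv_line[of \<eta> x v N]]
    by (simp add: mderiv_def Ui_def dU_def ent_pmat_times mult.assoc)
  then have "dderiv (\<lambda>x. Vd x k) x v = - ent (Ui x * dU x v * Ui x) k k"
    by (intro dderivI) (simp add: mderiv_def)
  moreover have "upper (Ui x)" "upper (dU x v)" using x v by (simp_all add: points_X tangent_X upper_Ui)
  ultimately show ?thesis by (simp add: ups_def ent_upper_times_diag)
qed

lemma one_first_order_path: "one_first_order x v (\<lambda>x. path_prod k (Ud x) * path_prod k (Vd x))"
proof -
  have UV1: "one_first_order x v (\<lambda>x. (- Ud x j) * (- Vd x j))" for j
    using UV[of j] dd_mult[OF regular_Ud regular_Vd, of j j x v]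
    by (simp add: one_first_order_def regular.mult regular_Ud regular_Vd dUd dVd)
  have "one_first_order x v (\<lambda>x. \<Prod>i<steps k. (- Ud x ((w ^^ i) k)) * (- Vd x ((w ^^ i) k)))"
    by (rule one_first_order_prod) (rule UV1)
  then show ?thesis unfolding path_prod_def prod.distrib .
qed

lemma one_first_order_to_slice_from_slice: "one_first_order x v (\<lambda>x. to_slice x k * from_slice x k)"
proof (cases "k < n")
  case True
  have "one_first_order x v (\<lambda>x. (path_prod (rep k) (Ud x) * path_prod (rep k) (Vd x))
      * (path_prod k (Ud x) * path_prod k (Vd x)))"
    by (intro one_first_order_mult one_first_order_path)
  then show ?thesis using True by (simp add: to_slice_def from_slice_def mult_ac)
next
  case False
  then show ?thesis by (simp add: to_slice_def from_slice_def one_first_order_def regular.const)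
qed

definition dlog :: "nat \<Rightarrow> complex" where
  "dlog k = dderiv (\<lambda>x. to_slice x k) x v * from_slice x k"

lemma dtt: "dderiv (\<lambda>x. to_slice x k) x v = to_slice x k * dlog k"
  using to_slice_from_slice[OF x, of k] by (simp add: dlog_def)

lemma dti: "dderiv (\<lambda>x. from_slice x k) x v = - from_slice x k * dlog k"
proof -
  have "dderiv (\<lambda>x. to_slice x k) x v * from_slice x k + dderiv (\<lambda>x. from_slice x k) x v * to_slice x k = 0"
    using one_first_order_to_slice_from_slice[of k] dd_mult[OF regular_to_slice regular_from_slice, of k k x v] by (simp add: one_first_order_def)
  then have "dderiv (\<lambda>x. from_slice x k) x v * to_slice x k = - dlog k"
    by (simp add: dlog_def eq_neg_iff_add_eq_0 add.commute)
  then have "dderiv (\<lambda>x. from_slice x k) x v * (to_slice x k * from_slice x k) = - from_slice x k * dlog k"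
    by (simp flip: mult.assoc)
  then show ?thesis using to_slice_from_slice[OF x, of k] by simp
qed

lemma dlog_A: "a \<in> A \<Longrightarrow> dlog a = 0"
  using one_first_order_path[of a] A_less[of a] by (simp add: dlog_def to_slice_def rep_A one_first_order_def)

text \<open>The logarithmic derivative of t_{w(k)} = - U_kk t_k.\<close>

lemma dlog_step:
  assumes k: "k < n" "k \<notin> M" shows "dlog (w k) = ups x v k + dlog k"
proof -
  have "dderiv (\<lambda>x. to_slice x k) x v = dderiv (\<lambda>x. - (Vd x k * to_slice x (w k))) x v"
    using to_slice_step'[OF k] by simp
  also have "\<dots> = - (- Vd x k * ups x v k * to_slice x (w k) + to_slice x (w k) * dlog (w k) * Vd x k)"
    by (simp add: dd_uminus dd_mult regular.mult regular_Vd regular_to_slice dVd dtt)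
  also have "\<dots> = to_slice x k * (dlog (w k) - ups x v k)"
    using to_slice_step'[OF k, of x] by (simp add: algebra_simps)
  finally show ?thesis using to_slice_nz[OF x, of k] by (simp add: dtt)
qed

text \<open>The derivative of \<open>norm_pt\<close> by the product rule: the vector is transported
  by the torus element, whose own variation adds an infinitesimal torus action.\<close>

definition dnorm :: "nat \<Rightarrow> complex" where
  "dnorm = torus_act \<eta> (to_slice x) (\<lambda>j. v j + torus_inf \<eta> dlog x j)"

lemma dU_dnorm: "dU (norm_pt x) dnorm = diagonal (to_slice x) * (dU x v + (diagonal dlog * Um x - Um x * diagonal (\<lambda>k. dlog (w k))))
    * diagonal (\<lambda>k. inverse (to_slice x (w k)))"
proof -
  have "dU x (\<lambda>j. v j + torus_inf \<eta> dlog x j) = dU x v + dU x (torus_inf \<eta> dlog x)"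
    using dU_lin[of x v 1 "torus_inf \<eta> dlog x"] by (simp add: diagonal_one)
  then show ?thesis
    unfolding norm_pt_def dnorm_def dU_torus[OF to_slice_nz[OF x]] dU_torus_inf[symmetric] by simp
qed

lemma dnorm_tangent: "dnorm \<in> tangent X (norm_pt x)"
proof -
  have "upper (Um x)" "upper (dU x v)" using x v by (simp_all add: points_X tangent_X)
  then have "upper (dU (norm_pt x) dnorm)" unfolding dU_dnorm by simp
  then show ?thesis by (simp add: tangent_X dnorm_def torus_act_coord)
qed

lemma ups_dnorm: "ups (norm_pt x) dnorm k = ups x v k + dlog k - dlog (w k)"
proof -
  have u: "upper (Um x)" "upper (dU x v)" using x v by (simp_all add: points_X tangent_X)
  have "upper (Um (norm_pt x))" "upper (dU (norm_pt x) dnorm)"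
    using norm_points[OF x] dnorm_tangent by (simp_all add: points_X tangent_X)
  then have "ups (norm_pt x) dnorm k = ent (dU (norm_pt x) dnorm) k k / Ud (norm_pt x) k"
    by (rule ups_upper)
  also have "ent (dU (norm_pt x) dnorm) k k
      = to_slice x k * (ent (dU x v) k k + (dlog k - dlog (w k)) * Ud x k) / to_slice x (w k)"
    unfolding dU_dnorm ent_times_diagonal ent_diagonal_times ent_add ent_minus
    by (simp add: divide_inverse algebra_simps)
  also have "\<dots> / Ud (norm_pt x) k = (ent (dU x v) k k + (dlog k - dlog (w k)) * Ud x k) / Ud x k"
    using to_slice_nz[OF x, of k] to_slice_nz[OF x, of "w k"]
    by (simp add: norm_pt_def Um_torus_diag[OF to_slice_nz[OF x]])
  also have "\<dots> = ups x v k + dlog k - dlog (w k)"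
    using u Um_diag_nz[OF u(1), of k] by (simp add: ups_upper add_divide_distrib)
  finally show ?thesis .
qed

lemma ups_dnorm_off: "k < n \<Longrightarrow> k \<notin> M \<Longrightarrow> ups (norm_pt x) dnorm k = 0"
  by (simp add: ups_dnorm dlog_step)

lemma dquot: "dmap quot x v = lower_tangent (quot x) dnorm"
proof
  fix g
  show "dmap quot x v g = lower_tangent (quot x) dnorm g"
  proof (cases g)
    case (Crossing j)
    show ?thesis
    proof (cases "j < length \<beta>")
      case True
      let ?a = "word_perm (take j \<beta>) (\<beta> ! j + 1)" and ?b = "word_perm (take j \<beta>) (\<beta> ! j)"
      have "dmap quot x v g = dderiv (\<lambda>x. to_slice x ?a * from_slice x ?b * x j) x v"
        using Crossing True by (simp add: dmap_def quot_def)
      also have "\<dots> = to_slice x ?a * from_slice x ?b * (v j + (dlog ?a - dlog ?b) * x j)"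
        using True by (simp add: dd_mult regular.mult regular_to_slice regular_from_slice regular.coord dtt dti algebra_simps)
      finally show ?thesis
        using Crossing True
        by (simp add: lower_tangent_def dnorm_def torus_act_def torus_inf_def nth_append from_slice_eq[OF x] divide_inverse)
    next
      case False
      then show ?thesis using Crossing by (simp add: dmap_def quot_def lower_tangent_def)
    qed
  next
    case (Marked m)
    show ?thesis
    proof (cases "m \<in> M")
      case True
      have "dmap quot x v g = dderiv (\<lambda>x. - (Vd x m * to_slice x (w m) * from_slice x m)) x v"
        using Marked True by (simp add: dmap_def quot_def)
      also have "\<dots> = - (Vd x m * to_slice x (w m) * from_slice x m) * (dlog (w m) - dlog m - ups x v m)"
        by (simp add: dd_uminus dd_mult regular.mult regular_to_slice regular_from_slice regular_Vd dtt dti dVd algebra_simps)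
      also have "- (Vd x m * to_slice x (w m) * from_slice x m) = tau (quot x) m"
        using True by (simp add: tau_eq quot_def)
      finally show ?thesis
        using Marked True by (simp add: lower_tangent_def sec_quot[OF x] ups_dnorm algebra_simps)
    next
      case False
      then show ?thesis using Marked by (simp add: dmap_def quot_def lower_tangent_def)
    qed
  qed
qed

lemma dquot_tangent: "dmap quot x v \<in> tangent AV (quot x)"
  unfolding dquot using dnorm_tangent ups_dnorm_off
  by (intro lower_tangent(1)[OF quot_points[OF x]]) (simp_all add: sec_quot[OF x])

text \<open>Without variation at unmarked strands, \<open>dlog\<close> is constant along them and 0
  on A, so it vanishes: the normalizing element is stationary.\<close>

lemma dnorm_slice:
  assumes off: "\<And>k. k < n \<Longrightarrow> k \<notin> M \<Longrightarrow> ups x v k = 0"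
  shows "dnorm = torus_act \<eta> (to_slice x) v"
proof -
  have d: "dlog k = 0" if "k < n" for k
    by (rule const_one[OF _ dlog_A that]) (simp add: dlog_step off)
  have "torus_inf \<eta> dlog x j = 0" for j
  proof -
    have "word_perm (take j \<eta>) (\<eta> ! j + 1) < n" "word_perm (take j \<eta>) (\<eta> ! j) < n" if "j < N"
      using braid_word_nth[OF eta, of j] that
      by (simp_all only: length_append Suc_eq_plus1 word_perm_less[OF braid_word_take[OF eta]])
        (auto intro!: word_perm_less[OF braid_word_take[OF eta]] simp del: take_append)
    then show ?thesis by (simp add: torus_inf_def d)
  qed
  then show ?thesis by (simp add: dnorm_def)
qed

end

section \<open>Tangent spaces of the quotient\<close>

lemma lower_tangent_dsec:
  assumes p: "p \<in> points AV" and u: "u \<in> tangent AV p"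
  shows "lower_tangent p (dmap sec p u) = u"
proof
  fix g
  have z: "u g = 0" if "g \<notin> idx AV" using u that by (auto simp: tangent_AV coord_space_def)
  show "lower_tangent p (dmap sec p u) g = u g"
  proof (cases g)
    case (Crossing j)
    then show ?thesis using z by (auto simp: lower_tangent_def dsec_crossing idx_AV)
  next
    case (Marked m)
    then show ?thesis using z ups_dsec[OF p u, of m] M_less[of m] tau_nz[OF p, of m]
      by (auto simp: lower_tangent_def idx_AV dtau_def)
  qed
qed

lemma ups_dsec_off:
  "p \<in> points AV \<Longrightarrow> u \<in> tangent AV p \<Longrightarrow> k < n \<Longrightarrow> k \<notin> M \<Longrightarrow> ups (sec p) (dmap sec p u) k = 0"
  by (simp add: ups_dsec dtau_def)

lemma dquot_slice:
  assumes x: "x \<in> points X" and v: "v \<in> tangent X x" and u: "u \<in> tangent AV (quot x)"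
    and tv: "torus_act \<eta> (to_slice x) v = dmap sec (quot x) u"
  shows "dmap quot x v = u"
proof -
  have "ups x v k = 0" if "k < n" "k \<notin> M" for k
    using ups_dsec_off[OF quot_points[OF x] u that] ups_torus[where t="to_slice x" and k=k, OF to_slice_nz[OF x] x v]
    by (simp add: sec_quot[OF x] norm_pt_def tv)
  then have "dnorm x v = dmap sec (quot x) u" using dnorm_slice[OF x v] tv by simp
  then show ?thesis
    using lower_tangent_dsec[OF quot_points[OF x] u] by (simp add: dquot[OF x v])
qed

lemma dquot_dsec:
  assumes p: "p \<in> points AV" and u: "u \<in> tangent AV p"
  shows "dmap quot (sec p) (dmap sec p u) = u"
proof (rule dquot_slice[OF sec_points[OF p] dsec_tangent[OF p u]])
  have "torus_act \<eta> (to_slice (sec p)) (dmap sec p u) = torus_act \<eta> (\<lambda>_. 1) (dmap sec p u)"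
    by (rule torus_act_cong[OF eta to_slice_slice[OF p]])
  then show "torus_act \<eta> (to_slice (sec p)) (dmap sec p u) = dmap sec (quot (sec p)) u"
    using dsec_tangent[OF p u] by (simp add: quot_sec[OF p] torus_act_one tangent_X)
qed (simp add: quot_sec[OF p] u)

text \<open>A preimage of u is its image under the section, translated back to x by the inverse of
  the normalizing torus element.\<close>

lemma dquot_image:
  assumes x: "x \<in> points X"
  shows "dmap quot x ` tangent X x = tangent AV (quot x)"
proof (intro equalityI subsetI)
  fix u assume "u \<in> dmap quot x ` tangent X x"
  then show "u \<in> tangent AV (quot x)" using dquot_tangent[OF x] by blast
next
  fix u assume u: "u \<in> tangent AV (quot x)"
  let ?t = "\<lambda>k. inverse (to_slice x k)"
  let ?u = "dmap sec (quot x) u" and ?v = "torus_act \<eta> ?t (dmap sec (quot x) u)"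
  have nz: "?t k \<noteq> 0" for k by (simp add: to_slice_nz[OF x])
  have tu: "?u \<in> tangent X (norm_pt x)" using dsec_tangent[OF quot_points[OF x] u] by (simp add: sec_quot[OF x])
  have back_x: "torus_act \<eta> ?t (norm_pt x) = x"
    using x by (simp add: norm_pt_def torus_act_mult to_slice_nz[OF x] torus_act_one points_X)
  have v: "?v \<in> tangent X x" using torus_tangent[where t="?t", OF nz tu] unfolding back_x .
  have "torus_act \<eta> (to_slice x) ?v = ?u"
    using tu by (simp add: torus_act_mult to_slice_nz[OF x] torus_act_one tangent_X)
  from dquot_slice[OF x v u this] show "u \<in> dmap quot x ` tangent X x" using v by (metis imageI)
qed

lemma morphism_quot: "morphism X AV quot"
  unfolding morphism_def using regular_quot quot_coord quot_points by blast

lemma morphism_sec: "morphism AV X sec"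
  unfolding morphism_def using regular_sec sec_coord sec_points by (simp add: image_subset_iff)

text \<open>An invariant function f descends to f composed with the section, because
  \<open>sec (quot x)\<close> lies in the torus orbit of x.\<close>

lemma geometric_quotient_quot: "geometric_quotient X (torus_act \<eta> ` torus_c n A) AV quot"
  unfolding geometric_quotient_def torus_c_T0
proof (intro conjI ballI impI)
  show "morphism X AV quot" by (rule morphism_quot)
  show "quot ` points X = points AV"
  proof (intro equalityI subsetI)
    fix p assume p: "p \<in> points AV"
    show "p \<in> quot ` points X" using quot_sec[OF p] sec_points[OF p] by (metis imageI)
  qed (use quot_points in auto)
  show "(quot x = quot y) = (\<exists>g\<in>torus_act \<eta> ` T0. y = g x)" if "x \<in> points X" "y \<in> points X" for x y
    using quot_eq_iff[OF that] by auto
  show "dmap quot x ` tangent X x = tangent AV (quot x)" if "x \<in> points X" for x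
    by (rule dquot_image[OF that])
  fix f assume f: "f \<in> regular X" and inv: "\<forall>x\<in>points X. \<forall>g\<in>torus_act \<eta> ` T0. f (g x) = f x"
  show "\<exists>h\<in>regular AV. \<forall>x\<in>points X. f x = h (quot x)"
  proof (intro bexI ballI)
    show "(\<lambda>p. f (sec p)) \<in> regular AV"
      by (rule regular_compose[OF f]) (simp_all add: regular_sec)
    show "f x = f (sec (quot x))" if x: "x \<in> points X" for x
      using inv x to_slice_T0[OF x] by (simp add: sec_quot[OF x] norm_pt_def)
  qed
qed

lemma braid_form_tangent:
  assumes "u \<in> tangent X x" "v \<in> tangent X x"
  shows "braid_form n (\<beta> @ delta n @ delta n) y u v = wform \<eta> y u v"
proof -
  have "braid_word n (\<beta> @ delta n @ delta n)"
    using eta braid_word_delta[of n] by (auto simp: braid_word_def)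
  then show ?thesis
    using wform_append[of u \<eta> v "delta n" y] assms by (simp add: braid_form_eq tangent_X)
qed

end

theorem theorem3p14:
  fixes n :: nat and \<beta> :: "nat list" and A M :: "nat set"
  assumes "n \<ge> 1" and "braid_word n \<beta>"
    and "cycle_transversal n \<beta> A" and "cycle_transversal n \<beta> M"
  defines "X \<equiv> X0 n (\<beta> @ delta n) (w0 n)"
    and "\<A> \<equiv> Aug n \<beta> M"
    and "T\<^sub>c \<equiv> torus_act (\<beta> @ delta n) ` torus_c n A"
    and "\<omega> \<equiv> braid_form n (\<beta> @ delta n @ delta n)"
  shows "\<exists>q \<sigma> \<Omega>.
     \<comment> \<open>the identification of the augmentation variety with the quotient, and its canonical section\<close>
     geometric_quotient X T\<^sub>c \<A> q \<and>
     morphism \<A> X \<sigma> \<and>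
     (\<forall>p\<in>points \<A>. q (\<sigma> p) = p \<and> (\<forall>k<length \<beta>. \<sigma> p k = p (Crossing k))) \<and>
     \<comment> \<open>the induced form: \<open>\<omega>\<close> is torus-invariant, and \<open>\<Omega>\<close> is its pullback to the slice \<open>\<sigma>(\<A>)\<close>;
       if a form on the quotient pulls back to \<open>\<omega>\<close> on \<open>X\<close>, it is \<open>\<Omega>\<close>\<close>
     (\<forall>g\<in>T\<^sub>c. \<forall>x\<in>points X. \<forall>u\<in>tangent X x. \<forall>v\<in>tangent X x.
        \<omega> (g x) (dmap g x u) (dmap g x v) = \<omega> x u v) \<and>
     (\<forall>p\<in>points \<A>. \<forall>u\<in>tangent \<A> p. \<forall>v\<in>tangent \<A> p.
        \<Omega> p u v = \<omega> (\<sigma> p) (dmap \<sigma> p u) (dmap \<sigma> p v)) \<and>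
     (\<forall>\<Omega>'. (\<forall>x\<in>points X. \<forall>u\<in>tangent X x. \<forall>v\<in>tangent X x.
                \<Omega>' (q x) (dmap q x u) (dmap q x v) = \<omega> x u v) \<longrightarrow>
        (\<forall>p\<in>points \<A>. \<forall>u\<in>tangent \<A> p. \<forall>v\<in>tangent \<A> p. \<Omega>' p u v = \<Omega> p u v)) \<and>
     \<comment> \<open>maximal rank at every point, and the symplectic conclusion\<close>
     maximal_rank \<A> \<Omega> \<and>
     holomorphic_symplectic \<A> \<Omega>"
proof -
  interpret braid_closure_torus n \<beta> M A
    by unfold_locales (use assms in auto)
  have form: "\<Omega> p u v = \<omega> (sec p) (dmap sec p u) (dmap sec p v)"
    if "p \<in> points \<A>" "u \<in> tangent \<A> p" "v \<in> tangent \<A> p" for p u v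
    using that unfolding \<A>_def \<omega>_def
    by (simp add: \<Omega>_def braid_form_tangent[OF dsec_tangent dsec_tangent])
  have invariant: "\<omega> (g x) (dmap g x u) (dmap g x v) = \<omega> x u v"
    if "g \<in> T\<^sub>c" "x \<in> points X" "u \<in> tangent X x" "v \<in> tangent X x" for g x u v
  proof -
    obtain t where t: "t \<in> T0" "g = torus_act (\<beta> @ delta n) t"
      using \<open>g \<in> T\<^sub>c\<close> unfolding T\<^sub>c_def torus_c_T0 by blast
    then have nz: "t k \<noteq> 0" for k by (simp add: T0_def)
    have uv: "u \<in> tangent (X0 n (\<beta> @ delta n) (w0 n)) x" "v \<in> tangent (X0 n (\<beta> @ delta n) (w0 n)) x"
      using that by (simp_all add: X_def)
    show ?thesis
      unfolding \<omega>_def t(2) dmap_torus_act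
        braid_form_tangent[OF torus_tangent[OF nz uv(1)] torus_tangent[OF nz uv(2)]] braid_form_tangent[OF uv]
      by (rule wform_torus_act[OF nz])
  qed
  have unique: "\<Omega>' p u v = \<Omega> p u v"
    if "\<forall>x\<in>points X. \<forall>u\<in>tangent X x. \<forall>v\<in>tangent X x. \<Omega>' (quot x) (dmap quot x u) (dmap quot x v) = \<omega> x u v"
      and p: "p \<in> points \<A>" "u \<in> tangent \<A> p" "v \<in> tangent \<A> p" for \<Omega>' p u v
  proof -
    \<comment> \<open>The pullback condition is evaluated on the slice, where the quotient map
      inverts the section together with its differential.\<close>
    have "\<Omega>' (quot (sec p)) (dmap quot (sec p) (dmap sec p u)) (dmap quot (sec p) (dmap sec p v))
        = \<omega> (sec p) (dmap sec p u) (dmap sec p v)"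
      using that(1) sec_points dsec_tangent p unfolding X_def \<A>_def by blast
    then show ?thesis
      using form[OF p] p unfolding \<A>_def by (simp add: quot_sec dquot_dsec)
  qed
  show ?thesis
  proof (intro exI[of _ quot] exI[of _ sec] exI[of _ \<Omega>] conjI)
    show "geometric_quotient X T\<^sub>c \<A> quot"
      unfolding X_def T\<^sub>c_def \<A>_def by (rule geometric_quotient_quot)
    show "morphism \<A> X sec" unfolding X_def \<A>_def by (rule morphism_sec)
    show "\<forall>p\<in>points \<A>. quot (sec p) = p \<and> (\<forall>k<length \<beta>. sec p k = p (Crossing k))"
      unfolding \<A>_def by (simp add: quot_sec)
    show "maximal_rank \<A> \<Omega>" "holomorphic_symplectic \<A> \<Omega>"
      unfolding \<A>_def by (rule maximal_rank_AV, rule symplectic_AV)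
  qed (use form invariant unique in blast)+
qed

end
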